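(* Consider Swap Bribery for $k$-approval, where $k$ is part of the input, restricted to instances in which the minimum cost of a swap is $1$ (every swap costs at least $1$). With combined parameter $(n,\beta)$, where $n$ is the number of votes and $\beta$ is the budget, this problem admits a kernel with $O(n^2\beta)$ votes and $O(n^2\beta^2)$ candidates.
   Context: Elections. An election consists of a set $C=\{c_1,\dots,c_m\}$ of candidates and votes $V=\{v_1,\dots,v_n\}$; each vote is a strict linear order over $C$ (several voters may have the same order), and $\mathrm{rank}(c,v)$ is the position of $c$ in $v$ (position $1$ is best). In $k$-approval, a candidate $c$ receives one point from $v$ if $\mathrm{rank}(c,v)\le k$ and zero points otherwise; the winners are all candidates with the highest total number of points (ties are allowed, so there may be several winners). Swaps. A swap in a vote $v$ is a triple $(v,a,b)$ with $a,b\in C$, $a\ne b$. It is admissible in $v$ if $\mathrm{rank}(a,v)=\mathrm{rank}(b,v)-1$; applying it exchanges the positions of $a$ and $b$ in $v$. A set $\Gamma$ of swaps is admissible in $v$ if its elements can be applied to $v$ one after the other in some order, each being admissible in the vote obtained so far; the resulting vote is $v^{\Gamma}$. This extends vote by vote to several votes, the resulting votes being denoted $V^{\Gamma}$. Swap Bribery for an election system $\mathcal{E}$: given an $\mathcal{E}$-election $(C,V)$, a preferred candidate $p\in C$, a cost function assigning to each possible swap in each vote a non-negative integer, and a budget $\beta\in\mathbb{N}$, decide whether there is an admissible set $\Gamma$ of swaps of total cost at most $\beta$ such that $p$ is a winner in the $\mathcal{E}$-election $(C,V^{\Gamma})$. Kernel. A kernelization for a parameterized problem is a polynomial-time algorithm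 transforming an instance $(I,\kappa)$ into an instance $(I',\kappa')$ of the same problem (the kernel) such that $(I,\kappa)$ is a yes-instance if and only if $(I',\kappa')$ is, and the size of $(I',\kappa')$ is bounded by a computable function of $\kappa$ only. Here the approval number $k$ is part of the instance and may be different in the kernel. *)

theory Defs
  imports
    "HOL-Combinatorics.Transposition"
    "HOL-Computational_Algebra.Polynomial"
begin

section \<open>Swap Bribery for k-approval\<close>

text \<open>A vote is a strict linear order, given as the list of all candidates from best to worst.\<close>

type_synonym vote = "nat list"

definition rank :: "nat \<Rightarrow> vote \<Rightarrow> nat" where
  "rank c v = length (takeWhile (\<lambda>x. x \<noteq> c) v) + 1"

definition admissible_swap :: "nat \<times> nat \<Rightarrow> vote \<Rightarrow> bool" where
  "admissible_swap = (\<lambda>(a, b) v. a \<in> set v \<and> b \<in> set v \<and> a \<noteq> b \<and> rank a v + 1 = rank b v)"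

text \<open>Renaming \<open>a\<close> to \<open>b\<close> and vice versa in the list exchanges the positions of \<open>a\<close> and \<open>b\<close>.\<close>

definition apply_swap :: "nat \<times> nat \<Rightarrow> vote \<Rightarrow> vote" where
  "apply_swap = (\<lambda>(a, b) v. map (transpose a b) v)"

fun admissible_seq :: "(nat \<times> nat) list \<Rightarrow> vote \<Rightarrow> bool" where
  "admissible_seq [] v \<longleftrightarrow> True"
| "admissible_seq (s # ss) v \<longleftrightarrow> admissible_swap s v \<and> admissible_seq ss (apply_swap s v)"

text \<open>\<open>swaps_to S v w\<close>: the set \<open>S\<close> of swaps is admissible in \<open>v\<close> and the resulting vote is \<open>w\<close>.
  The result does not depend on the order of application: the relative order of \<open>a\<close> and \<open>b\<close>
  in \<open>w\<close> is determined by \<open>v\<close> and by which of \<open>(a, b)\<close> and \<open>(b, a)\<close> belong to \<open>S\<close>.\<close>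

definition swaps_to :: "(nat \<times> nat) set \<Rightarrow> vote \<Rightarrow> vote \<Rightarrow> bool" where
  "swaps_to S v w \<longleftrightarrow>
     (\<exists>ss. distinct ss \<and> set ss = S \<and> admissible_seq ss v \<and> w = fold apply_swap ss v)"

definition score :: "nat \<Rightarrow> vote list \<Rightarrow> nat \<Rightarrow> nat" where
  "score k V c = card {i. i < length V \<and> rank c (V ! i) \<le> k}"

definition winner :: "nat \<Rightarrow> nat set \<Rightarrow> vote list \<Rightarrow> nat \<Rightarrow> bool" where
  "winner k C V c \<longleftrightarrow> c \<in> C \<and> (\<forall>d\<in>C. score k V d \<le> score k V c)"

text \<open>The candidates are \<open>0, \<dots>, num_cands - 1\<close>. Votes are addressed by their index, since several
  voters may have the same order; \<open>swap_cost I i a b\<close> is the cost of the swap \<open>(a, b)\<close> in vote \<open>i\<close>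
  and is meaningful only for triples in \<open>swaps I\<close> below.\<close>

record instance_sb =
  num_cands :: nat
  votes :: "vote list"
  approval :: nat
  preferred :: nat
  swap_cost :: "nat \<Rightarrow> nat \<Rightarrow> nat \<Rightarrow> nat"
  budget :: nat

abbreviation cands :: "instance_sb \<Rightarrow> nat set" where
  "cands I \<equiv> {..<num_cands I}"

abbreviation num_votes :: "instance_sb \<Rightarrow> nat" where
  "num_votes I \<equiv> length (votes I)"

definition is_instance :: "instance_sb \<Rightarrow> bool" where
  "is_instance I \<longleftrightarrow>
     preferred I \<in> cands I \<and> (\<forall>v\<in>set (votes I). distinct v \<and> set v = cands I)"

definition swaps :: "instance_sb \<Rightarrow> (nat \<times> nat \<times> nat) set" where
  "swaps I = {(i, a, b). i < num_votes I \<and> a \<in> cands I \<and> b \<in> cands I \<and> a \<noteq> b}"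

definition min_cost_one :: "instance_sb \<Rightarrow> bool" where
  "min_cost_one I \<longleftrightarrow> (\<forall>(i, a, b)\<in>swaps I. swap_cost I i a b \<ge> 1)"

definition instances :: "instance_sb set" where
  "instances = {I. is_instance I \<and> min_cost_one I}"

text \<open>\<open>W\<close> is the list of votes after applying \<open>S\<close>.\<close>

definition swap_bribery :: "instance_sb \<Rightarrow> bool" where
  "swap_bribery I \<longleftrightarrow>
     (\<exists>S W. S \<subseteq> swaps I \<and> length W = num_votes I \<and>
        (\<forall>i<num_votes I. swaps_to {(a, b). (i, a, b) \<in> S} (votes I ! i) (W ! i)) \<and>
        (\<Sum>(i, a, b)\<in>S. swap_cost I i a b) \<le> budget I \<and>
        winner (approval I) (cands I) W (preferred I))"

section \<open>Polynomial-time computation\<close>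

text \<open>
  The model of computation is Jones's WHILE language, whose only data are binary trees
  (Jones, Computability and Complexity from a Programming Perspective, 1997).
  An assignment is charged with the size of the assigned tree, so that the total size of the
  store never exceeds the size of the input plus the elapsed time. Consequently a Turing machine
  simulates a run of duration \<open>t\<close> on an input of size \<open>s\<close> in time polynomial in \<open>s + t\<close>, and
  conversely Turing machines are simulated with polynomial overhead: polynomial time has its
  usual meaning.\<close>

datatype tree = Leaf | Node tree tree

datatype expr = Var nat | LeafE | NodeE expr expr | LeftE expr | RightE expr

datatype com =
    Skip
  | Assign nat expr
  | Seq com com
  | If expr com com
  | While expr com

type_synonym store = "nat \<Rightarrow> tree"

fun left :: "tree \<Rightarrow> tree" where
  "left Leaf = Leaf"
| "left (Node l r) = l"

fun right :: "tree \<Rightarrow> tree" where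
  "right Leaf = Leaf"
| "right (Node l r) = r"

fun eval_expr :: "expr \<Rightarrow> store \<Rightarrow> tree" where
  "eval_expr (Var x) s = s x"
| "eval_expr LeafE s = Leaf"
| "eval_expr (NodeE e f) s = Node (eval_expr e s) (eval_expr f s)"
| "eval_expr (LeftE e) s = left (eval_expr e s)"
| "eval_expr (RightE e) s = right (eval_expr e s)"

text \<open>\<open>exec c s t s'\<close>: started in store \<open>s\<close>, the program \<open>c\<close> halts in store \<open>s'\<close> after time \<open>t\<close>.
  A test succeeds if it does not evaluate to \<open>Leaf\<close>. The automatically generated \<open>size\<close> of a tree
  is its number of inner nodes.\<close>

inductive exec :: "com \<Rightarrow> store \<Rightarrow> nat \<Rightarrow> store \<Rightarrow> bool" where
  Skip: "exec Skip s 1 s"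
| Assign: "exec (Assign x e) s (1 + size (eval_expr e s)) (s(x := eval_expr e s))"
| Seq: "exec c1 s1 t1 s2 \<Longrightarrow> exec c2 s2 t2 s3 \<Longrightarrow> exec (Seq c1 c2) s1 (t1 + t2) s3"
| IfTrue: "eval_expr e s \<noteq> Leaf \<Longrightarrow> exec c1 s t s' \<Longrightarrow> exec (If e c1 c2) s (1 + t) s'"
| IfFalse: "eval_expr e s = Leaf \<Longrightarrow> exec c2 s t s' \<Longrightarrow> exec (If e c1 c2) s (1 + t) s'"
| WhileFalse: "eval_expr e s = Leaf \<Longrightarrow> exec (While e c) s 1 s"
| WhileTrue: "eval_expr e s1 \<noteq> Leaf \<Longrightarrow> exec c s1 t1 s2 \<Longrightarrow> exec (While e c) s2 t2 s3 \<Longrightarrow>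
    exec (While e c) s1 (1 + t1 + t2) s3"

text \<open>Input and output are passed in variable \<open>0\<close>; all other variables are initially \<open>Leaf\<close>.\<close>

definition computes_in :: "com \<Rightarrow> tree \<Rightarrow> nat \<Rightarrow> tree \<Rightarrow> bool" where
  "computes_in c x t y \<longleftrightarrow> (\<exists>s. exec c ((\<lambda>_. Leaf)(0 := x)) t s \<and> s 0 = y)"

definition computable :: "('a \<Rightarrow> tree) \<Rightarrow> ('b \<Rightarrow> tree) \<Rightarrow> ('a \<Rightarrow> 'b) \<Rightarrow> bool" where
  "computable enc enc' f \<longleftrightarrow> (\<exists>c. \<forall>x. \<exists>t. computes_in c (enc x) t (enc' (f x)))"

definition poly_time_on :: "'a set \<Rightarrow> ('a \<Rightarrow> tree) \<Rightarrow> ('b \<Rightarrow> tree) \<Rightarrow> ('a \<Rightarrow> 'b) \<Rightarrow> bool" where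
  "poly_time_on A enc enc' f \<longleftrightarrow>
     (\<exists>c (q :: nat poly). \<forall>x\<in>A. \<exists>t \<le> poly q (size (enc x)). computes_in c (enc x) t (enc' (f x)))"

text \<open>Numbers are encoded in binary, least significant bit first.\<close>

fun enc_nat :: "nat \<Rightarrow> tree" where
  "enc_nat n =
     (if n = 0 then Leaf else Node (if odd n then Node Leaf Leaf else Leaf) (enc_nat (n div 2)))"

declare enc_nat.simps [simp del]

definition enc_list :: "('a \<Rightarrow> tree) \<Rightarrow> 'a list \<Rightarrow> tree" where
  "enc_list enc xs = foldr (\<lambda>x. Node (enc x)) xs Leaf"

definition enc_pair :: "('a \<Rightarrow> tree) \<Rightarrow> ('b \<Rightarrow> tree) \<Rightarrow> 'a \<times> 'b \<Rightarrow> tree" where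
  "enc_pair enc enc' = (\<lambda>(x, y). Node (enc x) (enc' y))"

text \<open>The cost function is encoded as one matrix per vote, with zeros on the diagonal.\<close>

definition cost_table :: "instance_sb \<Rightarrow> nat list list list" where
  "cost_table I =
     map (\<lambda>i. map (\<lambda>a. map (\<lambda>b. if a = b then 0 else swap_cost I i a b)
       [0..<num_cands I]) [0..<num_cands I]) [0..<num_votes I]"

definition enc_instance :: "instance_sb \<Rightarrow> tree" where
  "enc_instance I =
     enc_list id
       [enc_nat (num_cands I),
        enc_list (enc_list enc_nat) (votes I),
        enc_nat (approval I),
        enc_nat (preferred I),
        enc_list (enc_list (enc_list enc_nat)) (cost_table I),
        enc_nat (budget I)]"

section \<open>Kernelization\<close>

text \<open>A parameterized problem is given by a set \<open>A\<close> of instances, the property of being a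
  yes-instance, and the parameter \<open>par x\<close> of each instance \<open>x\<close>; instances and parameters come with
  encodings. The pairs of an instance and its parameter are what is transformed and measured.\<close>

definition kernelization ::
  "'a set \<Rightarrow> ('a \<Rightarrow> bool) \<Rightarrow> ('a \<Rightarrow> 'p) \<Rightarrow> ('a \<Rightarrow> tree) \<Rightarrow> ('p \<Rightarrow> tree) \<Rightarrow> ('a \<Rightarrow> 'a) \<Rightarrow> bool" where
  "kernelization A yes par enc encp K \<longleftrightarrow>
     (let enc_inst = (\<lambda>x. enc_pair enc encp (x, par x)) in
      (\<forall>x\<in>A. K x \<in> A \<and> (yes x \<longleftrightarrow> yes (K x))) \<and>
      poly_time_on A enc_inst enc_inst K \<and>
      (\<exists>g. computable encp enc_nat g \<and> (\<forall>x\<in>A. size (enc_inst (K x)) \<le> g (par x))))"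

definition param_n_budget :: "instance_sb \<Rightarrow> nat \<times> nat" where
  "param_n_budget I = (num_votes I, budget I)"

end

theory Submission
  imports Defs
begin

text \<open>
  A set of swaps leading from a vote \<open>v\<close> to a vote \<open>w\<close> contains all inversions between \<open>v\<close> and
  \<open>w\<close>, and these suffice (bubble sort), so one only chooses the new votes and pays for the
  inversions. Since every swap costs at least \<open>1\<close>, a candidate at distance more than \<open>\<beta>\<close> from the
  approval boundary of a vote cannot cross it, and permuting the \<open>2\<beta>\<close> candidates around the boundary
  is enough. A candidate that is in no such window has a fixed score, and of these candidates only
  one with maximal score matters. The kernel therefore keeps the votes, restricted to the at most
  \<open>2n\<beta> + 2\<close> relevant candidates. Dropping approved candidates shifts the boundary; this is repaired by
  dummies approved in front of the vote. Each dummy is approved in at most one vote, which is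
  harmless since a winner has at least one point, and any swap that involves a dummy costs \<open>\<beta> + 1\<close>.
  This gives \<open>n\<close> votes and \<open>O(n\<^sup>2\<beta>)\<close> candidates. The case \<open>\<beta> = 0\<close> is decided directly.
\<close>

section \<open>Polynomial-time functions\<close>

text \<open>A large share of the work is computational, because \<open>poly_time_on\<close> asks for
  a WHILE program. The program is never written out: \<open>ptime\<close> is closed under
  composition, pairing, conditionals and folds with bounded accumulators, and the kernel is defined
  by list functions that these rules cover. This explains its searches through enumerated lists. In
  the combinatorial share the obstacle is the common approval number: the number of deleted approved
  candidates differs from vote to vote. Each vote therefore has its own dummies, one for each kept
  candidate, and approves those whose kept candidate it does not approve. Every vote then approves
  \<open>length R\<close> candidates in total. This multiplies the number of candidates by
  \<open>n + 1\<close>, where \<open>n\<close> is the number of votes. Costs in the input are not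
  bounded by the parameter, so they are cut off at \<beta> + 1; this preserves which sets of swaps
  are affordable. For \<beta> = 0 even keeping the votes would be too much, since the claimed bound
  on their number is then constant.\<close>

lemma poly_nat_mono: "m \<le> n \<Longrightarrow> poly (p :: nat poly) m \<le> poly p n"
  by (induction p) (auto intro!: add_mono mult_mono)

section \<open>Composable WHILE programs and bounded loops\<close>

definition runs :: "com \<Rightarrow> store \<Rightarrow> nat \<Rightarrow> store \<Rightarrow> bool" where
  "runs c s T s' \<longleftrightarrow> (\<exists>t\<le>T. exec c s t s')"

lemma runs_mono: "runs c s T s' \<Longrightarrow> T \<le> T' \<Longrightarrow> runs c s T' s'"
  by (auto simp: runs_def intro: order_trans)

lemma runs_Assign: "runs (Assign x e) s (1 + size (eval_expr e s)) (s(x := eval_expr e s))"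
  unfolding runs_def using exec.Assign by blast

lemma runs_Seq: "runs c1 s1 T1 s2 \<Longrightarrow> runs c2 s2 T2 s3 \<Longrightarrow> runs (Seq c1 c2) s1 (T1 + T2) s3"
  unfolding runs_def by (meson add_mono exec.Seq)

lemma runs_IfTrue: "eval_expr e s \<noteq> Leaf \<Longrightarrow> runs c1 s T s' \<Longrightarrow> runs (If e c1 c2) s (1 + T) s'"
  unfolding runs_def by (meson add_mono exec.IfTrue order_refl)

lemma runs_IfFalse: "eval_expr e s = Leaf \<Longrightarrow> runs c2 s T s' \<Longrightarrow> runs (If e c1 c2) s (1 + T) s'"
  unfolding runs_def by (meson add_mono exec.IfFalse order_refl)

lemma runs_WhileFalse: "eval_expr e s = Leaf \<Longrightarrow> runs (While e c) s 1 s"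
  unfolding runs_def using exec.WhileFalse by blast

lemma runs_WhileTrue:
  "eval_expr e s1 \<noteq> Leaf \<Longrightarrow> runs c s1 T1 s2 \<Longrightarrow> runs (While e c) s2 T2 s3 \<Longrightarrow>
    runs (While e c) s1 (1 + T1 + T2) s3"
  unfolding runs_def by (meson add_mono exec.WhileTrue order_refl)

text \<open>The program must work from an arbitrary store and leave all variables from \<open>N\<close> on untouched,
  so that programs can be composed without renaming: a caller saves its data above \<open>N\<close>.\<close>

definition implements :: "com \<Rightarrow> nat \<Rightarrow> nat poly \<Rightarrow> ('a \<Rightarrow> tree) \<Rightarrow> ('b \<Rightarrow> tree) \<Rightarrow> ('a \<Rightarrow> 'b) \<Rightarrow> bool" where
  "implements c N q ea eb f \<longleftrightarrow>
     (\<forall>x. size (eb (f x)) \<le> poly q (size (ea x)) \<and>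
       (\<forall>s. s 0 = ea x \<longrightarrow>
         (\<exists>s'. runs c s (poly q (size (ea x))) s' \<and> s' 0 = eb (f x) \<and> (\<forall>y\<ge>N. s' y = s y))))"

text \<open>All values of the type are inputs, not only valid instances, so the closure rules have
  no side conditions; in return, values such as \<open>hd []\<close> must be computed as well. The
  size bound inside \<open>implements\<close> is what the next program of a composition
  needs.\<close>

definition ptime :: "('a \<Rightarrow> tree) \<Rightarrow> ('b \<Rightarrow> tree) \<Rightarrow> ('a \<Rightarrow> 'b) \<Rightarrow> bool" where
  "ptime ea eb f \<longleftrightarrow> (\<exists>c N q. implements c N q ea eb f)"

lemma implements_size: "implements c N q ea eb f \<Longrightarrow> size (eb (f x)) \<le> poly q (size (ea x))"
  by (simp add: implements_def)

lemma implements_runs: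
  assumes "implements c N q ea eb f" "(s :: store) 0 = ea x"
  obtains s' where "runs c s (poly q (size (ea x))) s'" "s' 0 = eb (f x)" "\<forall>y\<ge>N. s' y = s y"
  using assms unfolding implements_def by meson

lemma ptimeI:
  assumes "\<And>x. size (eb (f x)) \<le> poly q (size (ea x))"
    and "\<And>x (s :: store). s 0 = ea x \<Longrightarrow>
      \<exists>s'. runs c s (poly q (size (ea x))) s' \<and> s' 0 = eb (f x) \<and> (\<forall>y\<ge>N. s' y = s y)"
  shows "ptime ea eb f"
  unfolding ptime_def implements_def using assms by blast

lemma ptime_size:
  assumes "ptime ea eb f"
  obtains q :: "nat poly" where "\<And>x. size (eb (f x)) \<le> poly q (size (ea x))"
  using assms by (auto simp: ptime_def implements_def)

lemma ptime_Assign: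
  assumes "\<And>x (s :: store). s 0 = ea x \<Longrightarrow> eval_expr e s = eb (f x)"
    and "\<And>x. size (eb (f x)) \<le> poly q (size (ea x))"
  shows "ptime ea eb f"
proof (rule ptimeI)
  fix x and s :: store assume s: "s 0 = ea x"
  show "\<exists>s'. runs (Assign 0 e) s (poly (q + [:1:]) (size (ea x))) s' \<and> s' 0 = eb (f x) \<and> (\<forall>y\<ge>1. s' y = s y)"
    using runs_mono[OF runs_Assign[of 0 e s]] assms(1)[of s x, OF s] assms(2)[of x]
    by (intro exI[of _ "s(0 := eval_expr e s)"]) auto
next
  show "size (eb (f x)) \<le> poly (q + [:1:]) (size (ea x))" for x
    using assms(2)[of x] by auto
qed

lemma ptime_recode:
  assumes "\<And>x. eb (f x) = ea x"
  shows "ptime ea eb f"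
  by (rule ptime_Assign[where e="Var 0" and q="[:0, 1:]"]) (auto simp: assms)

lemma ptime_id: "ptime e e (\<lambda>x. x)"
  by (rule ptime_recode) simp

fun tree_expr :: "tree \<Rightarrow> expr" where
  "tree_expr Leaf = LeafE"
| "tree_expr (Node l r) = NodeE (tree_expr l) (tree_expr r)"

lemma eval_tree_expr: "eval_expr (tree_expr t) s = t"
  by (induction t) auto

lemma ptime_const: "ptime e eb (\<lambda>_. c)"
  by (rule ptime_Assign[where e="tree_expr (eb c)" and q="[:size (eb c):]"])
    (auto simp: eval_tree_expr)

lemma ptime_comp:
  assumes "ptime eb ec g" "ptime ea eb f"
  shows "ptime ea ec (\<lambda>x. g (f x))"
proof -
  from assms obtain c N q d M r where c: "implements c N q ea eb f" and d: "implements d M r eb ec g"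
    unfolding ptime_def by blast
  have le: "poly r (size (eb (f x))) \<le> poly (pcompose r q) (size (ea x))" for x
    using implements_size[OF c, of x] by (simp add: poly_pcompose poly_nat_mono)
  show ?thesis
  proof (rule ptimeI[where c="Seq c d" and N="max N M" and q="q + pcompose r q"])
    fix x
    show "size (ec (g (f x))) \<le> poly (q + pcompose r q) (size (ea x))"
      using implements_size[OF d, of "f x"] le[of x] by simp
    fix s :: store assume s: "s 0 = ea x"
    obtain s1 where s1: "runs c s (poly q (size (ea x))) s1" "s1 0 = eb (f x)" "\<forall>y\<ge>N. s1 y = s y"
      by (rule implements_runs[where s=s and x=x, OF c s])
    obtain s2 where s2: "runs d s1 (poly r (size (eb (f x)))) s2" "s2 0 = ec (g (f x))" "\<forall>y\<ge>M. s2 y = s1 y"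
      by (rule implements_runs[where s=s1 and x="f x", OF d s1(2)])
    have "runs (Seq c d) s (poly (q + pcompose r q) (size (ea x))) s2"
      using runs_mono[OF runs_Seq[OF s1(1) s2(1)]] le[of x] by simp
    then show "\<exists>s'. runs (Seq c d) s (poly (q + pcompose r q) (size (ea x))) s' \<and>
        s' 0 = ec (g (f x)) \<and> (\<forall>y\<ge>max N M. s' y = s y)"
      using s1 s2 by auto
  qed
qed

lemma size_enc_pair: "size (enc_pair ea eb z) = Suc (size (ea (fst z)) + size (eb (snd z)))"
  by (simp add: enc_pair_def split_beta)

lemma ptime_fst: "ptime e (enc_pair ea eb) f \<Longrightarrow> ptime e ea (\<lambda>x. fst (f x))"
  by (rule ptime_comp[rotated], assumption)
    (rule ptime_Assign[where e="LeftE (Var 0)" and q="[:0, 1:]"],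
      auto simp: enc_pair_def size_enc_pair)

lemma ptime_snd: "ptime e (enc_pair ea eb) f \<Longrightarrow> ptime e eb (\<lambda>x. snd (f x))"
  by (rule ptime_comp[rotated], assumption)
    (rule ptime_Assign[where e="RightE (Var 0)" and q="[:0, 1:]"],
      auto simp: enc_pair_def size_enc_pair)

text \<open>Both programs expect the input in variable 0 and may overwrite it. The input is
  therefore kept in variable \<open>N\<close> and the first result in \<open>Suc N\<close>, which
  neither program touches.\<close>

lemma ptime_pair:
  assumes "ptime e ea f" "ptime e eb g"
  shows "ptime e (enc_pair ea eb) (\<lambda>x. (f x, g x))"
proof -
  from assms obtain c N0 q d M0 r where c0: "implements c N0 q e ea f" and d0: "implements d M0 r e eb g"
    unfolding ptime_def by blast
  \<comment> \<open>The successor makes \<open>N\<close> differ from the input variable 0.\<close>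
  define N where "N = Suc (max N0 M0)"
  have c: "implements c N q e ea f" and d: "implements d N r e eb g"
    using c0 d0 unfolding implements_def N_def by (meson Suc_leD max.boundedE)+
  have N0: "N \<noteq> 0" by (simp add: N_def)
  define prog where "prog = Seq (Assign N (Var 0)) (Seq c (Seq (Assign (Suc N) (Var 0))
    (Seq (Assign 0 (Var N)) (Seq d (Assign 0 (NodeE (Var (Suc N)) (Var 0)))))))"
  define Q where "Q = q + q + q + r + r + r + [:0, 2:] + [:10:]"
  show ?thesis
  proof (rule ptimeI[where c=prog and N="N + 2" and q=Q])
    fix x
    show "size (enc_pair ea eb (f x, g x)) \<le> poly Q (size (e x))"
      using implements_size[OF c, of x] implements_size[OF d, of x] by (simp add: Q_def size_enc_pair)
    fix s :: store assume s: "s 0 = e x"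
    define s0 where "s0 = s(N := e x)"
    have s0: "s0 0 = e x" using s N0 by (simp add: s0_def)
    obtain s1 where s1: "runs c s0 (poly q (size (e x))) s1" "s1 0 = ea (f x)" "\<forall>y\<ge>N. s1 y = s0 y"
      by (rule implements_runs[where s=s0 and x=x, OF c s0])
    define s2 where "s2 = s1(Suc N := ea (f x), 0 := e x)"
    have s2: "s2 0 = e x" by (simp add: s2_def)
    obtain s3 where s3: "runs d s2 (poly r (size (e x))) s3" "s3 0 = eb (g x)" "\<forall>y\<ge>N. s3 y = s2 y"
      by (rule implements_runs[where s=s2 and x=x, OF d s2])
    have r0: "runs (Assign N (Var 0)) s (1 + size (e x)) s0"
      using runs_Assign[of N "Var 0" s] s by (simp add: s0_def)
    have r1: "runs (Assign (Suc N) (Var 0)) s1 (1 + size (ea (f x))) (s1(Suc N := ea (f x)))"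
      using runs_Assign[of "Suc N" "Var 0" s1] s1 by simp
    have r2: "runs (Assign 0 (Var N)) (s1(Suc N := ea (f x))) (1 + size (e x)) s2"
      using runs_Assign[of 0 "Var N" "s1(Suc N := ea (f x))"] s1 by (simp add: s2_def s0_def)
    have r3: "runs (Assign 0 (NodeE (Var (Suc N)) (Var 0))) s3
        (2 + size (ea (f x)) + size (eb (g x))) (s3(0 := enc_pair ea eb (f x, g x)))"
      using runs_Assign[of 0 "NodeE (Var (Suc N)) (Var 0)" s3] s3
      by (simp add: s2_def enc_pair_def)
    have "runs prog s (poly Q (size (e x))) (s3(0 := enc_pair ea eb (f x, g x)))"
      unfolding prog_def
      by (rule runs_mono, (rule runs_Seq, rule r0 r1 r2 s1(1) s3(1))+, rule r3)
        (use implements_size[OF c, of x] implements_size[OF d, of x] in \<open>simp add: Q_def\<close>)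
    then show "\<exists>s'. runs prog s (poly Q (size (e x))) s' \<and>
        s' 0 = enc_pair ea eb (f x, g x) \<and> (\<forall>y\<ge>N + 2. s' y = s y)"
      using s3 s1 N0 by (intro exI[of _ "s3(0 := enc_pair ea eb (f x, g x))"]) (auto simp: s2_def s0_def)
  qed
qed

text \<open>\<open>Leaf\<close> is the only tree on which a test fails, so an encoded truth value
  can be tested directly. The same two trees are the digits of \<open>enc_nat\<close>.\<close>

definition enc_bool :: "bool \<Rightarrow> tree" where
  "enc_bool b = (if b then Node Leaf Leaf else Leaf)"

lemma size_enc_bool: "size (enc_bool b) \<le> 1"
  by (simp add: enc_bool_def)

text \<open>The condition is computed first and paired with the input, so that the chosen branch
  still finds the original input.\<close>

lemma ptime_if:
  fixes e :: "'a \<Rightarrow> tree"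
  assumes "ptime e enc_bool P" "ptime e eb f" "ptime e eb g"
  shows "ptime e eb (\<lambda>x. if P x then f x else g x)"
proof -
  have "ptime e (enc_pair enc_bool e) (\<lambda>x. (P x, x))"
    by (intro ptime_pair assms ptime_id)
  moreover have "ptime (enc_pair enc_bool e) eb (\<lambda>(b, x). if b then f x else g x)"
  proof -
    from assms obtain c N0 q d M0 r where c0: "implements c N0 q e eb f" and d0: "implements d M0 r e eb g"
      unfolding ptime_def by blast
    define N where "N = Suc (max N0 M0)"
    have c: "implements c N q e eb f" and d: "implements d N r e eb g"
      using c0 d0 unfolding implements_def N_def by (meson Suc_leD max.boundedE)+
    have N0: "N \<noteq> 0" by (simp add: N_def)
    define prog where "prog = Seq (Assign N (LeftE (Var 0))) (Seq (Assign 0 (RightE (Var 0))) (If (Var N) c d))"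
    define Q where "Q = q + r + [:0, 1:] + [:5:]"
    show ?thesis
    proof (rule ptimeI[where c=prog and N="N + 1" and q=Q])
      fix z :: "bool \<times> 'a"
      obtain b x where z: "z = (b, x)" by (cases z)
      let ?m = "size (enc_pair enc_bool e z)"
      have qr: "poly q (size (e x)) \<le> poly q ?m" "poly r (size (e x)) \<le> poly r ?m"
        by (rule poly_nat_mono, simp add: z size_enc_pair)+
      show "size (eb (case z of (b, x) \<Rightarrow> if b then f x else g x)) \<le> poly Q ?m"
        using implements_size[OF c, of x] implements_size[OF d, of x] qr
        by (cases b) (simp_all add: Q_def z)
      fix s :: store assume s: "s 0 = enc_pair enc_bool e z"
      define s1 where "s1 = s(N := enc_bool b, 0 := e x)"
      have s1: "s1 0 = e x" by (simp add: s1_def)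
      have r0: "runs (Assign N (LeftE (Var 0))) s (1 + size (enc_bool b)) (s(N := enc_bool b))"
        using runs_Assign[of N "LeftE (Var 0)" s] s by (simp add: z enc_pair_def)
      have r1: "runs (Assign 0 (RightE (Var 0))) (s(N := enc_bool b)) (1 + size (e x)) s1"
        using runs_Assign[of 0 "RightE (Var 0)" "s(N := enc_bool b)"] s N0
        by (simp add: z enc_pair_def s1_def)
      have "\<exists>s'. runs (If (Var N) c d) s1 (1 + (if b then poly q (size (e x)) else poly r (size (e x)))) s' \<and>
        s' 0 = eb (if b then f x else g x) \<and> (\<forall>y\<ge>N. s' y = s1 y)"
      proof (cases b)
        case True
        obtain s' where "runs c s1 (poly q (size (e x))) s'" "s' 0 = eb (f x)" "\<forall>y\<ge>N. s' y = s1 y"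
          by (rule implements_runs[where s=s1 and x=x, OF c s1])
        then show ?thesis using True N0
          by (intro exI[of _ s']) (auto intro!: runs_IfTrue[simplified] simp: s1_def enc_bool_def)
      next
        case False
        obtain s' where "runs d s1 (poly r (size (e x))) s'" "s' 0 = eb (g x)" "\<forall>y\<ge>N. s' y = s1 y"
          by (rule implements_runs[where s=s1 and x=x, OF d s1])
        then show ?thesis using False N0
          by (intro exI[of _ s']) (auto intro!: runs_IfFalse[simplified] simp: s1_def enc_bool_def)
      qed
      then obtain s2 where s2:
        "runs (If (Var N) c d) s1 (1 + (if b then poly q (size (e x)) else poly r (size (e x)))) s2"
        "s2 0 = eb (if b then f x else g x)" "\<forall>y\<ge>N. s2 y = s1 y" by blast
      have "runs prog s (poly Q ?m) s2"
        unfolding prog_def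
        by (rule runs_mono, (rule runs_Seq, rule r0 r1)+, rule s2(1))
          (use qr size_enc_bool[of b] in \<open>cases b; simp add: Q_def z size_enc_pair\<close>)
      then show "\<exists>s'. runs prog s (poly Q ?m) s' \<and>
        s' 0 = eb (case z of (b, x) \<Rightarrow> if b then f x else g x) \<and> (\<forall>y\<ge>N + 1. s' y = s y)"
        using s2 N0 by (intro exI[of _ s2]) (auto simp: s1_def z)
    qed
  qed
  ultimately show ?thesis
    using ptime_comp[of "enc_pair enc_bool e" eb "\<lambda>(b, x). if b then f x else g x" e "\<lambda>x. (P x, x)"] by simp
qed

lemma enc_list_simps [simp]:
  "enc_list e [] = Leaf" "enc_list e (x # xs) = Node (e x) (enc_list e xs)"
  by (simp_all add: enc_list_def)

lemma size_enc_list: "size (enc_list e xs) = (\<Sum>x\<leftarrow>xs. Suc (size (e x)))"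
  by (induction xs) auto

lemma length_le_size: "length xs \<le> size (enc_list e xs)"
  by (induction xs) auto

lemma size_elem_le: "x \<in> set xs \<Longrightarrow> size (e x) < size (enc_list e xs)"
  by (induction xs) auto

text \<open>Variable \<open>N\<close> holds the fixed argument, \<open>N + 1\<close> the rest of the
  list and \<open>N + 2\<close> the accumulator. An encoded nonempty list is never
  \<open>Leaf\<close>, so the list itself serves as the loop test.\<close>

lemma runs_fold:
  assumes S: "implements cS N q (enc_pair e (enc_pair ea eb)) eb (\<lambda>z. S (fst z) (fst (snd z)) (snd (snd z)))"
    and N0: "N \<noteq> 0"
    and ys: "\<forall>a\<in>set ys. size (ea a) \<le> B" "size (enc_list ea ys) \<le> B"
    and acc: "\<forall>k. size (eb (fold (S x) (take k ys) acc)) \<le> B"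
    and s: "s N = e x" "s (N + 1) = enc_list ea ys" "s (N + 2) = eb acc"
  defines "prog \<equiv> While (Var (N + 1))
    (Seq (Assign 0 (NodeE (Var N) (NodeE (LeftE (Var (N + 1))) (Var (N + 2)))))
    (Seq cS (Seq (Assign (N + 2) (Var 0)) (Assign (N + 1) (RightE (Var (N + 1)))))))"
  shows "\<exists>s'. runs prog s (1 + length ys * (10 + size (e x) + 4 * B + poly q (2 + size (e x) + 2 * B))) s' \<and>
    s' (N + 2) = eb (fold (S x) ys acc) \<and> (\<forall>y\<ge>N + 3. s' y = s y)"
  using ys acc s
proof (induction ys arbitrary: acc s)
  case Nil
  then show ?case
    unfolding prog_def by (intro exI[of _ s]) (auto intro!: runs_WhileFalse[THEN runs_mono])
next
  case (Cons a ys)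
  let ?z = "(x, a, acc)" and ?e = "enc_pair e (enc_pair ea eb)"
  have acc0: "size (eb acc) \<le> B" using Cons.prems(3)[rule_format, of 0] by simp
  have acc1: "size (eb (S x a acc)) \<le> B" using Cons.prems(3)[rule_format, of 1] by simp
  define s0 where "s0 = s(0 := ?e ?z)"
  have s0: "s0 0 = ?e ?z" by (simp add: s0_def)
  have sz: "size (?e ?z) \<le> 2 + size (e x) + 2 * B"
    using Cons.prems(1) acc0 by (auto simp: size_enc_pair)
  obtain s1 where s1: "runs cS s0 (poly q (size (?e ?z))) s1" "s1 0 = eb (S x a acc)" "\<forall>y\<ge>N. s1 y = s0 y"
    using implements_runs[where s=s0 and x="?z", OF S s0] by auto
  define s2 where "s2 = s1(N + 2 := eb (S x a acc))"
  define s3 where "s3 = s2(N + 1 := enc_list ea ys)"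
  have r0: "runs (Assign 0 (NodeE (Var N) (NodeE (LeftE (Var (N + 1))) (Var (N + 2))))) s (1 + size (?e ?z)) s0"
    using runs_Assign[of 0 "NodeE (Var N) (NodeE (LeftE (Var (N + 1))) (Var (N + 2)))" s] Cons.prems
    by (simp add: s0_def enc_pair_def)
  have r2: "runs (Assign (N + 2) (Var 0)) s1 (1 + size (eb (S x a acc))) s2"
    using runs_Assign[of "N + 2" "Var 0" s1] s1 by (simp add: s2_def)
  have "s2 (N + 1) = s (N + 1)" using s1 by (simp add: s2_def s0_def)
  then have r3: "runs (Assign (N + 1) (RightE (Var (N + 1)))) s2 (1 + size (enc_list ea ys)) s3"
    using runs_Assign[of "N + 1" "RightE (Var (N + 1))" s2] Cons.prems by (simp add: s3_def)
  \<comment> \<open>The encoded triple has size at most \<open>2 + size (e x) + 2 * B\<close>, and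
    writing back the accumulator and the shortened list adds \<open>B\<close> each; the constants
    are rounded up.\<close>
  let ?T = "8 + size (e x) + 4 * B + poly q (2 + size (e x) + 2 * B)"
  have body: "runs (Seq (Assign 0 (NodeE (Var N) (NodeE (LeftE (Var (N + 1))) (Var (N + 2)))))
    (Seq cS (Seq (Assign (N + 2) (Var 0)) (Assign (N + 1) (RightE (Var (N + 1))))))) s ?T s3"
    by (rule runs_mono, (rule runs_Seq, rule r0 r2 s1(1))+, rule r3)
      (use sz poly_nat_mono[OF sz, of q] acc1 Cons.prems(2) in simp)
  have "\<exists>s'. runs prog s3 (1 + length ys * (10 + size (e x) + 4 * B + poly q (2 + size (e x) + 2 * B))) s' \<and>
    s' (N + 2) = eb (fold (S x) ys (S x a acc)) \<and> (\<forall>y\<ge>N + 3. s' y = s3 y)"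
  proof (rule Cons.IH)
    show "\<forall>a\<in>set ys. size (ea a) \<le> B" "size (enc_list ea ys) \<le> B" using Cons.prems by auto
    show "\<forall>k. size (eb (fold (S x) (take k ys) (S x a acc))) \<le> B"
      using Cons.prems(3) by (metis fold_simps(2) take_Suc_Cons)
    show "s3 N = e x" "s3 (N + 1) = enc_list ea ys" "s3 (N + 2) = eb (S x a acc)"
      using s1 Cons.prems N0 by (auto simp: s3_def s2_def s0_def)
  qed
  then obtain s4 where s4:
    "runs prog s3 (1 + length ys * (10 + size (e x) + 4 * B + poly q (2 + size (e x) + 2 * B))) s4"
    "s4 (N + 2) = eb (fold (S x) ys (S x a acc))" "\<forall>y\<ge>N + 3. s4 y = s3 y" by blast
  have "runs prog s (1 + ?T + (1 + length ys * (10 + size (e x) + 4 * B + poly q (2 + size (e x) + 2 * B)))) s4"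
    unfolding prog_def
    by (rule runs_WhileTrue[OF _ body s4(1)[unfolded prog_def]]) (use Cons.prems in simp)
  then have "runs prog s (1 + length (a # ys) * (10 + size (e x) + 4 * B + poly q (2 + size (e x) + 2 * B))) s4"
    by (rule runs_mono) simp
  then show ?case
    using s4 s1 by (intro exI[of _ s4]) (auto simp: s3_def s2_def s0_def)
qed

text \<open>Iterating a polynomial-time step may produce exponentially large values. The hypothesis
  \<open>bound\<close> excludes this; it ranges over the prefixes of the list because their folds
  are the accumulators that occur.\<close>

lemma ptime_fold:
  assumes L: "ptime e (enc_list ea) L" and I: "ptime e eb I"
    and S: "ptime (enc_pair e (enc_pair ea eb)) eb (\<lambda>z. S (fst z) (fst (snd z)) (snd (snd z)))"
    and bound: "\<And>x k. size (eb (fold (S x) (take k (L x)) (I x))) \<le> poly p (size (e x))"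
  shows "ptime e eb (\<lambda>x. fold (S x) (L x) (I x))"
proof -
  from L I S obtain cL N1 qL cI N2 qI cS N3 q where
    L0: "implements cL N1 qL e (enc_list ea) L" and I0: "implements cI N2 qI e eb I" and
    S0: "implements cS N3 q (enc_pair e (enc_pair ea eb)) eb (\<lambda>z. S (fst z) (fst (snd z)) (snd (snd z)))"
    unfolding ptime_def by blast
  define N where "N = Suc (max N1 (max N2 N3))"
  have L: "implements cL N qL e (enc_list ea) L" and I: "implements cI N qI e eb I" and
    S: "implements cS N q (enc_pair e (enc_pair ea eb)) eb (\<lambda>z. S (fst z) (fst (snd z)) (snd (snd z)))"
    using L0 I0 S0 unfolding implements_def N_def by (meson Suc_leD max.boundedE)+
  have N0: "N \<noteq> 0" by (simp add: N_def)
  define loop where "loop = While (Var (N + 1))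
    (Seq (Assign 0 (NodeE (Var N) (NodeE (LeftE (Var (N + 1))) (Var (N + 2)))))
    (Seq cS (Seq (Assign (N + 2) (Var 0)) (Assign (N + 1) (RightE (Var (N + 1)))))))"
  define prog where "prog = Seq (Assign N (Var 0)) (Seq cL (Seq (Assign (N + 1) (Var 0))
    (Seq (Assign 0 (Var N)) (Seq cI (Seq (Assign (N + 2) (Var 0)) (Seq loop (Assign 0 (Var (N + 2)))))))))"
  define B where "B = qL + p"
  define R where "R = [:10, 1:] + smult 4 B + pcompose q ([:2, 1:] + smult 2 B)"
  define Q where "Q = [:10:] + [:0, 2:] + qL + qL + qI + qI + B + p + qL * R"
  have pI: "size (eb (I x)) \<le> poly p (size (e x))" for x
    using bound[of x 0] by simp
  have pF: "size (eb (fold (S x) (L x) (I x))) \<le> poly p (size (e x))" for x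
    using bound[of x "length (L x)"] by simp
  show ?thesis
  proof (rule ptimeI[where c=prog and N="N + 3" and q=Q])
    fix x
    let ?n = "size (e x)"
    have sL: "size (enc_list ea (L x)) \<le> poly qL ?n" by (rule implements_size[OF L])
    show "size (eb (fold (S x) (L x) (I x))) \<le> poly Q ?n"
      using pF[of x] by (simp add: Q_def)
    fix s :: store assume s: "s 0 = e x"
    define s0 where "s0 = s(N := e x)"
    have s0: "s0 0 = e x" using s N0 by (simp add: s0_def)
    obtain s1 where s1: "runs cL s0 (poly qL ?n) s1" "s1 0 = enc_list ea (L x)" "\<forall>y\<ge>N. s1 y = s0 y"
      by (rule implements_runs[where s=s0 and x=x, OF L s0])
    define s2 where "s2 = s1(N + 1 := enc_list ea (L x))"
    define s3 where "s3 = s2(0 := e x)"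
    have s3: "s3 0 = e x" by (simp add: s3_def)
    obtain s4 where s4: "runs cI s3 (poly qI ?n) s4" "s4 0 = eb (I x)" "\<forall>y\<ge>N. s4 y = s3 y"
      by (rule implements_runs[where s=s3 and x=x, OF I s3])
    define s5 where "s5 = s4(N + 2 := eb (I x))"
    have r0: "runs (Assign N (Var 0)) s (1 + ?n) s0"
      using runs_Assign[of N "Var 0" s] s by (simp add: s0_def)
    have r2: "runs (Assign (N + 1) (Var 0)) s1 (1 + size (enc_list ea (L x))) s2"
      using runs_Assign[of "N + 1" "Var 0" s1] s1 by (simp add: s2_def)
    have "s2 N = e x" using s1 by (simp add: s2_def s0_def)
    then have r3: "runs (Assign 0 (Var N)) s2 (1 + ?n) s3"
      using runs_Assign[of 0 "Var N" s2] by (simp add: s3_def)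
    have r5: "runs (Assign (N + 2) (Var 0)) s4 (1 + size (eb (I x))) s5"
      using runs_Assign[of "N + 2" "Var 0" s4] s4 by (simp add: s5_def)
    have "\<exists>s'. runs loop s5 (1 + length (L x) * (10 + ?n + 4 * poly B ?n +
        poly q (2 + ?n + 2 * poly B ?n))) s' \<and>
      s' (N + 2) = eb (fold (S x) (L x) (I x)) \<and> (\<forall>y\<ge>N + 3. s' y = s5 y)"
      unfolding loop_def
    proof (rule runs_fold[OF S N0])
      show "\<forall>a\<in>set (L x). size (ea a) \<le> poly B ?n"
        using sL size_elem_le[of _ "L x" ea] by (fastforce simp: B_def)
      show "size (enc_list ea (L x)) \<le> poly B ?n" using sL by (simp add: B_def)
      show "\<forall>k. size (eb (fold (S x) (take k (L x)) (I x))) \<le> poly B ?n"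
        using bound by (simp add: B_def trans_le_add2)
      show "s5 N = e x" "s5 (N + 1) = enc_list ea (L x)" "s5 (N + 2) = eb (I x)"
        using s1 s4 N0 by (auto simp: s5_def s3_def s2_def s0_def)
    qed
    then obtain s6 where s6: "runs loop s5 (1 + length (L x) * (10 + ?n + 4 * poly B ?n +
        poly q (2 + ?n + 2 * poly B ?n))) s6"
      "s6 (N + 2) = eb (fold (S x) (L x) (I x))" "\<forall>y\<ge>N + 3. s6 y = s5 y" by blast
    have "length (L x) \<le> poly qL ?n" using sL length_le_size[of "L x" ea] by simp
    moreover have "10 + ?n + 4 * poly B ?n + poly q (2 + ?n + 2 * poly B ?n) = poly R ?n"
      by (simp add: R_def poly_pcompose)
    ultimately have s6': "runs loop s5 (1 + poly qL ?n * poly R ?n) s6"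
      using s6(1) by (auto elim!: runs_mono)
    let ?s = "s6(0 := eb (fold (S x) (L x) (I x)))"
    have r6: "runs (Assign 0 (Var (N + 2))) s6 (1 + size (eb (fold (S x) (L x) (I x)))) ?s"
      using runs_Assign[of 0 "Var (N + 2)" s6] s6 by simp
    have "runs prog s (poly Q ?n) ?s"
      unfolding prog_def
      by (rule runs_mono, (rule runs_Seq, rule r0 r2 r3 r5 s1(1) s4(1) s6')+, rule r6)
        (use sL pI[of x] pF[of x] in \<open>simp add: Q_def B_def\<close>)
    then show "\<exists>s'. runs prog s (poly Q ?n) s' \<and> s' 0 = eb (fold (S x) (L x) (I x)) \<and>
        (\<forall>y\<ge>N + 3. s' y = s y)"
      using s6 s4 s1 by (intro exI[of _ ?s]) (auto simp: s5_def s3_def s2_def s0_def)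
  qed
qed

section \<open>Closure rules for truth values and lists\<close>

named_theorems ptime_intros

lemmas [ptime_intros] = ptime_const ptime_id ptime_fst ptime_snd ptime_pair ptime_if

text \<open>A rule for a binary function is proved once on pairs and then instantiated with
  arbitrary computable arguments.\<close>

lemma ptime_comp2:
  assumes "ptime (enc_pair ea eb) ec (\<lambda>z. h (fst z) (snd z))" "ptime e ea f" "ptime e eb g"
  shows "ptime e ec (\<lambda>x. h (f x) (g x))"
  using ptime_comp[OF assms(1) ptime_pair[OF assms(2,3)]] by simp

text \<open>A different view of the output costs no time if both encodings give the same
  tree.\<close>

lemma ptime_recode_out: "ptime e eb f \<Longrightarrow> (\<And>x. ec (g x) = eb (f x)) \<Longrightarrow> ptime e ec g"
  by (simp add: ptime_def implements_def)

lemma ptime_cong: "ptime e eb f \<Longrightarrow> (\<And>x. g x = f x) \<Longrightarrow> ptime e eb g"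
  by (simp add: ptime_def implements_def)

lemma ptime_not [ptime_intros]: "ptime e enc_bool P \<Longrightarrow> ptime e enc_bool (\<lambda>x. \<not> P x)"
  by (rule ptime_cong[where f="\<lambda>x. if P x then False else True"]) ((rule ptime_intros | assumption)+, auto)

lemma ptime_conj [ptime_intros]:
  "ptime e enc_bool P \<Longrightarrow> ptime e enc_bool Q \<Longrightarrow> ptime e enc_bool (\<lambda>x. P x \<and> Q x)"
  by (rule ptime_cong[where f="\<lambda>x. if P x then Q x else False"]) ((rule ptime_intros | assumption)+, auto)

lemma ptime_disj [ptime_intros]:
  "ptime e enc_bool P \<Longrightarrow> ptime e enc_bool Q \<Longrightarrow> ptime e enc_bool (\<lambda>x. P x \<or> Q x)"
  by (rule ptime_cong[where f="\<lambda>x. if P x then True else Q x"]) ((rule ptime_intros | assumption)+, auto)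

lemma ptime_bool_eq [ptime_intros]:
  "ptime e enc_bool P \<Longrightarrow> ptime e enc_bool Q \<Longrightarrow> ptime e enc_bool (\<lambda>x. P x = Q x)"
  by (rule ptime_cong[where f="\<lambda>x. if P x then Q x else \<not> Q x"]) ((rule ptime_intros | assumption)+, auto)

text \<open>Emptiness is the primitive test of the language, but only commands can test. A program
  has to turn the outcome into an encoded truth value.\<close>

lemma ptime_Nil_eq [ptime_intros]:
  assumes "ptime e (enc_list ea) L"
  shows "ptime e enc_bool (\<lambda>x. L x = [])"
proof -
  let ?prog = "If (Var 0) (Assign 0 LeafE) (Assign 0 (NodeE LeafE LeafE))"
  have "ptime (enc_list ea) enc_bool (\<lambda>xs. xs = [])"
  proof (rule ptimeI[where q="[:5:]" and c="?prog" and N=1])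
    show "size (enc_bool (xs = [])) \<le> poly [:5:] (size (enc_list ea xs))" for xs
      by (simp add: enc_bool_def)
    fix xs and s :: store assume s: "s 0 = enc_list ea xs"
    have "runs ?prog s 5 (s(0 := enc_bool (xs = [])))"
    proof (cases xs)
      case Nil
      then have "runs ?prog s (1 + (1 + size (eval_expr (NodeE LeafE LeafE) s)))
        (s(0 := eval_expr (NodeE LeafE LeafE) s))"
        using s by (intro runs_IfFalse runs_Assign) simp
      then show ?thesis using Nil by (auto simp: enc_bool_def elim: runs_mono)
    next
      case (Cons a list)
      then have "runs ?prog s (1 + (1 + size (eval_expr LeafE s))) (s(0 := eval_expr LeafE s))"
        using s by (intro runs_IfTrue runs_Assign) simp
      then show ?thesis using Cons by (auto simp: enc_bool_def elim: runs_mono)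
    qed
    then show "\<exists>s'. runs ?prog s (poly [:5:] (size (enc_list ea xs))) s' \<and>
        s' 0 = enc_bool (xs = []) \<and> (\<forall>y\<ge>1. s' y = s y)"
      by (intro exI[of _ "s(0 := enc_bool (xs = []))"]) auto
  qed
  from ptime_comp[OF this assms] show ?thesis .
qed

lemma ptime_Cons [ptime_intros]:
  assumes "ptime e ea f" "ptime e (enc_list ea) L"
  shows "ptime e (enc_list ea) (\<lambda>x. f x # L x)"
  by (rule ptime_recode_out[OF ptime_pair[OF assms]]) (simp add: enc_pair_def)

lemma ptime_tl [ptime_intros]:
  assumes "ptime e (enc_list ea) L"
  shows "ptime e (enc_list ea) (\<lambda>x. tl (L x))"
proof -
  have sz: "size (right t) \<le> size t" for t by (cases t) auto
  have ev: "enc_list ea (tl xs) = right (enc_list ea xs)" for xs :: "'b list" by (cases xs) auto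
  have "ptime (enc_list ea) (enc_list ea) tl"
    by (rule ptime_Assign[where e="RightE (Var 0)" and q="[:0,1:]"]) (auto simp: sz ev)
  from ptime_comp[OF this assms] show ?thesis .
qed

text \<open>As \<open>hd []\<close> is a fixed value, \<open>hd\<close> is computable also on the empty list.\<close>

lemma ptime_hd [ptime_intros]:
  assumes "ptime e (enc_list ea) L"
  shows "ptime e ea (\<lambda>x. hd (L x))"
proof -
  have ev: "ea (if xs = [] then a else hd xs) =
      left (enc_list ea (if xs = [] then [a] else xs))" for xs a by (cases xs) auto
  have sz: "size (left t) \<le> size t" for t by (cases t) auto
  have 1: "ptime (enc_list ea) ea (\<lambda>xs. if xs = [] then hd [] else hd xs)"
  proof -
    \<comment> \<open>Once the default value is inserted the list is nonempty, and its head is the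
      left subtree.\<close>
    have "ptime (enc_list ea) (enc_list ea) (\<lambda>xs. if xs = [] then [hd []] else xs)"
      by (rule ptime_intros)+
    then have a: "ptime (enc_list ea) id (\<lambda>xs. enc_list ea (if xs = [] then [hd []] else xs))"
      by (rule ptime_recode_out) simp
    have b: "ptime id id left"
      by (rule ptime_Assign[where e="LeftE (Var 0)" and q="[:0,1:]"]) (auto simp: sz)
    show ?thesis
      by (rule ptime_recode_out[OF ptime_comp[OF b a]]) (simp only: ev id_apply)
  qed
  have "ptime (enc_list ea) ea hd"
    by (rule ptime_cong[OF 1]) auto
  from ptime_comp[OF this assms] show ?thesis .
qed

lemma size_enc_list_append: "size (enc_list e (xs @ ys)) = size (enc_list e xs) + size (enc_list e ys)"
  by (simp add: size_enc_list)

lemma size_enc_list_rev: "size (enc_list e (rev xs)) = size (enc_list e xs)"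
  by (induction xs) (auto simp: size_enc_list_append)

lemma size_enc_list_take: "size (enc_list e (take k xs)) \<le> size (enc_list e xs)"
  by (metis append_take_drop_id le_add1 size_enc_list_append)

lemma size_enc_list_le:
  "length xs \<le> A \<Longrightarrow> (\<And>a. a \<in> set xs \<Longrightarrow> size (e a) \<le> B) \<Longrightarrow> size (enc_list e xs) \<le> A * Suc B"
proof (induction xs arbitrary: A)
  case (Cons x xs)
  then obtain A' where "A = Suc A'" "length xs \<le> A'" by (cases A) auto
  moreover have "size (enc_list e xs) \<le> A' * Suc B" using Cons calculation by auto
  ultimately show ?case using Cons.prems(2)[of x] by simp
qed simp

lemma fold_Cons: "fold (#) xs ys = rev xs @ ys"
  by (induction xs arbitrary: ys) auto

lemma ptime_rev [ptime_intros]: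
  assumes "ptime e (enc_list ea) L"
  shows "ptime e (enc_list ea) (\<lambda>x. rev (L x))"
proof -
  have "ptime (enc_list ea) (enc_list ea) (\<lambda>x. fold (\<lambda>a b. a # b) x [])"
    by (rule ptime_fold[where p="[:0,1:]"])
      (rule ptime_intros | simp add: fold_Cons size_enc_list_rev size_enc_list_take)+
  then have "ptime (enc_list ea) (enc_list ea) rev"
    by (rule ptime_cong) (simp add: fold_Cons)
  from ptime_comp[OF this assms] show ?thesis .
qed

lemma ptime_append [ptime_intros]:
  assumes "ptime e (enc_list ea) L" "ptime e (enc_list ea) M"
  shows "ptime e (enc_list ea) (\<lambda>x. L x @ M x)"
proof -
  have "ptime (enc_pair (enc_list ea) (enc_list ea)) (enc_list ea)
      (\<lambda>z. fold (\<lambda>a b. a # b) (rev (fst z)) (snd z))"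
  proof (rule ptime_fold[where p="[:0,1:]"])
    fix z :: "'b list \<times> 'b list" and k
    show "size (enc_list ea (fold (\<lambda>a b. a # b) (take k (rev (fst z))) (snd z)))
        \<le> poly [:0, 1:] (size (enc_pair (enc_list ea) (enc_list ea) z))"
      using size_enc_list_take[of ea k "rev (fst z)"]
      by (simp add: fold_Cons size_enc_list_append size_enc_list_rev size_enc_pair)
  qed (rule ptime_intros)+
  then have "ptime (enc_pair (enc_list ea) (enc_list ea)) (enc_list ea) (\<lambda>z. fst z @ snd z)"
    by (rule ptime_cong) (simp add: fold_Cons)
  from ptime_comp2[OF this assms] show ?thesis .
qed

lemma ptime_map [ptime_intros]:
  assumes L: "ptime e (enc_list ea) L"
    and f: "ptime (enc_pair e ea) eb (\<lambda>z. f (fst z) (snd z))"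
  shows "ptime e (enc_list eb) (\<lambda>x. map (f x) (L x))"
proof -
  obtain qL where qL: "\<And>x. size (enc_list ea (L x)) \<le> poly qL (size (e x))"
    using ptime_size[OF L] by blast
  obtain q where q: "\<And>z. size (eb (f (fst z) (snd z))) \<le> poly q (size (enc_pair e ea z))"
    using ptime_size[OF f] by blast
  \<comment> \<open>The function is applied to pairs of \<open>x\<close> and an entry of
    \<open>L x\<close>, of size at most
    \<open>1 + size (e x) + poly qL (size (e x))\<close>.\<close>
  define R where "R = pcompose q ([:1, 1:] + qL)"
  have fold: "fold (\<lambda>a b. g a # b) xs ys = rev (map g xs) @ ys" for g :: "'b \<Rightarrow> 'c" and xs ys
    by (induction xs arbitrary: ys) auto
  have sz: "size (eb (f x a)) \<le> poly R (size (e x))" if "a \<in> set (L x)" for x a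
  proof -
    have "size (ea a) \<le> poly qL (size (e x))"
      using size_elem_le[OF that, of ea] qL[of x] by simp
    then have "poly q (size (enc_pair e ea (x, a))) \<le> poly R (size (e x))"
      by (simp add: R_def poly_pcompose poly_nat_mono size_enc_pair)
    then show ?thesis using q[of "(x, a)"] by simp
  qed
  have fold_ptime: "ptime e (enc_list eb) (\<lambda>x. fold (\<lambda>a b. f x a # b) (L x) [])"
  proof (rule ptime_fold[where p="qL * ([:1:] + R)", OF L])
    show "ptime (enc_pair e (enc_pair ea (enc_list eb))) (enc_list eb)
        (\<lambda>z. f (fst z) (fst (snd z)) # snd (snd z))"
      by (rule ptime_intros ptime_comp2[OF f])+
    fix x k
    have "size (enc_list eb (map (f x) (take k (L x)))) \<le> poly qL (size (e x)) * Suc (poly R (size (e x)))"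
      using length_le_size[of "L x" ea] qL[of x] in_set_takeD[of _ k "L x"]
      by (intro size_enc_list_le) (auto intro!: sz)
    then show "size (enc_list eb (fold (\<lambda>a b. f x a # b) (take k (L x)) []))
        \<le> poly (qL * ([:1:] + R)) (size (e x))"
      by (simp add: fold size_enc_list_rev)
  qed (rule ptime_intros)+
  show ?thesis
    by (rule ptime_cong[OF ptime_rev[OF fold_ptime]]) (simp add: fold)
qed

lemma size_enc_list_concat: "size (enc_list e (concat xss)) \<le> size (enc_list (enc_list e) xss)"
  by (induction xss) (auto simp: size_enc_list_append)

lemma ptime_concat [ptime_intros]:
  assumes "ptime e (enc_list (enc_list ea)) L"
  shows "ptime e (enc_list ea) (\<lambda>x. concat (L x))"
proof -
  have fold: "fold (\<lambda>a b. b @ a) xss ys = ys @ concat xss" for xss and ys :: "'b list"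
    by (induction xss arbitrary: ys) auto
  have "ptime (enc_list (enc_list ea)) (enc_list ea) (\<lambda>x. fold (\<lambda>a b. b @ a) x [])"
  proof (rule ptime_fold[where p="[:0,1:]"])
    show "size (enc_list ea (fold (\<lambda>a b. b @ a) (take k x) [])) \<le> poly [:0, 1:] (size (enc_list (enc_list ea) x))"
      for k x
      using size_enc_list_concat[of ea "take k x"] size_enc_list_take[of "enc_list ea" k x]
      by (simp add: fold)
  qed (rule ptime_intros)+
  then have "ptime (enc_list (enc_list ea)) (enc_list ea) concat"
    by (rule ptime_cong) (simp add: fold)
  from ptime_comp[OF this assms] show ?thesis .
qed

lemma ptime_filter [ptime_intros]:
  assumes L: "ptime e (enc_list ea) L"
    and P: "ptime (enc_pair e ea) enc_bool (\<lambda>z. P (fst z) (snd z))"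
  shows "ptime e (enc_list ea) (\<lambda>x. filter (P x) (L x))"
proof (rule ptime_cong)
  have filt: "concat (map (\<lambda>a. if Q a then [a] else []) xs) = filter Q xs" for Q and xs :: "'b list"
    by (induction xs) auto
  show "ptime e (enc_list ea) (\<lambda>x. concat (map (\<lambda>a. if P x a then [a] else []) (L x)))"
    by (rule ptime_intros L P)+
  show "filter (P x) (L x) = concat (map (\<lambda>a. if P x a then [a] else []) (L x))" for x
    by (simp add: filt)
qed

lemma ptime_Ball [ptime_intros]:
  assumes L: "ptime e (enc_list ea) L"
    and P: "ptime (enc_pair e ea) enc_bool (\<lambda>z. P (fst z) (snd z))"
  shows "ptime e enc_bool (\<lambda>x. \<forall>a\<in>set (L x). P x a)"
proof (rule ptime_cong)
  show "ptime e enc_bool (\<lambda>x. filter (\<lambda>a. \<not> P x a) (L x) = [])"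
    by (rule ptime_intros L P)+
qed (simp add: filter_empty_conv)

lemma ptime_Bex [ptime_intros]:
  assumes L: "ptime e (enc_list ea) L"
    and P: "ptime (enc_pair e ea) enc_bool (\<lambda>z. P (fst z) (snd z))"
  shows "ptime e enc_bool (\<lambda>x. \<exists>a\<in>set (L x). P x a)"
proof (rule ptime_cong)
  show "ptime e enc_bool (\<lambda>x. \<not> (\<forall>a\<in>set (L x). \<not> P x a))"
    by (rule ptime_intros L P)+
qed simp

section \<open>Numbers in binary\<close>

fun bits :: "nat \<Rightarrow> bool list" where
  "bits n = (if n = 0 then [] else odd n # bits (n div 2))"

declare bits.simps [simp del]

lemma bits_0 [simp]: "bits 0 = []"
  by (simp add: bits.simps)

text \<open>A number and its list of digits are the same tree, so arithmetic can be programmed as a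
  fold over digits.\<close>

lemma enc_nat_bits: "enc_nat n = enc_list enc_bool (bits n)"
proof (induction n rule: bits.induct)
  case (1 n)
  show ?case
  proof (cases "n = 0")
    case True
    then show ?thesis by (simp add: enc_nat.simps)
  next
    case False
    have "enc_nat n = Node (enc_bool (odd n)) (enc_nat (n div 2))"
      using False by (subst enc_nat.simps) (simp add: enc_bool_def)
    also have "\<dots> = enc_list enc_bool (odd n # bits (n div 2))"
      by (simp only: 1[OF False] enc_list_simps)
    also have "odd n # bits (n div 2) = bits n"
      using False by (subst (2) bits.simps) simp
    finally show ?thesis .
  qed
qed

lemma length_bits: "length (bits n) \<le> n"
proof (induction n rule: bits.induct)
  case (1 n)
  then show ?case by (subst bits.simps) auto
qed

text \<open>Far from tight, but applied only to numbers that are small anyway: positions in an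
  encoded list and the numbers in the kernel.\<close>

lemma size_enc_nat: "size (enc_nat n) \<le> 2 * n"
proof -
  have "size (enc_nat n) \<le> n * Suc 1"
    unfolding enc_nat_bits by (rule size_enc_list_le[OF length_bits size_enc_bool])
  then show ?thesis by simp
qed

lemma ptime_bits [ptime_intros]:
  "ptime e enc_nat f \<Longrightarrow> ptime e (enc_list enc_bool) (\<lambda>x. bits (f x))"
  by (erule ptime_recode_out) (simp add: enc_nat_bits)

text \<open>The flag is the carry. It is an argument because the induction over the digits meets
  both of its values.\<close>

fun increment :: "bool \<Rightarrow> bool list \<Rightarrow> bool list" where
  "increment c [] = (if c then [True] else [])"
| "increment c (b # bs) = (b \<noteq> c) # increment (b \<and> c) bs"

lemma bits_increment: "bits (n + of_bool c) = increment c (bits n)"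
proof (induction n arbitrary: c rule: bits.induct)
  case (1 n)
  show ?case
  proof (cases "n = 0")
    case True
    then show ?thesis by (cases c) (simp_all add: bits.simps[of "Suc 0"])
  next
    case False
    have "bits (n + of_bool c) = (odd n \<noteq> c) # bits ((n + of_bool c) div 2)"
      using False by (subst bits.simps) auto
    moreover have "(n + of_bool c) div 2 = n div 2 + of_bool (odd n \<and> c)"
      by (cases c; cases "odd n") auto
    ultimately show ?thesis using 1[OF False] False by (simp add: bits.simps[of n])
  qed
qed

lemma ptime_Suc [ptime_intros]:
  assumes "ptime e enc_nat f"
  shows "ptime e enc_nat (\<lambda>x. Suc (f x))"
proof -
  \<comment> \<open>The state is the carry and the digits produced so far, the latest first. A carry
    left over at the end becomes a new most significant digit.\<close>
  let ?step = "\<lambda>b z. (b \<and> fst z, (b \<noteq> fst z) # snd z)"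
  let ?fold = "\<lambda>xs. fold ?step xs (True, [])"
  have fold: "rev (snd (fold ?step xs (c, ys))) @ (if fst (fold ?step xs (c, ys)) then [True] else []) =
    rev ys @ increment c xs" for xs c ys
    by (induction xs arbitrary: c ys) auto
  have len: "length (snd (fold ?step xs z)) = length xs + length (snd z)" for xs z
    by (induction xs arbitrary: z) auto
  have "ptime (enc_list enc_bool) (enc_pair enc_bool (enc_list enc_bool)) ?fold"
  proof (rule ptime_fold[where p="[:2, 2:]"])
    fix k and x :: "bool list"
    have "size (enc_list enc_bool (snd (fold ?step (take k x) (True, [])))) \<le> length x * Suc 1"
    proof (rule size_enc_list_le)
      show "length (snd (fold ?step (take k x) (True, []))) \<le> length x" unfolding len by simp
    qed (rule size_enc_bool)
    then show "size (enc_pair enc_bool (enc_list enc_bool) (fold ?step (take k x) (True, [])))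
        \<le> poly [:2, 2:] (size (enc_list enc_bool x))"
      using length_le_size[of x enc_bool] size_enc_bool[of "fst (fold ?step (take k x) (True, []))"]
      by (simp add: size_enc_pair)
  qed (rule ptime_intros)+
  note F = ptime_comp[OF this ptime_bits[OF ptime_id]]
  have "ptime enc_nat (enc_list enc_bool)
    (\<lambda>n. rev (snd (?fold (bits n))) @ (if fst (?fold (bits n)) then [True] else []))"
    by (rule ptime_intros F)+
  then have "ptime enc_nat enc_nat Suc"
  proof (rule ptime_recode_out)
    show "enc_nat (Suc n) = enc_list enc_bool
      (rev (snd (?fold (bits n))) @ (if fst (?fold (bits n)) then [True] else []))" for n
      using bits_increment[of n True] fold[of "bits n" True "[]"] by (simp add: enc_nat_bits)
  qed
  from ptime_comp[OF this assms] show ?thesis .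
qed

text \<open>Leading zeros are allowed, so that the comparison below can be proved for arbitrary
  digit lists.\<close>

fun of_bits :: "bool list \<Rightarrow> nat" where
  "of_bits [] = 0"
| "of_bits (b # bs) = of_bool b + 2 * of_bits bs"

lemma of_bits_bits: "of_bits (bits n) = n"
proof (induction n rule: bits.induct)
  case (1 n)
  then show ?case by (subst bits.simps) (auto simp: odd_two_times_div_two_succ)
qed

lemma of_bits_pos: "0 < of_bits bs \<longleftrightarrow> (\<exists>b\<in>set bs. b)"
  by (induction bs) auto

text \<open>The least significant digits come first, so every later pair of differing digits
  overrides the verdict so far. The rest of the second number is carried along, an exhausted list
  counting as zeros; a digit 1 that remains at the end makes the second number larger.\<close>

lemma ptime_less [ptime_intros]:
  assumes "ptime e enc_nat f" "ptime e enc_nat g"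
  shows "ptime e enc_bool (\<lambda>x. f x < g x)"
proof -
  let ?hd = "\<lambda>bs. bs \<noteq> [] \<and> hd bs"
  let ?step = "\<lambda>b z. (if b = ?hd (snd z) then fst z else ?hd (snd z), tl (snd z))"
  let ?fold = "\<lambda>z. fold ?step (fst z) (False, snd z)"
  have fold: "(fst (fold ?step xs (r, ys)) \<or> (\<exists>b\<in>set (snd (fold ?step xs (r, ys))). b)) \<longleftrightarrow>
    of_bits xs < of_bits ys \<or> of_bits xs = of_bits ys \<and> r" for xs r ys
  proof (induction xs arbitrary: r ys)
    case Nil
    then show ?case by (auto simp flip: of_bits_pos)
  next
    case (Cons a xs)
    have "of_bits ys = of_bool (?hd ys) + 2 * of_bits (tl ys)" by (cases ys) auto
    then show ?case by (cases a; cases "?hd ys") (auto simp: Cons.IH)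
  qed
  have tl: "size (enc_list enc_bool (snd (fold ?step xs z))) \<le> size (enc_list enc_bool (snd z))" for xs z
  proof (induction xs arbitrary: z)
    case (Cons a xs)
    have "size (enc_list enc_bool (tl ys)) \<le> size (enc_list enc_bool ys)" for ys by (cases ys) auto
    with Cons[of "?step a z"] show ?case by (auto intro: order_trans)
  qed simp
  let ?e = "enc_pair (enc_list enc_bool) (enc_list enc_bool)"
  have "ptime ?e (enc_pair enc_bool (enc_list enc_bool)) ?fold"
  proof (rule ptime_fold[where p="[:2, 1:]"])
    fix k and z :: "bool list \<times> bool list"
    show "size (enc_pair enc_bool (enc_list enc_bool) (fold ?step (take k (fst z)) (False, snd z)))
        \<le> poly [:2, 1:] (size (?e z))"
      using tl[of "take k (fst z)" "(False, snd z)"] size_enc_bool[of "fst (fold ?step (take k (fst z)) (False, snd z))"]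
      by (simp add: size_enc_pair)
  qed (rule ptime_intros)+
  note F = ptime_comp[OF this ptime_pair[OF ptime_bits[OF assms(1)] ptime_bits[OF assms(2)]]]
  have "ptime e enc_bool (\<lambda>x. fst (?fold (bits (f x), bits (g x))) \<or>
    (\<exists>b\<in>set (snd (?fold (bits (f x), bits (g x)))). b))"
    by (rule ptime_intros F)+
  then show ?thesis
  proof (rule ptime_cong)
    show "(f x < g x) = (fst (?fold (bits (f x), bits (g x))) \<or>
      (\<exists>b\<in>set (snd (?fold (bits (f x), bits (g x)))). b))" for x
      unfolding fst_conv snd_conv fold by (simp add: of_bits_bits)
  qed
qed

lemma ptime_le [ptime_intros]:
  "ptime e enc_nat f \<Longrightarrow> ptime e enc_nat g \<Longrightarrow> ptime e enc_bool (\<lambda>x. f x \<le> g x)"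
  by (rule ptime_cong[where f="\<lambda>x. \<not> g x < f x"]) ((rule ptime_intros | assumption)+, auto)

lemma ptime_nat_eq [ptime_intros]:
  "ptime e enc_nat f \<Longrightarrow> ptime e enc_nat g \<Longrightarrow> ptime e enc_bool (\<lambda>x. f x = g x)"
  by (rule ptime_cong[where f="\<lambda>x. f x \<le> g x \<and> g x \<le> f x"]) ((rule ptime_intros | assumption)+, auto)

lemma ptime_pair_eq [ptime_intros]:
  fixes f g :: "_ \<Rightarrow> nat \<times> nat"
  shows "ptime e (enc_pair enc_nat enc_nat) f \<Longrightarrow> ptime e (enc_pair enc_nat enc_nat) g \<Longrightarrow>
    ptime e enc_bool (\<lambda>x. f x = g x)"
  unfolding prod_eq_iff by (rule ptime_intros | assumption)+

lemma ptime_member [ptime_intros]: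
  assumes "ptime e enc_nat f" "ptime e (enc_list enc_nat) L"
  shows "ptime e enc_bool (\<lambda>x. f x \<in> set (L x))"
proof -
  have "ptime (enc_pair enc_nat (enc_list enc_nat)) enc_bool (\<lambda>z. \<exists>a\<in>set (snd z). a = fst z)"
    by (rule ptime_intros)+
  then have "ptime (enc_pair enc_nat (enc_list enc_nat)) enc_bool (\<lambda>z. fst z \<in> set (snd z))"
    by (rule ptime_cong) auto
  from ptime_comp2[OF this assms] show ?thesis .
qed

text \<open>A number in binary may be exponentially larger than its encoding, so it must not control
  a loop. \<open>take\<close>, \<open>drop\<close> and \<open>label\<close> therefore compare their
  argument with the positions in an enumerated list.\<close>

lemma ptime_enumerate [ptime_intros]:
  assumes "ptime e (enc_list ea) L"
  shows "ptime e (enc_list (enc_pair enc_nat ea)) (\<lambda>x. List.enumerate 0 (L x))"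
proof -
  let ?step = "\<lambda>a z. (Suc (fst z), (fst z, a) # snd z)"
  let ?enc = "enc_list (enc_pair enc_nat ea)"
  have fold: "fold ?step xs (n, ys) = (n + length xs, rev (List.enumerate n xs) @ ys)" for n xs ys
    by (induction xs arbitrary: n ys) auto
  have "ptime (enc_list ea) (enc_pair enc_nat ?enc) (\<lambda>xs. fold ?step xs (0, []))"
  \<comment> \<open>With \<open>?n\<close> as below, \<open>1 + 2 * ?n\<close> covers the outer pair
    and the counter; the remaining product covers at most \<open>?n\<close> entries, each a pair of
    size at most \<open>1 + 3 * ?n\<close>.\<close>
  proof (rule ptime_fold[where p="[:1, 2:] + [:0, 1:] * [:2, 3:]"])
    fix k and xs :: "'b list"
    let ?n = "size (enc_list ea xs)"
    have len: "length xs \<le> ?n" by (rule length_le_size)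
    have "size (?enc (List.enumerate 0 (take k xs))) \<le> ?n * Suc (1 + 3 * ?n)"
    proof (rule size_enc_list_le)
      show "length (List.enumerate 0 (take k xs)) \<le> ?n" using len by simp
      fix z assume "z \<in> set (List.enumerate 0 (take k xs))"
      then have "fst z \<le> length xs" "snd z \<in> set xs"
        by (auto simp: in_set_enumerate_eq) (metis in_set_takeD length_take min_less_iff_conj nth_mem)
      then show "size (enc_pair enc_nat ea z) \<le> 1 + 3 * ?n"
        using len size_elem_le[of "snd z" xs ea] size_enc_nat[of "fst z"] by (simp add: size_enc_pair)
    qed
    moreover have "size (enc_nat (length (take k xs))) \<le> 2 * ?n"
      using size_enc_nat[of "length (take k xs)"] len by simp
    moreover have "poly ([:1, 2:] + [:0, 1:] * [:2, 3:]) ?n = 1 + 2 * ?n + ?n * Suc (1 + 3 * ?n)"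
      by (simp add: algebra_simps)
    ultimately show "size (enc_pair enc_nat ?enc (fold ?step (take k xs) (0, [])))
        \<le> poly ([:1, 2:] + [:0, 1:] * [:2, 3:]) ?n"
      unfolding fold by (simp only: size_enc_pair size_enc_list_rev fst_conv snd_conv append_Nil2 add_0)
  qed (rule ptime_intros)+
  note F = ptime_comp[OF this ptime_id]
  have "ptime (enc_list ea) ?enc (\<lambda>xs. rev (snd (fold ?step xs (0, []))))"
    by (rule ptime_intros F)+
  then have "ptime (enc_list ea) ?enc (List.enumerate 0)"
    by (rule ptime_cong) (simp add: fold)
  from ptime_comp[OF this assms] show ?thesis .
qed

lemma ptime_length [ptime_intros]:
  assumes "ptime e (enc_list ea) L"
  shows "ptime e enc_nat (\<lambda>x. length (L x))"
proof -
  have fold: "fold (\<lambda>_. Suc) xs n = n + length xs" for xs :: "'b list" and n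
    by (induction xs arbitrary: n) auto
  have "ptime (enc_list ea) enc_nat (\<lambda>xs. fold (\<lambda>_. Suc) xs 0)"
  proof (rule ptime_fold[where p="[:0, 2:]"])
    show "size (enc_nat (fold (\<lambda>_. Suc) (take k xs) 0)) \<le> poly [:0, 2:] (size (enc_list ea xs))" for k xs
      using size_enc_nat[of "length (take k xs)"] length_le_size[of xs ea] by (simp add: fold)
  qed (rule ptime_intros)+
  then have "ptime (enc_list ea) enc_nat length"
    by (rule ptime_cong) (simp add: fold)
  from ptime_comp[OF this assms] show ?thesis .
qed

text \<open>The upper end is the length of a list, since up to an arbitrary binary number the output
  could be exponentially long.\<close>

lemma ptime_upt [ptime_intros]:
  "ptime e (enc_list ea) L \<Longrightarrow> ptime e (enc_list enc_nat) (\<lambda>x. [0..<length (L x)])"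
  by (rule ptime_cong[where f="\<lambda>x. map fst (List.enumerate 0 (L x))"])
    ((rule ptime_intros | assumption)+, simp add: enumerate_eq_zip)

lemma take_drop_enumerate:
  "map snd (filter (\<lambda>z. fst z < n + i) (List.enumerate n xs)) = take i xs"
  "map snd (filter (\<lambda>z. n + i \<le> fst z) (List.enumerate n xs)) = drop i xs"
proof (induction xs arbitrary: n i)
  case (Cons x xs)
  {
    case 1
    from Cons.IH(1)[of "Suc n" "i - 1"] show ?case
      by (cases i) (auto simp: filter_empty_conv in_set_enumerate_eq)
  next
    case 2
    from Cons.IH(2)[of "Suc n" "i - 1"] Cons.IH(2)[of "Suc n" 0] show ?case
      by (cases i) (auto simp: filter_empty_conv in_set_enumerate_eq not_le
        intro!: filter_True[THEN arg_cong[of _ _ "map snd"], THEN trans])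
  }
qed simp_all

lemma ptime_take [ptime_intros]:
  assumes "ptime e enc_nat f" "ptime e (enc_list ea) L"
  shows "ptime e (enc_list ea) (\<lambda>x. take (f x) (L x))"
proof -
  have "ptime (enc_pair enc_nat (enc_list ea)) (enc_list ea)
      (\<lambda>z. map snd (filter (\<lambda>w. fst w < fst z) (List.enumerate 0 (snd z))))"
    by (rule ptime_intros)+
  then have "ptime (enc_pair enc_nat (enc_list ea)) (enc_list ea) (\<lambda>z. take (fst z) (snd z))"
    by (rule ptime_cong) (simp flip: take_drop_enumerate(1)[of 0])
  from ptime_comp2[OF this assms] show ?thesis .
qed

lemma ptime_drop [ptime_intros]:
  assumes "ptime e enc_nat f" "ptime e (enc_list ea) L"
  shows "ptime e (enc_list ea) (\<lambda>x. drop (f x) (L x))"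
proof -
  have "ptime (enc_pair enc_nat (enc_list ea)) (enc_list ea)
      (\<lambda>z. map snd (filter (\<lambda>w. fst z \<le> fst w) (List.enumerate 0 (snd z))))"
    by (rule ptime_intros)+
  then have "ptime (enc_pair enc_nat (enc_list ea)) (enc_list ea) (\<lambda>z. drop (fst z) (snd z))"
    by (rule ptime_cong) (simp flip: take_drop_enumerate(2)[of 0])
  from ptime_comp2[OF this assms] show ?thesis .
qed

section \<open>Swaps and inversions\<close>

lemma rank_Nil [simp]: "rank c [] = 1"
  by (simp add: rank_def)

lemma rank_Cons [simp]: "rank c (x # v) = (if x = c then 1 else Suc (rank c v))"
  by (simp add: rank_def)

lemma rank_pos [simp]: "0 < rank c v" "rank c v \<noteq> 0"
  by (simp_all add: rank_def)

lemma rank_append: "rank c (v @ w) = (if c \<in> set v then rank c v else length v + rank c w)"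
  by (induction v) auto

lemma rank_le_iff: "c \<in> set v \<Longrightarrow> rank c v \<le> k \<longleftrightarrow> c \<in> set (take k v)"
proof (induction v arbitrary: k)
  case (Cons x v)
  then show ?case by (cases k) auto
qed simp

lemma rank_le_length: "c \<in> set v \<Longrightarrow> rank c v \<le> length v"
  by (simp add: rank_le_iff)

lemma rank_nth: "distinct v \<Longrightarrow> i < length v \<Longrightarrow> rank (v ! i) v = Suc i"
  by (induction v arbitrary: i) (auto simp: nth_Cons split: nat.splits)

lemma rank_eq_iff: "a \<in> set v \<Longrightarrow> rank a v = rank b v \<longleftrightarrow> a = b"
  by (induction v) (auto split: if_splits)

text \<open>Turns ranks into cardinalities, the form in which they are compared with numbers of
  inversions.\<close>

lemma rank_card:
  assumes "distinct v" "c \<in> set v"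
  shows "rank c v = Suc (card {b \<in> set v. rank b v < rank c v})"
proof -
  have "rank b v < rank c v \<longleftrightarrow> b \<in> set (take (rank c v - 1) v)" if "b \<in> set v" for b
  proof -
    have "rank b v < rank c v \<longleftrightarrow> rank b v \<le> rank c v - 1"
      using rank_pos(1)[of c v] by linarith
    then show ?thesis using rank_le_iff[OF that] by simp
  qed
  then have "{b \<in> set v. rank b v < rank c v} = set (take (rank c v - 1) v)"
    by (auto dest: in_set_takeD)
  moreover have "card (set (take (rank c v - 1) v)) = rank c v - 1"
    using assms rank_le_length[OF assms(2)] by (subst distinct_card) auto
  ultimately show ?thesis by simp
qed

lemma rank_filter_less_iff:
  "P a \<Longrightarrow> P b \<Longrightarrow> rank a (filter P v) < rank b (filter P v) \<longleftrightarrow> rank a v < rank b v"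
  by (induction v) auto

lemma rank_map: "inj_on f (insert c (set v)) \<Longrightarrow> rank (f c) (map f v) = rank c v"
  by (induction v) (auto simp: inj_on_def)

text \<open>Oriented like swaps: \<open>(a, b)\<close> is the swap that moves \<open>b\<close> ahead
  of \<open>a\<close>, and costs depend on the orientation.\<close>

definition inversions :: "vote \<Rightarrow> vote \<Rightarrow> (nat \<times> nat) set" where
  "inversions v w = {(a, b). a \<in> set v \<and> b \<in> set v \<and> rank a v < rank b v \<and> rank b w < rank a w}"

lemma inversions_subset: "inversions v w \<subseteq> set v \<times> set v"
  by (auto simp: inversions_def)

lemma finite_inversions [simp]: "finite (inversions v w)"
  by (rule finite_subset[OF inversions_subset]) auto

lemma inversions_irrefl: "(a, a) \<notin> inversions v w"
  by (auto simp: inversions_def)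

text \<open>A swap renames the entries, and \<open>transpose a b\<close> is an involution: the place
  now held by \<open>c\<close> was held by the image of \<open>c\<close>.\<close>

lemma rank_apply_swap: "rank c (apply_swap (a, b) v) = rank (transpose a b c) v"
  by (induction v) (auto simp: apply_swap_def transpose_def)

lemma apply_swap_perm:
  assumes "a \<in> set v" "b \<in> set v"
  shows "set (apply_swap (a, b) v) = set v" "distinct (apply_swap (a, b) v) = distinct v"
  using assms by (auto simp: apply_swap_def distinct_map transpose_image_eq transpose_def)

text \<open>As \<open>a\<close> and \<open>b\<close> are neighbours, no third candidate stands
  between them, so exchanging them affects no comparison with others.\<close>

lemma rank_apply_swap_less_iff:
  assumes "a \<in> set v" "b \<in> set v" "rank a v + 1 = rank b v" "(x, y) \<noteq> (a, b)" "(x, y) \<noteq> (b, a)"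
  shows "rank x (apply_swap (a, b) v) < rank y (apply_swap (a, b) v) \<longleftrightarrow> rank x v < rank y v"
proof -
  have "x = a \<or> rank x v \<noteq> rank a v" "x = b \<or> rank x v \<noteq> rank b v"
    "y = a \<or> rank y v \<noteq> rank a v" "y = b \<or> rank y v \<noteq> rank b v"
    using rank_eq_iff[OF assms(1)] rank_eq_iff[OF assms(2)] by metis+
  then show ?thesis
    using assms(3-) unfolding rank_apply_swap transpose_def by auto
qed

text \<open>Each admissible swap changes only the relative order of its own two candidates, so a
  pair that is reversed at the end was swapped in this orientation at some step.\<close>

lemma admissible_seq_inversions:
  assumes "distinct v" "admissible_seq ss v"
  shows "distinct (fold apply_swap ss v) \<and> set (fold apply_swap ss v) = set v \<and>
    inversions v (fold apply_swap ss v) \<subseteq> set ss"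
  using assms
proof (induction ss arbitrary: v)
  case Nil
  then show ?case by (auto simp: inversions_def)
next
  case (Cons s ss)
  obtain a b where s: "s = (a, b)" by (cases s)
  from Cons.prems s have ab: "a \<in> set v" "b \<in> set v" "a \<noteq> b" "rank a v + 1 = rank b v"
    by (auto simp: admissible_swap_def)
  let ?v = "apply_swap (a, b) v" and ?w = "fold apply_swap ss (apply_swap s v)"
  have IH: "distinct ?w" "set ?w = set ?v" "inversions ?v ?w \<subseteq> set ss"
    using Cons.IH[of "apply_swap s v"] Cons.prems s ab by (auto simp: apply_swap_perm)
  have "(x, y) \<in> set (s # ss)" if "(x, y) \<in> inversions v ?w" for x y
  proof (cases "(x, y) \<in> inversions ?v ?w")
    case False
    from that have xy: "x \<in> set v" "y \<in> set v" "rank x v < rank y v" "rank y ?w < rank x ?w"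
      by (auto simp: inversions_def)
    have "x = a \<and> y = b"
    proof (rule ccontr)
      assume "\<not> (x = a \<and> y = b)"
      then have "rank x ?v < rank y ?v"
        using xy(3) ab by (subst rank_apply_swap_less_iff) auto
      with xy ab False show False by (auto simp: inversions_def apply_swap_perm)
    qed
    then show ?thesis by (simp add: s)
  qed (use IH in auto)
  then show ?case using IH ab by (auto simp: apply_swap_perm)
qed

text \<open>Otherwise the ranks in \<open>w\<close> would increase along \<open>v\<close>, and
  \<open>v\<close> and \<open>w\<close> would both be the list of candidates sorted by these
  ranks.\<close>

lemma ex_adjacent_inversion:
  assumes "distinct v" "distinct w" "set v = set w" "v \<noteq> w"
  obtains a b where "(a, b) \<in> inversions v w" "rank a v + 1 = rank b v"
proof -
  have "\<exists>i. Suc i < length v \<and> rank (v ! Suc i) w < rank (v ! i) w"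
  proof (rule ccontr)
    assume "\<not> ?thesis"
    then have "rank (v ! i) w \<le> rank (v ! Suc i) w" if "Suc i < length v" for i
      using that by (meson not_less)
    then have "sorted (map (\<lambda>c. rank c w) v)"
      by (simp add: sorted_iff_nth_Suc)
    moreover have "sorted (map (\<lambda>c. rank c w) w)"
      using assms(2) by (auto simp: sorted_iff_nth_Suc rank_nth)
    moreover have "inj_on (\<lambda>c. rank c w) (set v \<union> set w)"
      using assms(3) by (auto intro!: inj_onI simp: rank_eq_iff)
    ultimately have "v = w"
      using assms by (intro map_sorted_distinct_set_unique[of "\<lambda>c. rank c w"])
        (auto simp: distinct_map intro: inj_on_subset)
    with assms show False by simp
  qed
  then obtain i where i: "Suc i < length v" "rank (v ! Suc i) w < rank (v ! i) w" by blast
  show ?thesis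
    by (rule that[of "v ! i" "v ! Suc i"]) (use i assms(1) in \<open>auto simp: inversions_def rank_nth\<close>)
qed

text \<open>Swapping an adjacent inversion removes exactly this pair from the inversions and adds
  none. Hence no pair is swapped twice and the sequence is distinct, as \<open>swaps_to\<close>
  demands.\<close>

lemma swaps_to_inversions:
  assumes "distinct v" "distinct w" "set v = set w"
  shows "swaps_to (inversions v w) v w"
  using assms
proof (induction "card (inversions v w)" arbitrary: v rule: less_induct)
  case less
  show ?case
  proof (cases "v = w")
    case True
    then have "inversions v w = {}" by (auto simp: inversions_def)
    with True show ?thesis by (auto simp: swaps_to_def intro!: exI[of _ "[]"])
  next
    case False
    then obtain a b where ab: "(a, b) \<in> inversions v w" "rank a v + 1 = rank b v"
      using ex_adjacent_inversion less.prems by blast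
    let ?v = "apply_swap (a, b) v"
    from ab have in_set: "a \<in> set v" "b \<in> set v" and neq: "a \<noteq> b" and w: "rank b w < rank a w"
      by (auto simp: inversions_def)
    have inv: "inversions ?v w = inversions v w - {(a, b)}"
    proof -
      have "rank x ?v < rank y ?v \<longleftrightarrow> rank x v < rank y v"
        if "x \<in> set v" "y \<in> set v" "rank y w < rank x w" "(x, y) \<noteq> (a, b)" for x y
        using that ab(2) in_set w by (intro rank_apply_swap_less_iff) auto
      moreover have "\<not> rank a ?v < rank b ?v"
        using ab(2) by (simp add: rank_apply_swap)
      ultimately show ?thesis using in_set by (auto simp: inversions_def apply_swap_perm)
    qed
    then have "card (inversions ?v w) < card (inversions v w)"
      using ab(1) by (metis card_Diff1_less finite_inversions)
    then have "swaps_to (inversions ?v w) ?v w"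
      using less.prems in_set by (intro less.hyps) (auto simp: apply_swap_perm)
    then obtain ss where ss: "distinct ss" "set ss = inversions v w - {(a, b)}" "admissible_seq ss ?v"
      "w = fold apply_swap ss ?v"
      by (auto simp: swaps_to_def inv)
    then show ?thesis
      using ab in_set neq unfolding swaps_to_def
      by (intro exI[of _ "(a, b) # ss"]) (auto simp: admissible_swap_def)
  qed
qed

section \<open>Votes cut at the approval boundary\<close>

lemma rank_le_inversions:
  assumes "distinct (x @ z)" "distinct w" "set w = set (x @ z)" "c \<in> set x"
  shows "rank c w \<le> length x + card {b. (c, b) \<in> inversions (x @ z) w}"
proof -
  let ?I = "{b. (c, b) \<in> inversions (x @ z) w}"
  have fin: "finite ?I"
    by (rule finite_subset[of _ "snd ` inversions (x @ z) w"]) force+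
  \<comment> \<open>Whoever is ahead of \<open>c\<close> in \<open>w\<close> either stood in
    \<open>x\<close> already or has overtaken \<open>c\<close>.\<close>
  have "{b \<in> set w. rank b w < rank c w} \<subseteq> (set x - {c}) \<union> ?I"
  proof
    fix b assume "b \<in> {b \<in> set w. rank b w < rank c w}"
    then have b: "b \<in> set (x @ z)" "rank b w < rank c w" using assms by auto
    show "b \<in> (set x - {c}) \<union> ?I"
    proof (cases "rank c (x @ z) < rank b (x @ z)")
      case True
      with b assms show ?thesis by (auto simp: inversions_def)
    next
      case False
      then have "b \<in> set x" using assms b rank_le_length[of c x] rank_pos(1)[of b z]
        by (auto simp: rank_append simp del: rank_pos split: if_splits)
      with b show ?thesis by auto
    qed
  qed
  then have "card {b \<in> set w. rank b w < rank c w} \<le> card (set x - {c}) + card ?I"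
    by (intro order_trans[OF card_mono card_Un_le]) (use fin in auto)
  moreover have "Suc (card (set x - {c})) = length x"
    using assms by (metis List.finite_set card_Suc_Diff1 distinct_append distinct_card)
  ultimately show ?thesis
    using rank_card[of w c] assms by simp
qed

text \<open>The mirror image: a candidate of \<open>z\<close> that is not ahead of \<open>c\<close>
  in \<open>w\<close> has been overtaken by \<open>c\<close>.\<close>

lemma less_rank_inversions:
  assumes "distinct (z @ y)" "distinct w" "set w = set (z @ y)" "c \<in> set y"
  shows "length z < rank c w + card {a. (a, c) \<in> inversions (z @ y) w}"
proof -
  let ?I = "{a. (a, c) \<in> inversions (z @ y) w}"
  have fin: "finite ?I"
    by (rule finite_subset[of _ "fst ` inversions (z @ y) w"]) force+
  have cz: "c \<notin> set z" using assms by auto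
  have "set z \<subseteq> {b \<in> set w. rank b w < rank c w} \<union> ?I"
  proof
    fix b assume b: "b \<in> set z"
    then have "rank b (z @ y) < rank c (z @ y)"
      using rank_le_length[OF b] b cz rank_pos(1)[of c y] by (simp add: rank_append del: rank_pos)
    moreover have "rank b w \<noteq> rank c w" using rank_eq_iff[of b w c] b cz assms by auto
    ultimately show "b \<in> {b \<in> set w. rank b w < rank c w} \<union> ?I"
      using b assms by (auto simp: inversions_def)
  qed
  then have "card (set z) \<le> card {b \<in> set w. rank b w < rank c w} + card ?I"
    by (intro order_trans[OF card_mono card_Un_le]) (use fin in auto)
  moreover have "card (set z) = length z" using assms by (simp add: distinct_card)
  ultimately show ?thesis
    using rank_card[of w c] assms by simp
qed

lemma inversions_map:
  assumes "inj_on f (set v)" "set w = set v"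
  shows "inversions (map f v) (map f w) = map_prod f f ` inversions v w"
proof -
  have r: "rank (f c) (map f v) = rank c v" "rank (f c) (map f w) = rank c w" if "c \<in> set v" for c
    using that assms by (simp_all add: rank_map insert_absorb)
  show ?thesis
    by (force simp: inversions_def r image_iff)
qed

text \<open>Candidates outside the middle keep their ranks and the middle keeps its range of
  positions, so a pair can be reversed only inside it. The inclusion suffices, as it bounds the cost
  from above.\<close>

lemma inversions_middle:
  assumes "distinct (x @ m @ y)" "set u = set m" "length u = length m"
  shows "inversions (x @ m @ y) (x @ u @ y) \<subseteq> inversions m u"
proof safe
  fix a b assume ab: "(a, b) \<in> inversions (x @ m @ y) (x @ u @ y)"
  let ?v = "x @ m @ y" and ?w = "x @ u @ y"
  from ab have less: "rank a ?v < rank b ?v" "rank b ?w < rank a ?w"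
    by (auto simp: inversions_def)
  have out: "rank c ?v = rank c ?w \<and> (rank c ?v \<le> length x \<or> length x + length m < rank c ?v)"
    if "c \<notin> set m" for c
    using that assms rank_le_length[of c x] by (auto simp: rank_append)
  have mid: "length x < rank c ?v \<and> rank c ?v \<le> length x + length m \<and>
      length x < rank c ?w \<and> rank c ?w \<le> length x + length m" if "c \<in> set m" for c
    using that assms rank_le_length[of c m] rank_le_length[of c u] by (auto simp: rank_append)
  have "a \<in> set m \<and> b \<in> set m"
    using less out[of a] out[of b] mid[of a] mid[of b]
    by (cases "a \<in> set m"; cases "b \<in> set m") linarith+
  then show "(a, b) \<in> inversions m u"
    using ab assms by (auto simp: inversions_def rank_append split: if_splits)
qed

text \<open>The two bounds keep \<open>x\<close> approved and \<open>y\<close> not approved in \<open>w\<close>, so that only the order of \<open>w\<close> within the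
  window matters.\<close>

lemma window_normal_form:
  fixes x u1 u2 y w :: vote
  defines "v \<equiv> x @ u1 @ u2 @ y" and "u \<equiv> filter (\<lambda>c. c \<in> set (u1 @ u2)) w"
    and "q \<equiv> length x + length u1"
  assumes v: "distinct v" and w: "distinct w" "set w = set v"
    and x: "\<And>c. c \<in> set x \<Longrightarrow> card {b. (c, b) \<in> inversions v w} \<le> length u1"
    and y: "\<And>c. c \<in> set y \<Longrightarrow> card {a. (a, c) \<in> inversions v w} \<le> length u2"
  shows "distinct u" "set u = set (u1 @ u2)" "set (take q w) = set (take q (x @ u @ y))"
    "inversions (u1 @ u2) u \<subseteq> inversions v w"
proof -
  show "distinct u" "set u = set (u1 @ u2)" using w by (auto simp: u_def v_def)
  let ?U = "set (u1 @ u2)" and ?T = "set (take q w)"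
  have len: "length w = length v" using v w by (metis distinct_card)
  have xT: "set x \<subseteq> ?T"
  proof
    fix c assume c: "c \<in> set x"
    have "rank c w \<le> q"
      using rank_le_inversions[of x "u1 @ u2 @ y" w c] v w c x[OF c] by (auto simp: v_def q_def)
    then show "c \<in> ?T" using rank_le_iff[of c w q] w c by (simp add: v_def)
  qed
  have yT: "set y \<inter> ?T = {}"
  proof -
    have "c \<notin> ?T" if c: "c \<in> set y" for c
    proof -
      have "q < rank c w"
        using less_rank_inversions[of "x @ u1 @ u2" y w c] v w c y[OF c] by (auto simp: v_def q_def)
      then show ?thesis using rank_le_iff[of c w q] w c by (simp add: v_def)
    qed
    then show ?thesis by blast
  qed
  \<comment> \<open>The first \<open>q\<close> places of \<open>w\<close> hold all of
    \<open>x\<close> and none of \<open>y\<close>. Counting leaves exactly \<open>length u1\<close>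
    of them for the window.\<close>
  have T: "?T = set x \<union> (?T \<inter> ?U)"
    using xT yT set_take_subset[of q w] w by (auto simp: v_def)
  have "card ?T = q"
    using w len by (subst distinct_card) (auto simp: v_def q_def)
  moreover have "card ?T = card (set x) + card (?T \<inter> ?U)"
    using v by (subst T, subst card_Un_disjoint) (auto simp: v_def)
  moreover have "card (set x) = length x" using v by (simp add: v_def distinct_card)
  ultimately have card: "card (?T \<inter> ?U) = length u1" by (simp add: q_def)
  \<comment> \<open>Filtering keeps the order of \<open>w\<close>, so the approved candidates of the
    window form an initial segment of \<open>u\<close>.\<close>
  have "u = filter (\<lambda>c. c \<in> ?U) (take q w) @ filter (\<lambda>c. c \<in> ?U) (drop q w)"
    by (simp add: u_def flip: filter_append)
  moreover have "length (filter (\<lambda>c. c \<in> ?U) (take q w)) = length u1"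
  proof -
    have "length (filter (\<lambda>c. c \<in> ?U) (take q w)) = card (set (filter (\<lambda>c. c \<in> ?U) (take q w)))"
      using w by (subst distinct_card) auto
    also have "set (filter (\<lambda>c. c \<in> ?U) (take q w)) = ?T \<inter> ?U" by auto
    finally show ?thesis using card by simp
  qed
  ultimately have "take (length u1) u = filter (\<lambda>c. c \<in> ?U) (take q w)" and lu: "length u1 \<le> length u"
    by (metis append_eq_conv_conj, metis length_append le_add1)
  then have "set (take (length u1) u) = ?T \<inter> ?U" by auto
  then show "?T = set (take q (x @ u @ y))"
    using T lu by (simp add: q_def)
  show "inversions (u1 @ u2) u \<subseteq> inversions v w"
  proof safe
    fix a b assume ab: "(a, b) \<in> inversions (u1 @ u2) u"
    then have U: "a \<in> ?U" "b \<in> ?U" "rank a (u1 @ u2) < rank b (u1 @ u2)" "rank b u < rank a u"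
      by (auto simp: inversions_def)
    then have "rank b w < rank a w"
      by (simp only: u_def rank_filter_less_iff[where P="\<lambda>c. c \<in> ?U"])
    moreover have "rank c v = length x + rank c (u1 @ u2)" if "c \<in> ?U" for c
      using v that unfolding v_def by (subst rank_append) (auto simp: rank_append)
    ultimately show "(a, b) \<in> inversions v w"
      using U by (auto simp: inversions_def v_def)
  qed
qed

section \<open>Bribery as a choice of new votes\<close>

lemma score_eq:
  assumes "\<And>v. v \<in> set V \<Longrightarrow> c \<in> set v"
  shows "score k V c = card {i. i < length V \<and> c \<in> set (take k (V ! i))}"
  unfolding score_def using assms by (intro arg_cong[where f=card]) (auto simp: rank_le_iff)

definition inv_cost :: "instance_sb \<Rightarrow> nat \<Rightarrow> vote \<Rightarrow> vote \<Rightarrow> nat" where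
  "inv_cost I i v w = (\<Sum>(a, b)\<in>inversions v w. swap_cost I i a b)"

lemma swap_bribery_inversions:
  assumes "is_instance I"
  shows "swap_bribery I \<longleftrightarrow> (\<exists>W. length W = num_votes I \<and>
    (\<forall>i<num_votes I. distinct (W ! i) \<and> set (W ! i) = cands I) \<and>
    (\<Sum>i<num_votes I. inv_cost I i (votes I ! i) (W ! i)) \<le> budget I \<and>
    winner (approval I) (cands I) W (preferred I))"
proof -
  let ?n = "num_votes I" and ?V = "votes I"
  have V: "distinct (?V ! i)" "set (?V ! i) = cands I" if "i < ?n" for i
    using assms that by (auto simp: is_instance_def)
  have fin: "finite (swaps I)"
    by (rule finite_subset[of _ "{..<?n} \<times> cands I \<times> cands I"]) (auto simp: swaps_def)
  have cost: "(\<Sum>(i, a, b)\<in>Sigma {..<?n} (\<lambda>i. inversions (?V ! i) (W ! i)). swap_cost I i a b) =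
    (\<Sum>i<?n. inv_cost I i (?V ! i) (W ! i))" for W
    by (simp add: sum.Sigma inv_cost_def split_def)
  show ?thesis
  proof
    assume "swap_bribery I"
    then obtain S W where S: "S \<subseteq> swaps I" and W: "length W = ?n"
      and sw: "\<And>i. i < ?n \<Longrightarrow> swaps_to {(a, b). (i, a, b) \<in> S} (?V ! i) (W ! i)"
      and le: "(\<Sum>(i, a, b)\<in>S. swap_cost I i a b) \<le> budget I"
      and win: "winner (approval I) (cands I) W (preferred I)"
      by (auto simp: swap_bribery_def)
    have *: "distinct (W ! i) \<and> set (W ! i) = cands I \<and>
        inversions (?V ! i) (W ! i) \<subseteq> {(a, b). (i, a, b) \<in> S}" if i: "i < ?n" for i
    proof -
      obtain ss where ss: "set ss = {(a, b). (i, a, b) \<in> S}" "admissible_seq ss (?V ! i)"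
        "W ! i = fold apply_swap ss (?V ! i)"
        using sw[OF i] by (auto simp: swaps_to_def)
      from admissible_seq_inversions[OF V(1)[OF i] ss(2)] V(2)[OF i] show ?thesis
        unfolding ss(3)[symmetric] ss(1) by auto
    qed
    have "(\<Sum>i<?n. inv_cost I i (?V ! i) (W ! i)) \<le> (\<Sum>(i, a, b)\<in>S. swap_cost I i a b)"
      unfolding cost[symmetric]
      by (rule sum_mono2) (use S fin * in \<open>auto intro: finite_subset\<close>)
    with W * le win show "\<exists>W. length W = ?n \<and>
      (\<forall>i<?n. distinct (W ! i) \<and> set (W ! i) = cands I) \<and>
      (\<Sum>i<?n. inv_cost I i (?V ! i) (W ! i)) \<le> budget I \<and>
      winner (approval I) (cands I) W (preferred I)"
      by (intro exI[of _ W]) auto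
  next
    assume "\<exists>W. length W = ?n \<and>
      (\<forall>i<?n. distinct (W ! i) \<and> set (W ! i) = cands I) \<and>
      (\<Sum>i<?n. inv_cost I i (?V ! i) (W ! i)) \<le> budget I \<and>
      winner (approval I) (cands I) W (preferred I)"
    then obtain W where W: "length W = ?n"
      "\<And>i. i < ?n \<Longrightarrow> distinct (W ! i) \<and> set (W ! i) = cands I"
      "(\<Sum>i<?n. inv_cost I i (?V ! i) (W ! i)) \<le> budget I"
      "winner (approval I) (cands I) W (preferred I)" by blast
    let ?S = "Sigma {..<?n} (\<lambda>i. inversions (?V ! i) (W ! i))"
    have "?S \<subseteq> swaps I"
      using inversions_subset V by (auto simp: swaps_def inversions_irrefl) blast+
    moreover have "swaps_to {(a, b). (i, a, b) \<in> ?S} (?V ! i) (W ! i)" if "i < ?n" for i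
    proof -
      have "{(a, b). (i, a, b) \<in> ?S} = inversions (?V ! i) (W ! i)" using that by auto
      then show ?thesis using swaps_to_inversions V W that by metis
    qed
    ultimately show "swap_bribery I"
      using W cost[of W] unfolding swap_bribery_def by (intro exI[of _ ?S] exI[of _ W]) auto
  qed
qed

text \<open>Stated for an arbitrary cut of each vote because it serves both the given instance and
  the kernel. The hypothesis \<open>fixed\<close> counts inversions per candidate: it holds where
  the adjacent half of the window has \<open>budget I\<close> places, and also for a candidate that
  takes part in no affordable inversion.\<close>

lemma swap_bribery_normal_form:
  assumes I: "is_instance I"
    and V: "\<And>i. i < num_votes I \<Longrightarrow> votes I ! i = X i @ U1 i @ U2 i @ Y i"
    and cut: "\<And>i. i < num_votes I \<Longrightarrow> min (approval I) (num_cands I) = length (X i) + length (U1 i)"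
    and fixed: "\<And>i w c. i < num_votes I \<Longrightarrow> distinct w \<Longrightarrow> set w = cands I \<Longrightarrow>
      inv_cost I i (votes I ! i) w \<le> budget I \<Longrightarrow>
      (c \<in> set (X i) \<longrightarrow> card {b. (c, b) \<in> inversions (votes I ! i) w} \<le> length (U1 i)) \<and>
      (c \<in> set (Y i) \<longrightarrow> card {a. (a, c) \<in> inversions (votes I ! i) w} \<le> length (U2 i))"
  shows "swap_bribery I \<longleftrightarrow> (\<exists>U.
    (\<forall>i<num_votes I. distinct (U i) \<and> set (U i) = set (U1 i @ U2 i)) \<and>
    (\<Sum>i<num_votes I. inv_cost I i (U1 i @ U2 i) (U i)) \<le> budget I \<and>
    winner (approval I) (cands I) (map (\<lambda>i. X i @ U i @ Y i) [0..<num_votes I]) (preferred I))"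
proof -
  let ?n = "num_votes I" and ?V = "votes I" and ?k = "approval I"
  have VI: "distinct (?V ! i)" "set (?V ! i) = cands I" if "i < ?n" for i
    using I that by (auto simp: is_instance_def)
  have mono: "inv_cost I i v w \<le> inv_cost I i v' w'" if "inversions v w \<subseteq> inversions v' w'" for i v w v' w'
    unfolding inv_cost_def by (rule sum_mono2) (use that in auto)
  show ?thesis
    unfolding swap_bribery_inversions[OF I]
  proof
    assume "\<exists>W. length W = ?n \<and> (\<forall>i<?n. distinct (W ! i) \<and> set (W ! i) = cands I) \<and>
      (\<Sum>i<?n. inv_cost I i (?V ! i) (W ! i)) \<le> budget I \<and> winner ?k (cands I) W (preferred I)"
    then obtain W where W: "length W = ?n"
      "\<And>i. i < ?n \<Longrightarrow> distinct (W ! i)" "\<And>i. i < ?n \<Longrightarrow> set (W ! i) = cands I"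
      and cost: "(\<Sum>i<?n. inv_cost I i (?V ! i) (W ! i)) \<le> budget I"
      and win: "winner ?k (cands I) W (preferred I)" by blast
    define U where "U i = filter (\<lambda>c. c \<in> set (U1 i @ U2 i)) (W ! i)" for i
    let ?W = "map (\<lambda>i. X i @ U i @ Y i) [0..<?n]"
    have cost_i: "inv_cost I i (?V ! i) (W ! i) \<le> budget I" if "i < ?n" for i
      using cost member_le_sum[of i "{..<?n}" "\<lambda>i. inv_cost I i (?V ! i) (W ! i)"] that by simp
    have *: "distinct (U i) \<and> set (U i) = set (U1 i @ U2 i) \<and>
      set (take (length (X i) + length (U1 i)) (W ! i)) =
        set (take (length (X i) + length (U1 i)) (X i @ U i @ Y i)) \<and>
      inversions (U1 i @ U2 i) (U i) \<subseteq> inversions (?V ! i) (W ! i)" if i: "i < ?n" for i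
    proof -
      have w: "distinct (X i @ U1 i @ U2 i @ Y i)" "distinct (W ! i)" "set (W ! i) = set (X i @ U1 i @ U2 i @ Y i)"
        using VI[OF i] W i V[OF i] by simp_all
      have "\<And>c. c \<in> set (X i) \<Longrightarrow> card {b. (c, b) \<in> inversions (X i @ U1 i @ U2 i @ Y i) (W ! i)} \<le> length (U1 i)"
       "\<And>c. c \<in> set (Y i) \<Longrightarrow> card {a. (a, c) \<in> inversions (X i @ U1 i @ U2 i @ Y i) (W ! i)} \<le> length (U2 i)"
        using fixed[OF i, of "W ! i"] W i cost_i[OF i] by (simp_all add: V[OF i])
      from window_normal_form[OF w this] show ?thesis by (simp add: U_def V[OF i])
    qed
    have top: "set (take ?k (W ! i)) = set (take ?k (?W ! i))" and mem: "set (?W ! i) = cands I"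
      if i: "i < ?n" for i
    proof -
      show set: "set (?W ! i) = cands I" using *[OF i] VI(2)[OF i] V[OF i] i by (simp add: Un_assoc)
      \<comment> \<open>The approval number may exceed the number of candidates, and then the
        boundary lies at the end of the vote.\<close>
      have "length (W ! i) = num_cands I" using W i by (metis card_lessThan distinct_card)
      then have a: "take ?k (W ! i) = take (min ?k (num_cands I)) (W ! i)" by (simp add: min_def)
      have "distinct (?W ! i)" using *[OF i] VI(1)[OF i] V[OF i] i by auto
      then have "length (?W ! i) = num_cands I" using set by (metis card_lessThan distinct_card)
      then have b: "take ?k (?W ! i) = take (min ?k (num_cands I)) (?W ! i)" by (simp add: min_def)
      show "set (take ?k (W ! i)) = set (take ?k (?W ! i))"
        unfolding a b cut[OF i] using *[OF i] i by simp
    qed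
    have "score ?k ?W c = score ?k W c" if "c \<in> cands I" for c
    proof -
      have "score ?k ?W c = card {i. i < length ?W \<and> c \<in> set (take ?k (?W ! i))}"
      proof (rule score_eq)
        fix v assume "v \<in> set ?W"
        then obtain i where i: "i < ?n" and v: "v = ?W ! i" by (auto simp: in_set_conv_nth)
        show "c \<in> set v" unfolding v mem[OF i] by (rule that)
      qed
      also have "\<dots> = card {i. i < length W \<and> c \<in> set (take ?k (W ! i))}"
        using W top by (intro arg_cong[where f=card]) auto
      also have "\<dots> = score ?k W c"
      proof (rule score_eq[symmetric])
        fix v assume "v \<in> set W"
        then obtain i where i: "i < ?n" and v: "v = W ! i" using W(1) by (auto simp: in_set_conv_nth)
        show "c \<in> set v" unfolding v W(3)[OF i] by (rule that)
      qed
      finally show ?thesis .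
    qed
    then have "winner ?k (cands I) ?W (preferred I)"
      using win by (simp add: winner_def)
    moreover have "(\<Sum>i<?n. inv_cost I i (U1 i @ U2 i) (U i)) \<le> budget I"
      by (rule order_trans[OF sum_mono cost]) (use * mono in auto)
    ultimately show "\<exists>U. (\<forall>i<?n. distinct (U i) \<and> set (U i) = set (U1 i @ U2 i)) \<and>
      (\<Sum>i<?n. inv_cost I i (U1 i @ U2 i) (U i)) \<le> budget I \<and>
      winner ?k (cands I) (map (\<lambda>i. X i @ U i @ Y i) [0..<?n]) (preferred I)"
      using * by (intro exI[of _ U]) auto
  next
    assume "\<exists>U. (\<forall>i<?n. distinct (U i) \<and> set (U i) = set (U1 i @ U2 i)) \<and>
      (\<Sum>i<?n. inv_cost I i (U1 i @ U2 i) (U i)) \<le> budget I \<and>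
      winner ?k (cands I) (map (\<lambda>i. X i @ U i @ Y i) [0..<?n]) (preferred I)"
    then obtain U where U: "\<And>i. i < ?n \<Longrightarrow> distinct (U i) \<and> set (U i) = set (U1 i @ U2 i)"
      and cost: "(\<Sum>i<?n. inv_cost I i (U1 i @ U2 i) (U i)) \<le> budget I"
      and win: "winner ?k (cands I) (map (\<lambda>i. X i @ U i @ Y i) [0..<?n]) (preferred I)" by blast
    let ?W = "map (\<lambda>i. X i @ U i @ Y i) [0..<?n]"
    have "inv_cost I i (?V ! i) (?W ! i) \<le> inv_cost I i (U1 i @ U2 i) (U i)" if i: "i < ?n" for i
    proof (rule mono)
      have "length (U i) = length (U1 i @ U2 i)"
        using U[OF i] VI(1)[OF i] V[OF i] by (metis distinct_append distinct_card append_assoc)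
      then show "inversions (?V ! i) (?W ! i) \<subseteq> inversions (U1 i @ U2 i) (U i)"
        using inversions_middle[of "X i" "U1 i @ U2 i" "Y i" "U i"] U[OF i] VI(1)[OF i] V[OF i] i by simp
    qed
    then have "(\<Sum>i<?n. inv_cost I i (?V ! i) (?W ! i)) \<le> budget I"
      by (intro order_trans[OF sum_mono cost]) auto
    moreover have "distinct (?W ! i) \<and> set (?W ! i) = cands I" if i: "i < ?n" for i
      using U[OF i] VI[OF i] V[OF i] i by auto
    ultimately show "\<exists>W. length W = ?n \<and> (\<forall>i<?n. distinct (W ! i) \<and> set (W ! i) = cands I) \<and>
      (\<Sum>i<?n. inv_cost I i (?V ! i) (W ! i)) \<le> budget I \<and> winner ?k (cands I) W (preferred I)"
      using win by (intro exI[of _ ?W]) auto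
  qed
qed

section \<open>The kernel\<close>

text \<open>The approved part is reversed so that \<open>take\<close> starts at the
  boundary.\<close>

definition window :: "nat \<Rightarrow> nat \<Rightarrow> vote \<Rightarrow> vote" where
  "window b k v = take b (rev (take k v)) @ take b (drop k v)"

definition approvals :: "nat \<Rightarrow> vote list \<Rightarrow> nat \<Rightarrow> nat" where
  "approvals k V c = length (filter (\<lambda>v. c \<in> set (take k v)) V)"

definition candidates :: "vote list \<Rightarrow> nat list" where
  "candidates V = [0..<length (hd V)]"

definition frozen :: "nat \<Rightarrow> nat \<Rightarrow> vote list \<Rightarrow> nat list" where
  "frozen b k V = filter (\<lambda>c. \<forall>v\<in>set V. c \<notin> set (window b k v)) (candidates V)"

text \<open>A list rather than a candidate, because there may be no frozen candidate at all.\<close>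

definition best_frozen :: "nat \<Rightarrow> nat \<Rightarrow> vote list \<Rightarrow> nat list" where
  "best_frozen b k V =
     take 1 (filter (\<lambda>d. \<forall>e\<in>set (frozen b k V). approvals k V e \<le> approvals k V d) (frozen b k V))"

definition kept :: "nat \<Rightarrow> nat \<Rightarrow> nat \<Rightarrow> vote list \<Rightarrow> nat list" where
  "kept b k p V = filter (\<lambda>c. c = p \<or> (\<exists>v\<in>set V. c \<in> set (window b k v)) \<or> c \<in> set (best_frozen b k V))
     (candidates V)"

text \<open>The kernel's candidates are pairs, renamed to their positions in this list: \<open>(0, c)\<close> is the kept
  candidate \<open>c\<close>, and \<open>(Suc i, c)\<close> is a dummy that is approved in vote \<open>i\<close> only, and only if \<open>c\<close> is not.
  Thus all votes approve the same number of candidates.\<close>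

definition names :: "nat list \<Rightarrow> vote list \<Rightarrow> (nat \<times> nat) list" where
  "names R V = map (Pair 0) R @ concat (map (\<lambda>i. map (Pair (Suc i)) R) [0..<length V])"

text \<open>Written as a search in the enumerated list, so that the closure rules apply to
  it.\<close>

definition label :: "(nat \<times> nat) list \<Rightarrow> nat \<times> nat \<Rightarrow> nat" where
  "label X z = fst (hd (filter (\<lambda>w. snd w = z) (List.enumerate 0 X)))"

definition pad :: "nat \<Rightarrow> nat \<Rightarrow> vote \<Rightarrow> nat \<times> nat \<Rightarrow> bool" where
  "pad k i v z \<longleftrightarrow> fst z = Suc i \<and> snd z \<in> set (drop k v)"

definition kernel_vote :: "nat \<Rightarrow> nat list \<Rightarrow> (nat \<times> nat) list \<Rightarrow> nat \<Rightarrow> vote \<Rightarrow> (nat \<times> nat) list" where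
  "kernel_vote k R X i v = filter (pad k i v) X @ map (Pair 0) (filter (\<lambda>c. c \<in> set R) v) @
     filter (\<lambda>z. fst z \<noteq> 0 \<and> \<not> pad k i v z) X"

text \<open>Agrees with \<open>t ! a ! b\<close> inside the table; \<open>drop\<close> and
  \<open>hd\<close> are functions with a closure rule.\<close>

definition lookup :: "nat list list \<Rightarrow> nat \<Rightarrow> nat \<Rightarrow> nat" where
  "lookup t a b = hd (drop b (hd (drop a t)))"

text \<open>All costs above the budget are equally prohibitive, so \<open>Suc b\<close> replaces
  them and keeps the encoding small. The same value freezes the dummies, and the diagonal is 0 as in
  \<open>cost_table\<close>.\<close>

definition kernel_cost :: "nat \<Rightarrow> nat list list \<Rightarrow> nat \<times> nat \<Rightarrow> nat \<times> nat \<Rightarrow> nat" where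
  "kernel_cost b t z w = (if z = w then 0
     else if fst z = 0 \<and> fst w = 0 \<and> lookup t (snd z) (snd w) \<le> b then lookup t (snd z) (snd w)
     else Suc b)"

text \<open>The final \<open>unit\<close> is encoded by \<open>Leaf\<close>, the end of the list in
  \<open>enc_instance\<close>. Nested pairs and the list of components thus have the same
  tree.\<close>

type_synonym data = "nat \<times> vote list \<times> nat \<times> nat \<times> nat list list list \<times> nat \<times> unit"

definition reduced :: "nat list \<Rightarrow> (nat \<times> nat) list \<Rightarrow> vote list \<Rightarrow> nat \<Rightarrow> nat \<Rightarrow> nat list list list \<Rightarrow> nat \<Rightarrow> data" where
  "reduced R X V k p T b =
     (length X, map (\<lambda>z. map (label X) (kernel_vote k R X (fst z) (snd z))) (List.enumerate 0 V),
      length R, label X (0, p), map (\<lambda>t. map (\<lambda>z. map (kernel_cost b t z) X) X) T, b, ())"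

definition trivial_yes :: data where
  "trivial_yes = (1, [], 0, 0, [], 0, ())"

text \<open>Candidate 1 could win only by a swap of cost 1, and the budget is 0.\<close>

definition trivial_no :: data where
  "trivial_no = (2, [[0, 1]], 1, 1, [[[0, 1], [1, 0]]], 0, ())"

text \<open>An empty election and \<open>k = 0\<close> come first: all scores are 0 there, so
  \<open>p\<close> wins, whereas for \<open>k = 0\<close> the approved dummies would beat it. For
  \<open>b = 0\<close> no vote can change, so comparing the present scores decides the
  instance.\<close>

definition kernel_data :: "vote list \<Rightarrow> nat \<Rightarrow> nat \<Rightarrow> nat list list list \<Rightarrow> nat \<Rightarrow> data" where
  "kernel_data V k p T b =
     (if V = [] \<or> k = 0 then trivial_yes
      else if b = 0 then
        (if \<forall>c\<in>set (candidates V). approvals k V c \<le> approvals k V p then trivial_yes else trivial_no)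
      else reduced (kept b k p V) (names (kept b k p V) V) V k p T b)"

abbreviation "enc_nats \<equiv> enc_list enc_nat"
abbreviation "enc_votes \<equiv> enc_list enc_nats"
abbreviation "enc_table \<equiv> enc_list enc_votes"
abbreviation "enc_name \<equiv> enc_pair enc_nat enc_nat"

abbreviation enc_unit :: "unit \<Rightarrow> tree" where
  "enc_unit \<equiv> \<lambda>_. Leaf"

definition enc_data :: "data \<Rightarrow> tree" where
  "enc_data = enc_pair enc_nat (enc_pair enc_votes (enc_pair enc_nat (enc_pair enc_nat
     (enc_pair enc_table (enc_pair enc_nat enc_unit)))))"

section \<open>The kernel in polynomial time\<close>

lemma ptime_window [ptime_intros]:
  assumes "ptime e enc_nat b" "ptime e enc_nat k" "ptime e enc_nats v"
  shows "ptime e enc_nats (\<lambda>x. window (b x) (k x) (v x))"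
  unfolding window_def by (rule ptime_intros assms[THEN ptime_comp])+

text \<open>Inside \<open>filter\<close> the input is paired with a list entry. Composing the
  assumptions with a projection, as \<open>ptime_comp\<close> does, makes them available
  there.\<close>

lemma ptime_approvals [ptime_intros]:
  assumes "ptime e enc_nat k" "ptime e enc_votes V" "ptime e enc_nat c"
  shows "ptime e enc_nat (\<lambda>x. approvals (k x) (V x) (c x))"
  unfolding approvals_def by (rule ptime_intros assms[THEN ptime_comp])+

lemma ptime_candidates [ptime_intros]:
  assumes "ptime e enc_votes V"
  shows "ptime e enc_nats (\<lambda>x. candidates (V x))"
  unfolding candidates_def by (rule ptime_intros assms[THEN ptime_comp])+

lemma ptime_frozen [ptime_intros]:
  assumes "ptime e enc_nat b" "ptime e enc_nat k" "ptime e enc_votes V"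
  shows "ptime e enc_nats (\<lambda>x. frozen (b x) (k x) (V x))"
  unfolding frozen_def by (rule ptime_intros assms[THEN ptime_comp])+

lemma ptime_best_frozen [ptime_intros]:
  assumes "ptime e enc_nat b" "ptime e enc_nat k" "ptime e enc_votes V"
  shows "ptime e enc_nats (\<lambda>x. best_frozen (b x) (k x) (V x))"
  unfolding best_frozen_def by (rule ptime_intros assms[THEN ptime_comp])+

lemma ptime_kept [ptime_intros]:
  assumes "ptime e enc_nat b" "ptime e enc_nat k" "ptime e enc_nat p" "ptime e enc_votes V"
  shows "ptime e enc_nats (\<lambda>x. kept (b x) (k x) (p x) (V x))"
  unfolding kept_def by (rule ptime_intros assms[THEN ptime_comp])+

lemma ptime_names [ptime_intros]:
  assumes "ptime e enc_nats R" "ptime e enc_votes V"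
  shows "ptime e (enc_list enc_name) (\<lambda>x. names (R x) (V x))"
  unfolding names_def by (rule ptime_intros assms[THEN ptime_comp])+

lemma ptime_label [ptime_intros]:
  assumes "ptime e (enc_list enc_name) X" "ptime e enc_name z"
  shows "ptime e enc_nat (\<lambda>x. label (X x) (z x))"
  unfolding label_def by (rule ptime_intros assms[THEN ptime_comp])+

lemma ptime_pad [ptime_intros]:
  assumes "ptime e enc_nat k" "ptime e enc_nat i" "ptime e enc_nats v" "ptime e enc_name z"
  shows "ptime e enc_bool (\<lambda>x. pad (k x) (i x) (v x) (z x))"
  unfolding pad_def by (rule ptime_intros assms[THEN ptime_comp])+

lemma ptime_kernel_vote [ptime_intros]:
  assumes "ptime e enc_nat k" "ptime e enc_nats R" "ptime e (enc_list enc_name) X"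
    "ptime e enc_nat i" "ptime e enc_nats v"
  shows "ptime e (enc_list enc_name) (\<lambda>x. kernel_vote (k x) (R x) (X x) (i x) (v x))"
  unfolding kernel_vote_def by (rule ptime_intros assms[THEN ptime_comp])+

lemma ptime_lookup [ptime_intros]:
  assumes "ptime e enc_votes t" "ptime e enc_nat a" "ptime e enc_nat b"
  shows "ptime e enc_nat (\<lambda>x. lookup (t x) (a x) (b x))"
  unfolding lookup_def by (rule ptime_intros assms[THEN ptime_comp])+

lemma ptime_kernel_cost [ptime_intros]:
  assumes "ptime e enc_nat b" "ptime e enc_votes t" "ptime e enc_name z" "ptime e enc_name w"
  shows "ptime e enc_nat (\<lambda>x. kernel_cost (b x) (t x) (z x) (w x))"
  unfolding kernel_cost_def by (rule ptime_intros assms[THEN ptime_comp])+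

lemma ptime_reduced [ptime_intros]:
  assumes "ptime e enc_nats R" "ptime e (enc_list enc_name) X" "ptime e enc_votes V"
    "ptime e enc_nat k" "ptime e enc_nat p" "ptime e enc_table T" "ptime e enc_nat b"
  shows "ptime e enc_data (\<lambda>x. reduced (R x) (X x) (V x) (k x) (p x) (T x) (b x))"
  unfolding reduced_def enc_data_def by (rule ptime_intros assms[THEN ptime_comp])+

lemma ptime_kernel_data [ptime_intros]:
  assumes "ptime e enc_votes V" "ptime e enc_nat k" "ptime e enc_nat p" "ptime e enc_table T"
    "ptime e enc_nat b"
  shows "ptime e enc_data (\<lambda>x. kernel_data (V x) (k x) (p x) (T x) (b x))"
  unfolding kernel_data_def by (rule ptime_intros assms[THEN ptime_comp])+

text \<open>What is transformed are pairs of an instance and its parameter, so the new parameter is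
  output too, read off the new instance as its number of votes and its budget.\<close>

lemma ptime_kernel:
  "ptime (enc_pair enc_data enc_name) (enc_pair enc_data enc_name)
    (\<lambda>x. let D = kernel_data (fst (snd (fst x))) (fst (snd (snd (fst x)))) (fst (snd (snd (snd (fst x)))))
        (fst (snd (snd (snd (snd (fst x)))))) (fst (snd (snd (snd (snd (snd (fst x)))))))
      in (D, length (fst (snd D)), fst (snd (snd (snd (snd (snd D)))))))"
proof -
  have *: "ptime (enc_pair enc_data enc_name) enc_data (\<lambda>x. kernel_data (fst (snd (fst x)))
    (fst (snd (snd (fst x)))) (fst (snd (snd (snd (fst x)))))
    (fst (snd (snd (snd (snd (fst x)))))) (fst (snd (snd (snd (snd (snd (fst x))))))))"
    unfolding enc_data_def[symmetric] by (rule ptime_kernel_data; unfold enc_data_def; (rule ptime_intros)+)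
  have "ptime enc_data (enc_pair enc_data enc_name) (\<lambda>D. (D, length (fst (snd D)), fst (snd (snd (snd (snd (snd D)))))))"
    unfolding enc_data_def by (rule ptime_intros)+
  from ptime_comp[OF this *] show ?thesis by (simp add: Let_def)
qed

lemma ptime_poly_time_on: "ptime ea eb f \<Longrightarrow> poly_time_on A ea eb f"
  unfolding ptime_def poly_time_on_def implements_def runs_def computes_in_def
  by (smt (verit, ccfv_threshold) fun_upd_same)

section \<open>Names and labels of the kernel's candidates\<close>

lemma distinct_names:
  assumes "distinct R"
  shows "distinct (names R V)"
proof -
  have "distinct (concat (map (\<lambda>i. map (Pair (Suc i)) R) is))" if "distinct is" for "is" :: "nat list"
    using that assms by (induction "is") (auto simp: distinct_map inj_on_def)
  then show ?thesis
    using assms by (auto simp: names_def distinct_map inj_on_def)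
qed

lemma set_names: "set (names R V) = {..length V} \<times> set R"
proof -
  have "{..length V} = insert 0 (Suc ` {..<length V})"
    by (simp add: lessThan_Suc_atMost[symmetric] lessThan_Suc_eq_insert_0)
  then show ?thesis by (auto simp: names_def)
qed

lemma length_names: "length (names R V) = Suc (length V) * length R"
  by (simp add: names_def length_concat comp_def sum_list_triv)

lemma label_nth:
  assumes "distinct X" "j < length X"
  shows "label X (X ! j) = j"
proof -
  let ?F = "filter (\<lambda>w. snd w = X ! j) (List.enumerate 0 X)"
  have F: "w \<in> set ?F \<longleftrightarrow> w = (j, X ! j)" for w
    using assms by (cases w) (auto simp: in_set_enumerate_eq nth_eq_iff_index_eq)
  then have "?F \<noteq> []" by (metis empty_iff empty_set)
  then have "hd ?F = (j, X ! j)" using F hd_in_set by blast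
  then show ?thesis by (simp add: label_def)
qed

lemma bij_betw_label:
  assumes "distinct X"
  shows "bij_betw (label X) (set X) {..<length X}"
proof (rule bij_betw_byWitness[where f'="(!) X"])
  show "\<forall>z\<in>set X. X ! label X z = z"
    using label_nth[OF assms] by (metis in_set_conv_nth)
  show "label X ` set X \<subseteq> {..<length X}"
    using label_nth[OF assms] by (metis image_subsetI in_set_conv_nth lessThan_iff)
qed (auto simp: label_nth[OF assms])

text \<open>A single term above \<open>b\<close> exceeds the bound with or without truncation; if
  there is none, nothing is truncated.\<close>

lemma sum_truncate_le_iff:
  fixes f :: "'a \<Rightarrow> nat"
  assumes "finite A"
  shows "(\<Sum>x\<in>A. if f x \<le> b then f x else Suc b) \<le> b \<longleftrightarrow> (\<Sum>x\<in>A. f x) \<le> b"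
proof
  assume le: "(\<Sum>x\<in>A. if f x \<le> b then f x else Suc b) \<le> b"
  have "f x \<le> b" if "x \<in> A" for x
  proof (rule ccontr)
    assume "\<not> f x \<le> b"
    then show False
      using member_le_sum[OF that _ assms, of "\<lambda>x. if f x \<le> b then f x else Suc b"] le by simp
  qed
  then have "(\<Sum>x\<in>A. if f x \<le> b then f x else Suc b) = (\<Sum>x\<in>A. f x)" by simp
  with le show "(\<Sum>x\<in>A. f x) \<le> b" by simp
next
  assume "(\<Sum>x\<in>A. f x) \<le> b"
  moreover have "(\<Sum>x\<in>A. if f x \<le> b then f x else Suc b) \<le> (\<Sum>x\<in>A. f x)"
    by (rule sum_mono) simp
  ultimately show "(\<Sum>x\<in>A. if f x \<le> b then f x else Suc b) \<le> b" by simp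
qed

definition instance_of :: "data \<Rightarrow> instance_sb" where
  "instance_of = (\<lambda>(m, V, k, p, T, b, _). \<lparr>num_cands = m, votes = V, approval = k, preferred = p,
     swap_cost = \<lambda>i a b. T ! i ! a ! b, budget = b\<rparr>)"

text \<open>The minimum cost of a swap enters here: the budget bounds the number of inversions and
  thereby the distance that a candidate can move.\<close>

lemma card_inversions_le:
  assumes "I \<in> instances" "i < num_votes I" "set v = cands I"
  shows "card (inversions v w) \<le> inv_cost I i v w"
proof -
  have "1 \<le> swap_cost I i a c" if "(a, c) \<in> inversions v w" for a c
    using assms that by (auto simp: instances_def min_cost_one_def swaps_def inversions_def)
  then have "(\<Sum>x\<in>inversions v w. 1) \<le> inv_cost I i v w"
    unfolding inv_cost_def by (intro sum_mono) auto
  then show ?thesis by simp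
qed

lemma card_section_le:
  assumes "finite S"
  shows "card {b. (c, b) \<in> S} \<le> card S" "card {a. (a, c) \<in> S} \<le> card S"
proof -
  have "card {b. (c, b) \<in> S} \<le> card (snd ` S)"
    by (rule card_mono) (use assms in force)+
  then show "card {b. (c, b) \<in> S} \<le> card S" using card_image_le[OF assms, of snd] by simp
  have "card {a. (a, c) \<in> S} \<le> card (fst ` S)"
    by (rule card_mono) (use assms in force)+
  then show "card {a. (a, c) \<in> S} \<le> card S" using card_image_le[OF assms, of fst] by simp
qed

section \<open>The kernel of a nontrivial instance\<close>

locale reduction =
  fixes I :: instance_sb
  assumes I: "I \<in> instances" and votes: "votes I \<noteq> []" and k0: "approval I \<noteq> 0"
begin

abbreviation "V \<equiv> votes I"
abbreviation "n \<equiv> num_votes I"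
abbreviation "m \<equiv> num_cands I"
abbreviation "k \<equiv> approval I"
abbreviation "p \<equiv> preferred I"
abbreviation "b \<equiv> budget I"

definition "R = kept b k p V"
definition "X = names R V"
definition "lab = label X"
definition "J = instance_of (reduced R X V k p (cost_table I) b)"

text \<open>The pieces of vote \<open>i\<close> are the part too far above the boundary, the two
  halves of the window, and the part too far below. The boundary is at \<open>min k m\<close> since
  \<open>k\<close> may exceed the number of candidates; truncated subtraction makes
  \<open>lead i\<close> empty if at most \<open>b\<close> candidates are approved.\<close>

definition "lead i = take (min k m - b) (V ! i)"
definition "hi i = drop (min k m - b) (take k (V ! i))"
definition "lo i = take b (drop k (V ! i))"
definition "trail i = drop b (drop k (V ! i))"

definition "real_part = map (\<lambda>c. lab (0, c))"
text \<open>The dummies go to the outer ends of the vote, so that the window stays contiguous around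
  the boundary.\<close>

definition "lead' i = map lab (filter (pad k i (V ! i)) X) @ real_part (filter (\<lambda>c. c \<in> set R) (lead i))"
definition "trail' i = real_part (filter (\<lambda>c. c \<in> set R) (trail i)) @
  map lab (filter (\<lambda>z. fst z \<noteq> 0 \<and> \<not> pad k i (V ! i) z) X)"

lemma vote: "i < n \<Longrightarrow> distinct (V ! i)" "i < n \<Longrightarrow> set (V ! i) = cands I"
  using I by (auto simp: instances_def is_instance_def)

lemma length_vote: "i < n \<Longrightarrow> length (V ! i) = m"
  using vote[of i] by (metis card_lessThan distinct_card)

lemma candidates: "candidates V = [0..<m]"
  using length_vote[of 0] votes by (simp add: candidates_def hd_conv_nth)

lemma p: "p < m"
  using I by (auto simp: instances_def is_instance_def)

lemma take_vote: "take k (V ! i) = lead i @ hi i"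
proof -
  have "min (min k m - b) k = min k m - b" by linarith
  then have "lead i = take (min k m - b) (take k (V ! i))" by (simp add: lead_def)
  then show ?thesis by (simp only: hi_def append_take_drop_id)
qed

lemma drop_vote: "drop k (V ! i) = lo i @ trail i"
  by (simp only: lo_def trail_def append_take_drop_id)

lemma vote_split: "V ! i = lead i @ hi i @ lo i @ trail i"
  by (metis append_assoc append_take_drop_id drop_vote take_vote)

lemma length_lead_hi: "i < n \<Longrightarrow> length (lead i) + length (hi i) = min k m"
  using take_vote[of i] length_vote[of i] by (metis length_append length_take min.commute)

text \<open>Here and in \<open>length_lo\<close>: a half of the window is shorter than
  \<open>b\<close> only if nothing lies beyond it.\<close>

lemma length_hi: "i < n \<Longrightarrow> lead i \<noteq> [] \<Longrightarrow> length (hi i) = b"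
  using length_vote[of i] by (auto simp: lead_def hi_def min_def)

lemma length_lo: "trail i \<noteq> [] \<Longrightarrow> length (lo i) = b"
  by (auto simp: trail_def lo_def)

lemma set_window: "i < n \<Longrightarrow> set (window b k (V ! i)) = set (hi i @ lo i)"
  using length_vote[of i] by (auto simp: window_def hi_def lo_def take_rev min.commute)

lemma set_R_subset: "set R \<subseteq> cands I"
  by (auto simp: R_def kept_def candidates)

lemma distinct_R: "distinct R"
  by (simp add: R_def kept_def candidates)

lemma p_in_R: "p \<in> set R"
  using p by (auto simp: R_def kept_def candidates)

lemma window_subset_R:
  assumes "i < n"
  shows "set (hi i @ lo i) \<subseteq> set R"
proof
  fix c assume c: "c \<in> set (hi i @ lo i)"
  then have "c \<in> set (V ! i)" using vote_split[of i] by auto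
  then have "c < m" using vote assms by auto
  moreover have "\<exists>v\<in>set V. c \<in> set (window b k v)"
    using assms c set_window by (intro bexI[of _ "V ! i"]) auto
  ultimately show "c \<in> set R" by (auto simp: R_def kept_def candidates)
qed

lemma distinct_X: "distinct X"
  unfolding X_def by (rule distinct_names[OF distinct_R])

lemma set_X: "set X = {..n} \<times> set R"
  by (simp add: X_def set_names)

lemma bij_lab: "bij_betw lab (set X) {..<length X}"
  unfolding lab_def by (rule bij_betw_label[OF distinct_X])

lemma lab_eq_iff: "z \<in> set X \<Longrightarrow> w \<in> set X \<Longrightarrow> lab z = lab w \<longleftrightarrow> z = w"
  using bij_lab by (auto simp: bij_betw_def inj_on_def)

lemma lab_ex:
  assumes "a < length X"
  obtains z where "z \<in> set X" "a = lab z"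
proof -
  have "a \<in> lab ` set X" using assms bij_lab by (simp add: bij_betw_def)
  then show ?thesis using that by blast
qed

lemma lab_real_eq_iff: "c \<in> set R \<Longrightarrow> d \<in> set R \<Longrightarrow> lab (0, c) = lab (0, d) \<longleftrightarrow> c = d"
  using lab_eq_iff[of "(0, c)" "(0, d)"] by (auto simp: set_X)

lemma J_simps [simp]:
  "num_cands J = length X" "num_votes J = n" "approval J = length R" "preferred J = lab (0, p)"
  "budget J = b"
  by (simp_all add: J_def instance_of_def reduced_def lab_def)

lemma votes_J: "i < n \<Longrightarrow> votes J ! i = map lab (kernel_vote k R X i (V ! i))"
  by (simp add: J_def instance_of_def reduced_def lab_def nth_enumerate_eq)

text \<open>All candidates of the window are kept, so restricting the vote to \<open>R\<close>
  shortens only \<open>lead i\<close> and \<open>trail i\<close>.\<close>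

lemma kernel_vote_split: "i < n \<Longrightarrow> votes J ! i = lead' i @ real_part (hi i) @ real_part (lo i) @ trail' i"
proof -
  assume i: "i < n"
  have "filter (\<lambda>c. c \<in> set R) (V ! i) =
    filter (\<lambda>c. c \<in> set R) (lead i) @ hi i @ lo i @ filter (\<lambda>c. c \<in> set R) (trail i)"
  proof -
    have "filter (\<lambda>c. c \<in> set R) (hi i) = hi i" "filter (\<lambda>c. c \<in> set R) (lo i) = lo i"
      using window_subset_R[OF i] by (auto simp: filter_id_conv)
    then show ?thesis by (subst vote_split[of i]) simp
  qed
  then show ?thesis
    by (simp add: votes_J[OF i] kernel_vote_def lead'_def trail'_def real_part_def)
qed

lemma distinct_kernel_vote:
  assumes "i < n"
  shows "distinct (kernel_vote k R X i (V ! i))"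
  using vote(1)[OF assms] distinct_X by (auto simp: kernel_vote_def distinct_map inj_on_def pad_def)

lemma set_kernel_vote:
  assumes i: "i < n"
  shows "set (kernel_vote k R X i (V ! i)) = set X"
proof -
  have "set (filter (\<lambda>c. c \<in> set R) (V ! i)) = set R" using set_R_subset vote(2)[OF i] by auto
  then show ?thesis by (auto simp: kernel_vote_def set_X pad_def)
qed

lemma length_cost_table: "length (cost_table I) = n"
  by (simp add: cost_table_def)

lemma cost_J:
  assumes "i < n" "z \<in> set X" "w \<in> set X"
  shows "swap_cost J i (lab z) (lab w) = kernel_cost b (cost_table I ! i) z w"
proof -
  have "X ! lab z = z" "lab z < length X" if "z \<in> set X" for z
    using that label_nth[OF distinct_X] by (auto simp: lab_def in_set_conv_nth)
  then show ?thesis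
    using assms by (simp add: J_def instance_of_def reduced_def length_cost_table)
qed

lemma lookup_cost_table:
  assumes "i < n" "c < m" "d < m" "c \<noteq> d"
  shows "lookup (cost_table I ! i) c d = swap_cost I i c d"
  using assms by (simp add: lookup_def cost_table_def hd_drop_conv_nth)

lemma cost_J_real:
  assumes "i < n" "c \<in> set R" "d \<in> set R" "c \<noteq> d"
  shows "swap_cost J i (lab (0, c)) (lab (0, d)) = (if swap_cost I i c d \<le> b then swap_cost I i c d else Suc b)"
proof -
  have "c < m" "d < m" using assms set_R_subset by auto
  then show ?thesis
    using assms cost_J[of i "(0, c)" "(0, d)"] by (simp add: set_X kernel_cost_def lookup_cost_table)
qed

lemma cost_J_dummy:
  assumes "i < n" "z \<in> set X" "w \<in> set X" "z \<noteq> w" "fst z \<noteq> 0 \<or> fst w \<noteq> 0"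
  shows "swap_cost J i (lab z) (lab w) = Suc b"
  using assms by (auto simp: cost_J kernel_cost_def)

lemma J_instance: "J \<in> instances"
proof -
  have "distinct v \<and> set v = cands J" if v: "v \<in> set (votes J)" for v
  proof -
    obtain i where i: "i < n" "v = votes J ! i" using v by (auto simp: in_set_conv_nth)
    have "inj_on lab (set X)" "lab ` set X = {..<length X}" using bij_lab by (auto simp: bij_betw_def)
    then show ?thesis
      using i distinct_kernel_vote set_kernel_vote by (auto simp: votes_J distinct_map)
  qed
  moreover have "lab (0, p) < length X"
    using bij_lab p_in_R by (auto simp: bij_betw_def set_X)
  moreover have "1 \<le> swap_cost J i x y" if xy: "i < n" "x < length X" "y < length X" "x \<noteq> y" for i x y
  proof -
    obtain z where z1: "z \<in> set X" "x = lab z" using lab_ex[OF xy(2)] by blast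
    obtain w where z2: "w \<in> set X" "y = lab w" using lab_ex[OF xy(3)] by blast
    note z = z1 z2
    have "1 \<le> kernel_cost b (cost_table I ! i) z w"
    proof (cases "fst z = 0 \<and> fst w = 0")
      case True
      have "snd z < m" "snd w < m" "z \<noteq> w" using z xy set_R_subset by (auto simp: set_X)
      then have "1 \<le> swap_cost I i (snd z) (snd w)" "snd z \<noteq> snd w"
        using I True xy by (auto simp: instances_def min_cost_one_def swaps_def prod_eq_iff)
      then show ?thesis
        using xy \<open>snd z < m\<close> \<open>snd w < m\<close> by (simp add: kernel_cost_def lookup_cost_table prod_eq_iff)
    qed (use z xy in \<open>auto simp: kernel_cost_def\<close>)
    then show ?thesis using z xy by (simp add: cost_J)
  qed
  ultimately show ?thesis
    by (auto simp: instances_def is_instance_def min_cost_one_def swaps_def)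
qed

text \<open>For each kept candidate, exactly one of itself and its dummy of vote \<open>i\<close>
  stands before the boundary.\<close>

lemma length_lead'_hi:
  assumes i: "i < n"
  shows "length (lead' i) + length (hi i) = length R"
proof -
  have "length (filter (pad k i (V ! i)) X) = card {c \<in> set R. c \<in> set (drop k (V ! i))}"
  proof -
    have "length (filter (pad k i (V ! i)) X) = card (set (filter (pad k i (V ! i)) X))"
      by (metis distinct_card distinct_filter distinct_X)
    also have "set (filter (pad k i (V ! i)) X) = Pair (Suc i) ` {c \<in> set R. c \<in> set (drop k (V ! i))}"
      using i by (auto simp: set_X pad_def)
    finally show ?thesis by (simp add: card_image inj_on_def)
  qed
  moreover have "length (filter (\<lambda>c. c \<in> set R) (lead i)) + length (hi i) = card {c \<in> set R. c \<in> set (take k (V ! i))}"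
  proof -
    have "length (filter (\<lambda>c. c \<in> set R) (lead i)) + length (hi i) = length (filter (\<lambda>c. c \<in> set R) (take k (V ! i)))"
      using window_subset_R[OF i] by (auto simp: take_vote intro!: arg_cong[where f=length] filter_True[symmetric])
    also have "\<dots> = card (set (filter (\<lambda>c. c \<in> set R) (take k (V ! i))))"
      by (metis distinct_card distinct_filter distinct_take vote(1)[OF i])
    also have "set (filter (\<lambda>c. c \<in> set R) (take k (V ! i))) = {c \<in> set R. c \<in> set (take k (V ! i))}" by auto
    finally show ?thesis .
  qed
  moreover have "card {c \<in> set R. c \<in> set (drop k (V ! i))} + card {c \<in> set R. c \<in> set (take k (V ! i))} = length R"
  proof -
    have "set (V ! i) = set (take k (V ! i)) \<union> set (drop k (V ! i))"
      by (metis append_take_drop_id set_append)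
    then have "{c \<in> set R. c \<in> set (drop k (V ! i))} \<union> {c \<in> set R. c \<in> set (take k (V ! i))} = set R"
      using set_R_subset vote(2)[OF i] by auto
    moreover have "{c \<in> set R. c \<in> set (drop k (V ! i))} \<inter> {c \<in> set R. c \<in> set (take k (V ! i))} = {}"
      using set_take_disj_set_drop_if_distinct[OF vote(1)[OF i], of k k] by auto
    ultimately show ?thesis
      using distinct_R card_Un_disjoint[of "{c \<in> set R. c \<in> set (drop k (V ! i))}" "{c \<in> set R. c \<in> set (take k (V ! i))}"]
      by (simp add: distinct_card)
  qed
  ultimately show ?thesis by (simp add: lead'_def real_part_def)
qed

section \<open>Normal forms of the instance and of the kernel\<close>

abbreviation "perms U \<equiv> \<forall>i<n. distinct (U i) \<and> set (U i) = set (hi i @ lo i)"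
abbreviation "W U \<equiv> map (\<lambda>i. lead i @ U i @ trail i) [0..<n]"
abbreviation "W' U \<equiv> map (\<lambda>i. lead' i @ real_part (U i) @ trail' i) [0..<n]"

lemma normal_form_I:
  "swap_bribery I \<longleftrightarrow> (\<exists>U. perms U \<and> (\<Sum>i<n. inv_cost I i (hi i @ lo i) (U i)) \<le> b \<and>
    winner k (cands I) (W U) p)"
proof -
  have fixed: "(c \<in> set (lead i) \<longrightarrow> card {d. (c, d) \<in> inversions (V ! i) w} \<le> length (hi i)) \<and>
      (c \<in> set (trail i) \<longrightarrow> card {a. (a, c) \<in> inversions (V ! i) w} \<le> length (lo i))"
    if i: "i < n" and w: "distinct w" "set w = cands I" and cost: "inv_cost I i (V ! i) w \<le> b" for i w c
  proof -
    have "card (inversions (V ! i) w) \<le> b"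
      by (rule le_trans[OF card_inversions_le[OF I i vote(2)[OF i]] cost])
    then have "card {d. (c, d) \<in> inversions (V ! i) w} \<le> b" "card {a. (a, c) \<in> inversions (V ! i) w} \<le> b"
      using card_section_le[OF finite_inversions] le_trans by blast+
    then show ?thesis
      using length_hi[OF i] length_lo[of i] by (cases "lead i = []"; cases "trail i = []") auto
  qed
  have "is_instance I" using I by (simp add: instances_def)
  from swap_bribery_normal_form[OF this vote_split length_lead_hi[symmetric] fixed] show ?thesis .
qed

lemma dummy_no_inversions:
  assumes i: "i < n" and w: "set w = cands J" and cost: "inv_cost J i (votes J ! i) w \<le> b"
    and z: "z \<in> set X" "fst z \<noteq> 0"
  shows "(lab z, d) \<notin> inversions (votes J ! i) w" "(d, lab z) \<notin> inversions (votes J ! i) w"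
proof -
  have set: "set (votes J ! i) = cands J" using J_instance i by (auto simp: instances_def is_instance_def)
  have le: "swap_cost J i x y \<le> b" "x < length X" "y < length X" "x \<noteq> y" if "(x, y) \<in> inversions (votes J ! i) w" for x y
  proof -
    have "swap_cost J i x y \<le> inv_cost J i (votes J ! i) w"
      unfolding inv_cost_def using member_le_sum[OF that, of "\<lambda>(x, y). swap_cost J i x y"] by auto
    then show "swap_cost J i x y \<le> b" using cost by simp
    show "x < length X" "y < length X" "x \<noteq> y"
      using that set by (auto simp: inversions_def)
  qed
  show "(lab z, d) \<notin> inversions (votes J ! i) w"
  proof
    assume "(lab z, d) \<in> inversions (votes J ! i) w"
    note le = le[OF this]
    obtain w where w: "w \<in> set X" "d = lab w" using lab_ex[OF le(3)] by blast
    have "z \<noteq> w" using le(4) w by auto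
    then show False using le(1) cost_J_dummy[OF i z(1) w(1)] z(2) w(2) by simp
  qed
  show "(d, lab z) \<notin> inversions (votes J ! i) w"
  proof
    assume "(d, lab z) \<in> inversions (votes J ! i) w"
    note le = le[OF this]
    obtain w where w: "w \<in> set X" "d = lab w" using lab_ex[OF le(2)] by blast
    have "w \<noteq> z" using le(4) w by auto
    then show False using le(1) cost_J_dummy[OF i w(1) z(1)] z(2) w(2) by simp
  qed
qed

text \<open>Where a half of the window is shorter than \<open>b\<close>, nothing lies beyond it in
  the original vote, so only dummies lie beyond it in the kernel vote. These stay in place because
  of their price, not because of their distance.\<close>

lemma normal_form_J:
  "swap_bribery J \<longleftrightarrow> (\<exists>U'. (\<forall>i<n. distinct (U' i) \<and> set (U' i) = set (real_part (hi i) @ real_part (lo i))) \<and>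
    (\<Sum>i<n. inv_cost J i (real_part (hi i) @ real_part (lo i)) (U' i)) \<le> b \<and>
    winner (length R) (cands J) (map (\<lambda>i. lead' i @ U' i @ trail' i) [0..<n]) (lab (0, p)))"
proof -
  have "length R \<le> length X" by (simp add: X_def length_names)
  then have len: "min (approval J) (num_cands J) = length (lead' i) + length (real_part (hi i))" if "i < n" for i
    using length_lead'_hi[OF that] by (simp add: real_part_def)
  have fixed: "(c \<in> set (lead' i) \<longrightarrow> card {d. (c, d) \<in> inversions (votes J ! i) w} \<le> length (real_part (hi i))) \<and>
      (c \<in> set (trail' i) \<longrightarrow> card {a. (a, c) \<in> inversions (votes J ! i) w} \<le> length (real_part (lo i)))"
    if i: "i < num_votes J" and w: "distinct w" "set w = cands J"
      and cost: "inv_cost J i (votes J ! i) w \<le> budget J" for i w c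
  proof -
    have i': "i < n" using i by simp
    have set: "set (votes J ! i) = cands J" using J_instance i by (auto simp: instances_def is_instance_def)
    note dummy = dummy_no_inversions[OF i' w(2) cost[simplified]]
    have "card (inversions (votes J ! i) w) \<le> b"
      using le_trans[OF card_inversions_le[OF J_instance i set] cost] by simp
    then have le: "card {d. (c, d) \<in> inversions (votes J ! i) w} \<le> b" "card {a. (a, c) \<in> inversions (votes J ! i) w} \<le> b"
      using card_section_le[OF finite_inversions] le_trans by blast+
    have "card {d. (c, d) \<in> inversions (votes J ! i) w} \<le> length (hi i)" if c: "c \<in> set (lead' i)"
    proof (cases "lead i = []")
      case True
      with c obtain z where "c = lab z" "z \<in> set X" "fst z \<noteq> 0"
        by (auto simp: lead'_def real_part_def pad_def)
      then show ?thesis using dummy by simp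
    next
      case False
      then show ?thesis using length_hi[OF i'] le by simp
    qed
    moreover have "card {a. (a, c) \<in> inversions (votes J ! i) w} \<le> length (lo i)" if c: "c \<in> set (trail' i)"
    proof (cases "trail i = []")
      case True
      with c obtain z where "c = lab z" "z \<in> set X" "fst z \<noteq> 0"
        by (auto simp: trail'_def real_part_def)
      then show ?thesis using dummy by simp
    next
      case False
      then show ?thesis using length_lo[of i] le by simp
    qed
    ultimately show ?thesis by (simp add: real_part_def)
  qed
  have "is_instance J" using J_instance by (simp add: instances_def)
  from swap_bribery_normal_form[OF this, where ?X=lead' and ?U1.0="\<lambda>i. real_part (hi i)" and ?U2.0="\<lambda>i. real_part (lo i)"
      and ?Y=trail', OF _ len fixed]
  show ?thesis by (simp add: kernel_vote_split)
qed

section \<open>Scores and costs in the instance and in the kernel\<close>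

lemma length_U:
  assumes "perms U" "i < n"
  shows "length (U i) = length (hi i) + length (lo i)"
proof -
  have "distinct (lead i @ hi i @ lo i @ trail i)"
    using vote(1)[OF assms(2)] unfolding vote_split[of i] .
  then have "distinct (hi i @ lo i)" by auto
  then have "length (hi i @ lo i) = card (set (hi i @ lo i))" by (rule distinct_card[symmetric])
  also have "\<dots> = card (set (U i))" using assms by simp
  also have "\<dots> = length (U i)" using assms by (intro distinct_card) blast
  finally show ?thesis by simp
qed

lemma set_W:
  assumes "perms U" "v \<in> set (W U)"
  shows "set v = cands I"
proof -
  from assms(2) obtain i where i: "i < n" "v = lead i @ U i @ trail i" by auto
  have "set (V ! i) = set (lead i) \<union> set (hi i @ lo i) \<union> set (trail i)"
    by (subst vote_split[of i]) auto
  also have "set (hi i @ lo i) = set (U i)" using assms(1) i(1) by blast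
  finally show ?thesis using vote(2)[OF i(1)] i(2) by (simp add: Un_assoc)
qed

lemma set_W':
  assumes "perms U" "v \<in> set (W' U)"
  shows "set v = cands J"
proof -
  from assms(2) obtain i where i: "i < n" "v = lead' i @ real_part (U i) @ trail' i" by auto
  have "set (real_part (U i)) = set (real_part (hi i) @ real_part (lo i))"
    using assms(1) i(1) by (simp add: real_part_def image_Un)
  moreover have "set (votes J ! i) = cands J"
    using J_instance i(1) by (auto simp: instances_def is_instance_def)
  moreover have "set (votes J ! i) = set (lead' i) \<union> set (real_part (hi i) @ real_part (lo i)) \<union> set (trail' i)"
    by (subst kernel_vote_split[OF i(1)]) auto
  ultimately show ?thesis using i(2) by (simp add: Un_assoc)
qed

lemma approved_W:
  assumes "perms U" "i < n"
  shows "set (take k (W U ! i)) = set (lead i) \<union> set (take (length (hi i)) (U i))"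
proof -
  have len: "length (W U ! i) = m"
    using assms(2) length_U[OF assms] length_vote[OF assms(2)] arg_cong[OF vote_split[of i], of length]
    by simp
  then have "take k (W U ! i) = take (min k m) (W U ! i)" by (simp add: min_def)
  also have "\<dots> = take (length (lead i) + length (hi i)) (lead i @ U i @ trail i)"
    using assms(2) length_lead_hi by simp
  finally show ?thesis using length_U[OF assms] by simp
qed

lemma approved_W':
  assumes "perms U" "i < n"
  shows "set (take (length R) (W' U ! i)) = set (lead' i) \<union> set (real_part (take (length (hi i)) (U i)))"
proof -
  have "take (length R) (W' U ! i) = take (length (lead' i) + length (hi i)) (lead' i @ real_part (U i) @ trail' i)"
    using assms(2) length_lead'_hi[OF assms(2)] by simp
  also have "\<dots> = lead' i @ real_part (take (length (hi i)) (U i))"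
    using length_U[OF assms] by (simp add: real_part_def take_map)
  finally show ?thesis by simp
qed

text \<open>In both votes the approved candidates of \<open>R\<close> are those of
  \<open>lead i\<close> and the first \<open>length (hi i)\<close> of the reordered window; approved
  dummies carry other labels.\<close>

lemma score_real:
  assumes U: "perms U" and c: "c \<in> set R"
  shows "score (length R) (W' U) (lab (0, c)) = score k (W U) c"
proof -
  have cX: "(0, c) \<in> set X" using c by (auto simp: set_X)
  have "lab (0, c) \<in> set (take (length R) (W' U ! i)) \<longleftrightarrow> c \<in> set (take k (W U ! i))" if i: "i < n" for i
  proof -
    have pad: "lab (0, c) \<notin> set (map lab (filter (pad k i (V ! i)) X))"
    proof
      assume "lab (0, c) \<in> set (map lab (filter (pad k i (V ! i)) X))"
      then obtain z where "z \<in> set X" "pad k i (V ! i) z" "lab (0, c) = lab z" by auto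
      moreover from this have "z = (0, c)" using lab_eq_iff[OF cX] by metis
      ultimately show False by (simp add: pad_def)
    qed
    have real: "lab (0, c) \<in> set (real_part xs) \<longleftrightarrow> c \<in> set xs" if "set xs \<subseteq> set R" for xs
      using that c lab_real_eq_iff[OF c] by (auto simp: real_part_def)
    have "set (take (length (hi i)) (U i)) \<subseteq> set R"
      using U i window_subset_R[OF i] set_take_subset[of "length (hi i)" "U i"] by auto
    note real_U = real[OF this]
    have "lab (0, c) \<in> set (real_part (filter (\<lambda>c. c \<in> set R) (lead i))) \<longleftrightarrow> c \<in> set (lead i)"
      using c by (subst real) auto
    then show ?thesis
      unfolding approved_W[OF U i] approved_W'[OF U i] unfolding lead'_def set_append Un_iff real_U
      using pad by blast
  qed
  moreover have "score (length R) (W' U) (lab (0, c)) =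
      card {i. i < length (W' U) \<and> lab (0, c) \<in> set (take (length R) (W' U ! i))}"
    by (rule score_eq) (use set_W'[OF U] bij_lab cX in \<open>auto simp: bij_betw_def\<close>)
  moreover have "score k (W U) c = card {i. i < length (W U) \<and> c \<in> set (take k (W U ! i))}"
    by (rule score_eq) (use set_W[OF U] c set_R_subset in auto)
  ultimately show ?thesis by (auto intro!: arg_cong[where f=card])
qed

lemma score_dummy:
  assumes U: "perms U" and z: "z \<in> set X" "fst z \<noteq> 0"
  shows "score (length R) (W' U) (lab z) \<le> 1"
proof -
  have "score (length R) (W' U) (lab z) =
      card {i. i < length (W' U) \<and> lab z \<in> set (take (length R) (W' U ! i))}"
    by (rule score_eq) (use set_W'[OF U] bij_lab z in \<open>auto simp: bij_betw_def\<close>)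
  \<comment> \<open>A dummy with first component \<open>Suc i\<close> can be approved in vote
    \<open>i\<close> only; the shift comes from 0 marking the kept candidates.\<close>
  also have "\<dots> \<le> card {fst z - 1}"
  proof (rule card_mono)
    have "i = fst z - 1" if i: "i < n" and lead: "lab z \<in> set (take (length R) (W' U ! i))" for i
    proof -
      have real: "lab z \<notin> set (real_part xs)" if "set xs \<subseteq> set R" for xs
      proof
        assume "lab z \<in> set (real_part xs)"
        then obtain c where "c \<in> set xs" "lab z = lab (0, c)" by (auto simp: real_part_def)
        with that z lab_eq_iff[OF z(1), of "(0, c)"] show False by (auto simp: set_X)
      qed
      have "set (take (length (hi i)) (U i)) \<subseteq> set R"
        using U i window_subset_R[OF i] set_take_subset[of "length (hi i)" "U i"] by auto
      from real[OF this] real[of "filter (\<lambda>c. c \<in> set R) (lead i)"]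
      have "lab z \<in> set (map lab (filter (pad k i (V ! i)) X))"
        using lead unfolding approved_W'[OF U i] unfolding lead'_def by auto
      then have "pad k i (V ! i) z" using lab_eq_iff[OF z(1)] by auto
      then show ?thesis by (simp add: pad_def)
    qed
    then show "{i. i < length (W' U) \<and> lab z \<in> set (take (length R) (W' U ! i))} \<subseteq> {fst z - 1}"
      by auto
  qed simp
  finally show ?thesis by simp
qed

lemma frozen_iff: "c \<in> set (frozen b k V) \<longleftrightarrow> c < m \<and> (\<forall>i<n. c \<notin> set (hi i @ lo i))"
  using set_window by (auto simp: frozen_def candidates all_set_conv_all_nth)

lemma score_frozen:
  assumes U: "perms U" and c: "c \<in> set (frozen b k V)"
  shows "score k (W U) c = approvals k V c"
proof -
  have "score k (W U) c = card {i. i < length (W U) \<and> c \<in> set (take k (W U ! i))}"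
    by (rule score_eq) (use set_W[OF U] c in \<open>auto simp: frozen_iff\<close>)
  also have "{i. i < length (W U) \<and> c \<in> set (take k (W U ! i))} = {i. i < n \<and> c \<in> set (take k (V ! i))}"
  proof -
    have "c \<in> set (take k (W U ! i)) \<longleftrightarrow> c \<in> set (take k (V ! i))" if i: "i < n" for i
      unfolding approved_W[OF U i] take_vote
      using c i U set_take_subset[of "length (hi i)" "U i"] by (auto simp: frozen_iff)
    then show ?thesis by auto
  qed
  also have "card \<dots> = approvals k V c"
    by (simp add: approvals_def length_filter_conv_card)
  finally show ?thesis .
qed

lemma best_frozen:
  assumes "frozen b k V \<noteq> []"
  obtains e where "e \<in> set R" "e \<in> set (frozen b k V)"
    "\<And>d. d \<in> set (frozen b k V) \<Longrightarrow> approvals k V d \<le> approvals k V e"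
proof -
  let ?F = "frozen b k V" and ?s = "approvals k V"
  let ?B = "filter (\<lambda>d. \<forall>e\<in>set ?F. ?s e \<le> ?s d) ?F"
  have "Max (?s ` set ?F) \<in> ?s ` set ?F" using assms by (intro Max_in) auto
  then obtain d where "d \<in> set ?F" "?s d = Max (?s ` set ?F)" by auto
  then have "d \<in> set ?B" by auto
  then obtain e es where B: "?B = e # es" by (cases ?B) auto
  then have "e \<in> set ?B" by simp
  then have e: "e \<in> set ?F" "\<forall>d\<in>set ?F. ?s d \<le> ?s e" by auto
  have "e \<in> set (best_frozen b k V)" by (simp add: best_frozen_def B)
  then have "e \<in> set R" using e by (auto simp: R_def kept_def candidates frozen_iff)
  with e show ?thesis using that by blast
qed

text \<open>Kept candidates have the same scores on both sides. What remains is to see that neither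
  the added dummies nor the deleted candidates decide the election.\<close>

lemma winner_iff:
  assumes U: "perms U"
  shows "winner k (cands I) (W U) p \<longleftrightarrow> winner (length R) (cands J) (W' U) (lab (0, p))"
proof
  assume win: "winner k (cands I) (W U) p"
  \<comment> \<open>The candidate ranked first in vote 0 is approved, as \<open>k\<close> is
    positive. So the winner \<open>p\<close> has a point as well, and no dummy exceeds it.\<close>
  have n0: "0 < n" using votes by simp
  have "set (W U ! 0) = cands I" by (rule set_W[OF U]) (use n0 in simp)
  then have "W U ! 0 \<noteq> []" using p by (metis empty_iff empty_set lessThan_iff)
  then obtain c vs where cvs: "W U ! 0 = c # vs" by (cases "W U ! 0") auto
  then have c: "c \<in> cands I" using \<open>set (W U ! 0) = cands I\<close> by auto
  have "0 < score k (W U) c"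
  proof -
    have "score k (W U) c = card {i. i < length (W U) \<and> c \<in> set (take k (W U ! i))}"
      by (rule score_eq) (use set_W[OF U] c in auto)
    moreover have "0 \<in> {i. i < length (W U) \<and> c \<in> set (take k (W U ! i))}"
      using n0 k0 by (simp add: cvs take_Cons' del: nth_map)
    ultimately show ?thesis by (metis (no_types, lifting) card_gt_0_iff empty_iff finite_nat_set_iff_bounded mem_Collect_eq)
  qed
  moreover have "score k (W U) c \<le> score k (W U) p"
    using win c unfolding winner_def by blast
  ultimately have pos: "1 \<le> score k (W U) p" by linarith
  have "score (length R) (W' U) d \<le> score (length R) (W' U) (lab (0, p))" if d: "d \<in> cands J" for d
  proof -
    obtain z where z: "z \<in> set X" "d = lab z" using lab_ex d by auto
    show ?thesis
    proof (cases "fst z = 0")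
      case True
      then obtain c where c: "z = (0, c)" "c \<in> set R" using z by (cases z) (auto simp: set_X)
      then show ?thesis
        using win set_R_subset by (auto simp: z score_real[OF U] p_in_R winner_def)
    next
      case False
      then show ?thesis
        using score_dummy[OF U z(1)] pos by (simp add: z score_real[OF U p_in_R])
    qed
  qed
  then show "winner (length R) (cands J) (W' U) (lab (0, p))"
    using J_instance unfolding winner_def instances_def is_instance_def by simp
next
  assume win: "winner (length R) (cands J) (W' U) (lab (0, p))"
  have real: "score k (W U) c \<le> score k (W U) p" if c: "c \<in> set R" for c
  proof -
    have "lab (0, c) \<in> cands J" using c bij_lab by (auto simp: bij_betw_def set_X)
    then have "score (length R) (W' U) (lab (0, c)) \<le> score (length R) (W' U) (lab (0, p))"
      using win unfolding winner_def by blast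
    then show ?thesis unfolding score_real[OF U c] score_real[OF U p_in_R] .
  qed
  have "score k (W U) d \<le> score k (W U) p" if d: "d \<in> cands I" for d
  proof (cases "d \<in> set R")
    case False
    \<comment> \<open>A deleted candidate lies in no window, so its score is fixed and some kept
      frozen candidate scores at least as much.\<close>
    then have fd: "d \<in> set (frozen b k V)"
      using d by (auto simp: R_def kept_def candidates frozen_def)
    then have "frozen b k V \<noteq> []" by auto
    then obtain e where e: "e \<in> set R" "e \<in> set (frozen b k V)" "approvals k V d \<le> approvals k V e"
      using best_frozen fd by metis
    then show ?thesis using real[OF e(1)] by (simp add: score_frozen[OF U] fd)
  qed (rule real)
  then show "winner k (cands I) (W U) p" using p by (simp add: winner_def)
qed

lemma cost_iff:
  assumes U: "perms U"
  shows "(\<Sum>i<n. inv_cost J i (real_part (hi i) @ real_part (lo i)) (real_part (U i))) \<le> b \<longleftrightarrow>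
    (\<Sum>i<n. inv_cost I i (hi i @ lo i) (U i)) \<le> b"
proof -
  \<comment> \<open>The budget applies to the total over all votes, so the sums are merged into one
    over triples before truncation is compared.\<close>
  let ?S = "Sigma {..<n} (\<lambda>i. inversions (hi i @ lo i) (U i))"
  let ?f = "\<lambda>x. swap_cost I (fst x) (fst (snd x)) (snd (snd x))"
  have J: "inv_cost J i (real_part (hi i) @ real_part (lo i)) (real_part (U i)) =
    (\<Sum>(c, d)\<in>inversions (hi i @ lo i) (U i). if swap_cost I i c d \<le> b then swap_cost I i c d else Suc b)"
    if i: "i < n" for i
  proof -
    let ?r = "\<lambda>c. lab (0, c)"
    have inj: "inj_on ?r (set (hi i @ lo i))"
      using window_subset_R[OF i] lab_real_eq_iff by (meson inj_onI subsetD)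
    have "inversions (real_part (hi i) @ real_part (lo i)) (real_part (U i)) =
      map_prod ?r ?r ` inversions (hi i @ lo i) (U i)"
      using inversions_map[OF inj, of "U i"] U i by (simp add: real_part_def)
    moreover have "inj_on (map_prod ?r ?r) (inversions (hi i @ lo i) (U i))"
      by (rule inj_on_subset[OF map_prod_inj_on[OF inj inj] inversions_subset])
    moreover have "swap_cost J i (?r c) (?r d) = (if swap_cost I i c d \<le> b then swap_cost I i c d else Suc b)"
      if "(c, d) \<in> inversions (hi i @ lo i) (U i)" for c d
    proof (rule cost_J_real[OF i])
      show "c \<in> set R" "d \<in> set R" "c \<noteq> d"
        using that window_subset_R[OF i] by (auto simp: inversions_def)
    qed
    ultimately show ?thesis
      unfolding inv_cost_def by (auto simp: sum.reindex intro!: sum.cong)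
  qed
  have "(\<Sum>i<n. inv_cost J i (real_part (hi i) @ real_part (lo i)) (real_part (U i))) =
    (\<Sum>x\<in>?S. if ?f x \<le> b then ?f x else Suc b)"
    by (simp add: J sum.Sigma split_def)
  moreover have "(\<Sum>i<n. inv_cost I i (hi i @ lo i) (U i)) = (\<Sum>x\<in>?S. ?f x)"
    by (simp add: inv_cost_def sum.Sigma split_def)
  ultimately show ?thesis
    using sum_truncate_le_iff[where A="?S" and b=b and f="?f"] by simp
qed

lemma swap_bribery_J: "swap_bribery J \<longleftrightarrow> swap_bribery I"
proof
  assume "swap_bribery I"
  then obtain U where U: "perms U" "(\<Sum>i<n. inv_cost I i (hi i @ lo i) (U i)) \<le> b" "winner k (cands I) (W U) p"
    using normal_form_I by blast
  have "distinct (real_part (U i)) \<and> set (real_part (U i)) = set (real_part (hi i) @ real_part (lo i))" if i: "i < n" for i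
  proof -
    have "inj_on (\<lambda>c. lab (0, c)) (set (hi i @ lo i))"
      using window_subset_R[OF i] lab_real_eq_iff by (meson inj_onI subsetD)
    then show ?thesis using U(1) i by (auto simp: real_part_def distinct_map)
  qed
  then show "swap_bribery J"
    unfolding normal_form_J using U cost_iff[OF U(1)] winner_iff[OF U(1)]
    by (intro exI[of _ "\<lambda>i. real_part (U i)"]) simp
next
  assume "swap_bribery J"
  then obtain U' where U': "\<And>i. i < n \<Longrightarrow> distinct (U' i) \<and> set (U' i) = set (real_part (hi i) @ real_part (lo i))"
    "(\<Sum>i<n. inv_cost J i (real_part (hi i) @ real_part (lo i)) (U' i)) \<le> b"
    "winner (length R) (cands J) (map (\<lambda>i. lead' i @ U' i @ trail' i) [0..<n]) (lab (0, p))"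
    unfolding normal_form_J by blast
  let ?r = "\<lambda>c. lab (0, c)"
  \<comment> \<open>The window orders in the kernel use labels of kept candidates only, so they can
    be pulled back along the injective labelling.\<close>
  define U where "U i = map (inv_into (set R) ?r) (U' i)" for i
  have inj: "inj_on ?r (set R)" using lab_real_eq_iff by (meson inj_onI)
  have sub: "set (U' i) \<subseteq> ?r ` set R" if "i < n" for i
    using U'(1)[OF that] window_subset_R[OF that] by (auto simp: real_part_def)
  have r: "real_part (U i) = U' i" if i: "i < n" for i
    using sub[OF i]
    by (auto simp: U_def real_part_def intro!: map_idI f_inv_into_f[where f="\<lambda>c. lab (0, c)"])
  have perms: "perms U"
  proof (intro allI impI conjI)
    fix i assume i: "i < n"
    show "distinct (U i)"
      using U'(1)[OF i] sub[OF i] by (auto simp: U_def distinct_map intro: inj_on_subset[OF inj_on_inv_into])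
    have "set (U i) = inv_into (set R) ?r ` (?r ` set (hi i @ lo i))"
      using U'(1)[OF i] by (simp add: U_def real_part_def image_Un)
    also have "\<dots> = set (hi i @ lo i)"
      by (rule inv_into_image_cancel[OF inj window_subset_R[OF i]])
    finally show "set (U i) = set (hi i @ lo i)" .
  qed
  have W': "W' U = map (\<lambda>i. lead' i @ U' i @ trail' i) [0..<n]" by (simp add: r)
  have "(\<Sum>i<n. inv_cost J i (real_part (hi i) @ real_part (lo i)) (real_part (U i))) \<le> b"
    using U'(2) by (simp add: r)
  then have "(\<Sum>i<n. inv_cost I i (hi i @ lo i) (U i)) \<le> b"
    unfolding cost_iff[OF perms] .
  moreover have "winner k (cands I) (W U) p"
    unfolding winner_iff[OF perms] W' by (rule U'(3))
  ultimately show "swap_bribery I"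
    unfolding normal_form_I using perms by blast
qed

lemma length_R: "length R \<le> 2 + 2 * n * b"
proof -
  have "length R = card (set R)" using distinct_R by (simp add: distinct_card)
  also have "set R \<subseteq> {p} \<union> (\<Union>i<n. set (window b k (V ! i))) \<union> set (best_frozen b k V)"
    by (auto simp: R_def kept_def set_conv_nth[of V])
  then have "card (set R) \<le> card ({p} \<union> (\<Union>i<n. set (window b k (V ! i))) \<union> set (best_frozen b k V))"
    by (intro card_mono) auto
  also have "\<dots> \<le> card {p} + card (\<Union>i<n. set (window b k (V ! i))) + card (set (best_frozen b k V))"
    by (meson add_mono card_Un_le le_refl le_trans)
  also have "card (\<Union>i<n. set (window b k (V ! i))) \<le> (\<Sum>i<n. 2 * b)"
  proof (rule order_trans[OF card_UN_le sum_mono])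
    fix i assume "i \<in> {..<n}"
    have "card (set (window b k (V ! i))) \<le> length (window b k (V ! i))" by (rule card_length)
    also have "\<dots> \<le> 2 * b" by (simp add: window_def)
    finally show "card (set (window b k (V ! i))) \<le> 2 * b" .
  qed simp
  also have "card (set (best_frozen b k V)) \<le> 1"
    by (rule order_trans[OF card_length]) (simp add: best_frozen_def)
  finally show ?thesis by simp
qed

text \<open>The costs of \<open>J\<close> are read off the computed table by index. The cost table
  of \<open>J\<close> must be that table again, zeros on the diagonal included, for the encoding of
  \<open>J\<close> to be the tree that the program outputs.\<close>

lemma cost_table_J: "cost_table J = map (\<lambda>t. map (\<lambda>z. map (kernel_cost b t z) X) X) (cost_table I)"
proof -
  have "map (\<lambda>i. map (\<lambda>x. map (\<lambda>y. if x = y then 0 else swap_cost J i x y) [0..<length X]) [0..<length X]) [0..<n] ! i =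
    map (\<lambda>t. map (\<lambda>z. map (kernel_cost b t z) X) X) (cost_table I) ! i" if i: "i < n" for i
  proof -
    have cost: "(if x = y then 0 else swap_cost J i x y) = kernel_cost b (cost_table I ! i) (X ! x) (X ! y)"
      if "x < length X" "y < length X" for x y
      using that i distinct_X
      by (simp add: J_def instance_of_def reduced_def length_cost_table nth_eq_iff_index_eq kernel_cost_def)
    show ?thesis using i by (auto simp: length_cost_table simp flip: cost intro!: nth_equalityI)
  qed
  then show ?thesis
    by (intro nth_equalityI) (simp_all add: cost_table_def[of J] length_cost_table)
qed

lemma num_cands_J: "num_cands J \<le> (n + 1) * (2 + 2 * n * b)"
proof -
  have "num_cands J = (n + 1) * length R" by (simp add: X_def length_names)
  also have "\<dots> \<le> (n + 1) * (2 + 2 * n * b)" by (rule mult_le_mono2[OF length_R])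
  finally show ?thesis .
qed

lemma swap_cost_J_le:
  assumes "(i, x, y) \<in> swaps J"
  shows "swap_cost J i x y \<le> Suc b"
proof -
  from assms have i: "i < n" and xy: "x < length X" "y < length X" by (auto simp: swaps_def)
  obtain z where z: "z \<in> set X" "x = lab z" using lab_ex[OF xy(1)] by blast
  obtain w where w: "w \<in> set X" "y = lab w" using lab_ex[OF xy(2)] by blast
  show ?thesis unfolding z(2) w(2) cost_J[OF i z(1) w(1)] by (simp add: kernel_cost_def)
qed

end

section \<open>The kernelization and its correctness\<close>

definition instance_data :: "instance_sb \<Rightarrow> data" where
  "instance_data I = (num_cands I, votes I, approval I, preferred I, cost_table I, budget I, ())"

lemma enc_instance_data: "enc_instance I = enc_data (instance_data I)"
  by (simp add: enc_instance_def enc_data_def instance_data_def enc_pair_def)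

definition kernel :: "instance_sb \<Rightarrow> instance_sb" where
  "kernel I = instance_of (kernel_data (votes I) (approval I) (preferred I) (cost_table I) (budget I))"

abbreviation "yes_instance \<equiv> instance_of trivial_yes"
abbreviation "no_instance \<equiv> instance_of trivial_no"

lemma kernel_cases:
  assumes I: "I \<in> instances"
  obtains "votes I = [] \<or> approval I = 0" "kernel I = yes_instance"
  | "votes I \<noteq> []" "budget I = 0" "\<forall>c<num_cands I. approvals (approval I) (votes I) c \<le> approvals (approval I) (votes I) (preferred I)"
    "kernel I = yes_instance"
  | "votes I \<noteq> []" "budget I = 0" "\<not> (\<forall>c<num_cands I. approvals (approval I) (votes I) c \<le> approvals (approval I) (votes I) (preferred I))"
    "kernel I = no_instance"
  | "votes I \<noteq> []" "budget I \<noteq> 0" "reduction I" "kernel I = reduction.J I"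
proof (cases "votes I = [] \<or> approval I = 0")
  case True
  then show ?thesis using that(1) by (auto simp: kernel_def kernel_data_def)
next
  case False
  then have red: "reduction I" using I by unfold_locales auto
  then interpret reduction I .
  show ?thesis
  proof (cases "budget I = 0")
    case True
    then have "kernel I = (if \<forall>c<m. approvals k V c \<le> approvals k V p then yes_instance else no_instance)"
      using False by (auto simp: kernel_def kernel_data_def candidates Ball_def)
    then show ?thesis
      using that(2,3) False True by (cases "\<forall>c<m. approvals k V c \<le> approvals k V p") simp_all
  next
    case b: False
    then have "kernel I = J" using False by (simp add: kernel_def kernel_data_def J_def R_def X_def)
    then show ?thesis using that(4) False b red by blast
  qed
qed

lemma instance_data_yes: "instance_data yes_instance = trivial_yes"
  by (simp add: instance_data_def instance_of_def trivial_yes_def cost_table_def)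

lemma instance_data_no: "instance_data no_instance = trivial_no"
  by (simp add: instance_data_def instance_of_def trivial_no_def cost_table_def upt_rec numeral_2_eq_2)

lemma yes_instance: "yes_instance \<in> instances"
  by (auto simp: instances_def is_instance_def min_cost_one_def swaps_def instance_of_def trivial_yes_def)

lemma no_instance: "no_instance \<in> instances"
  by (auto simp: instances_def is_instance_def min_cost_one_def swaps_def instance_of_def trivial_no_def
      less_2_cases_iff)

text \<open>The program outputs encoded data, whereas the kernel is a record with a cost function.
  Passing to the record and back must therefore leave the data unchanged.\<close>

lemma instance_data_kernel:
  assumes "I \<in> instances"
  shows "instance_data (kernel I) = kernel_data (votes I) (approval I) (preferred I) (cost_table I) (budget I)"
proof -
  let ?D = "kernel_data (votes I) (approval I) (preferred I) (cost_table I) (budget I)"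
  have "?D = trivial_yes \<or> ?D = trivial_no \<or>
      votes I \<noteq> [] \<and> approval I \<noteq> 0 \<and> ?D = reduced (kept (budget I) (approval I) (preferred I) (votes I))
        (names (kept (budget I) (approval I) (preferred I) (votes I)) (votes I)) (votes I) (approval I) (preferred I) (cost_table I) (budget I)"
    by (auto simp: kernel_data_def)
  then consider "?D = trivial_yes" | "?D = trivial_no" | "votes I \<noteq> []" "approval I \<noteq> 0"
     "?D = reduced (kept (budget I) (approval I) (preferred I) (votes I))
        (names (kept (budget I) (approval I) (preferred I) (votes I)) (votes I)) (votes I) (approval I) (preferred I) (cost_table I) (budget I)"
    by blast
  then show ?thesis
  proof cases
    case 3
    interpret reduction I using assms 3 by unfold_locales auto
    have D: "?D = reduced R X V k p (cost_table I) b" using 3 by (simp add: R_def X_def)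
    then have K: "kernel I = J" by (simp add: kernel_def J_def)
    show ?thesis
      unfolding instance_data_def K cost_table_J D
      by (simp add: J_def instance_of_def reduced_def)
  qed (simp_all add: kernel_def instance_data_yes instance_data_no)
qed

lemma score_approvals:
  assumes "I \<in> instances" "c < num_cands I"
  shows "score k (votes I) c = approvals k (votes I) c"
proof -
  have "score k (votes I) c = card {i. i < num_votes I \<and> c \<in> set (take k (votes I ! i))}"
    by (rule score_eq) (use assms in \<open>auto simp: instances_def is_instance_def\<close>)
  then show ?thesis by (simp add: approvals_def length_filter_conv_card)
qed

lemma winner_swap_bribery:
  assumes "I \<in> instances" "winner (approval I) (cands I) (votes I) (preferred I)"
  shows "swap_bribery I"
proof -
  have "inv_cost I i v v = 0" for i v by (auto simp: inv_cost_def inversions_def intro!: sum.neutral)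
  then show ?thesis
    using assms by (subst swap_bribery_inversions) (auto simp: instances_def is_instance_def intro!: exI[of _ "votes I"])
qed

lemma swap_bribery_trivial:
  assumes "I \<in> instances" "votes I = [] \<or> approval I = 0"
  shows "swap_bribery I"
proof (rule winner_swap_bribery[OF assms(1)])
  have "score (approval I) (votes I) c = 0" for c
    using assms(2) by (auto simp: score_def rank_def)
  then show "winner (approval I) (cands I) (votes I) (preferred I)"
    using assms(1) by (simp add: winner_def instances_def is_instance_def)
qed

text \<open>Two different votes over the same candidates have an inversion, which costs at least 1.
  With budget 0 the votes stay as they are.\<close>

lemma swap_bribery_budget_0:
  assumes I: "I \<in> instances" and b: "budget I = 0"
  shows "swap_bribery I \<longleftrightarrow>
    (\<forall>c<num_cands I. approvals (approval I) (votes I) c \<le> approvals (approval I) (votes I) (preferred I))"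
proof -
  have p: "preferred I < num_cands I" using I by (auto simp: instances_def is_instance_def)
  have V: "distinct (votes I ! i)" "set (votes I ! i) = cands I" if "i < num_votes I" for i
    using I that by (auto simp: instances_def is_instance_def)
  have "winner (approval I) (cands I) (votes I) (preferred I)" if "swap_bribery I"
  proof -
    from that obtain W where W: "length W = num_votes I"
      "\<And>i. i < num_votes I \<Longrightarrow> distinct (W ! i) \<and> set (W ! i) = cands I"
      "(\<Sum>i<num_votes I. inv_cost I i (votes I ! i) (W ! i)) \<le> budget I"
      "winner (approval I) (cands I) W (preferred I)"
      using swap_bribery_inversions[of I] I by (auto simp: instances_def)
    have "W ! i = votes I ! i" if i: "i < num_votes I" for i
    proof (rule ccontr)
      assume "W ! i \<noteq> votes I ! i"
      then obtain x y where "(x, y) \<in> inversions (votes I ! i) (W ! i)"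
        using ex_adjacent_inversion[of "votes I ! i" "W ! i"] V[OF i] W(2)[OF i] by metis
      then have "card (inversions (votes I ! i) (W ! i)) \<noteq> 0" by auto
      moreover have "inv_cost I i (votes I ! i) (W ! i) = 0" using W(3) b i by simp
      ultimately show False using card_inversions_le[OF I i V(2)[OF i], of "W ! i"] by simp
    qed
    then have "W = votes I" using W(1) by (intro nth_equalityI) auto
    then show ?thesis using W(4) by simp
  qed
  then have "swap_bribery I \<longleftrightarrow> winner (approval I) (cands I) (votes I) (preferred I)"
    using winner_swap_bribery[OF I] by blast
  then show ?thesis using p by (auto simp: winner_def score_approvals[OF I])
qed

lemma kernel_correct:
  assumes I: "I \<in> instances"
  shows "kernel I \<in> instances" "swap_bribery (kernel I) \<longleftrightarrow> swap_bribery I"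
proof -
  have yes: "swap_bribery yes_instance"
    by (rule swap_bribery_trivial[OF yes_instance]) (simp add: instance_of_def trivial_yes_def)
  have no: "\<not> swap_bribery no_instance"
    by (subst swap_bribery_budget_0[OF no_instance])
      (auto simp: instance_of_def trivial_no_def approvals_def intro!: exI[of _ 0])
  from I show "kernel I \<in> instances"
    by (cases rule: kernel_cases) (simp_all add: yes_instance no_instance reduction.J_instance)
  from I show "swap_bribery (kernel I) \<longleftrightarrow> swap_bribery I"
    by (cases rule: kernel_cases)
      (simp_all add: yes no swap_bribery_trivial swap_bribery_budget_0 I reduction.swap_bribery_J)
qed

text \<open>The maximum with 1 accounts for budget 0, where the products vanish but the kernel still
  has a candidate.\<close>

lemma kernel_bounds:
  assumes I: "I \<in> instances"
  shows "num_votes (kernel I) \<le> 8 * max 1 (num_votes I ^ 2 * budget I)"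
    "num_cands (kernel I) \<le> 8 * max 1 (num_votes I ^ 2 * budget I ^ 2)"
proof -
  have trivial: "num_votes yes_instance = 0" "num_cands yes_instance = 1"
      "num_votes no_instance = 1" "num_cands no_instance = 2"
    by (simp_all add: instance_of_def trivial_yes_def trivial_no_def)
  have "num_votes (kernel I) \<le> 8 * max 1 (num_votes I ^ 2 * budget I) \<and>
    num_cands (kernel I) \<le> 8 * max 1 (num_votes I ^ 2 * budget I ^ 2)"
    using I
  proof (cases rule: kernel_cases)
    case 4
    let ?n = "num_votes I" and ?b = "budget I"
    have n: "1 \<le> ?n" and b: "1 \<le> ?b" using 4 by (auto simp: Suc_le_eq)
    then have nb: "1 \<le> ?n * ?b" by simp
    have "num_votes (kernel I) = ?n" using 4 by (simp add: reduction.J_simps)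
    moreover have "?n \<le> ?n ^ 2 * ?b"
      using mult_le_mono2[OF nb, of ?n] by (simp add: power2_eq_square mult.assoc)
    moreover have "num_cands (kernel I) \<le> 8 * (?n ^ 2 * ?b ^ 2)"
    proof -
      have "num_cands (kernel I) \<le> (?n + 1) * (2 + 2 * ?n * ?b)"
        using reduction.num_cands_J[OF 4(3)] 4(4) by simp
      \<comment> \<open>\<open>1 \<le> ?n\<close> and \<open>1 \<le> ?n * ?b\<close> give the
        constant 8. The further factor \<open>?b\<close> below only brings the bound into the
        claimed form.\<close>
      also have "\<dots> \<le> (2 * ?n) * (4 * (?n * ?b))"
      proof (rule mult_le_mono)
        show "2 + 2 * ?n * ?b \<le> 4 * (?n * ?b)" using nb unfolding mult.assoc by linarith
      qed (use n in simp)
      also have "\<dots> \<le> (2 * ?n) * (4 * (?n * ?b)) * ?b"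
        using mult_le_mono2[OF b, of "(2 * ?n) * (4 * (?n * ?b))"] by simp
      also have "\<dots> = 8 * (?n ^ 2 * ?b ^ 2)" by (simp add: power2_eq_square)
      finally show ?thesis .
    qed
    ultimately show ?thesis by linarith
  qed (simp_all add: trivial le_max_iff_disj)
  then show "num_votes (kernel I) \<le> 8 * max 1 (num_votes I ^ 2 * budget I)"
    "num_cands (kernel I) \<le> 8 * max 1 (num_votes I ^ 2 * budget I ^ 2)" by simp_all
qed

section \<open>Size of the kernel and a computable bound\<close>

lemma size_enc_instance_le:
  assumes I: "I \<in> instances" and B: "num_votes I \<le> B" "num_cands I \<le> B" "approval I \<le> B" "budget I \<le> B"
    and cost: "\<And>i a b. (i, a, b) \<in> swaps I \<Longrightarrow> swap_cost I i a b \<le> B"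
  shows "size (enc_pair enc_instance enc_name (I, param_n_budget I)) \<le> (2 * B + 2) ^ 10"
proof -
  \<comment> \<open>\<open>C - 1\<close> bounds an encoded number. A list of at most
    \<open>B\<close> entries of size at most \<open>C ^ j - 1\<close> has size at most
    \<open>C ^ Suc j - 1\<close>, so each of the three list levels of the cost table adds one to the
    exponent.\<close>
  define C where "C = 2 * B + 2"
  have C: "2 \<le> C" by (simp add: C_def)
  have nat: "size (enc_nat a) \<le> C - 1" if "a \<le> B" for a
    using size_enc_nat[of a] that by (simp add: C_def)
  have list: "size (enc_list e xs) \<le> C ^ Suc j - 1"
    if "length xs \<le> B" "\<And>x. x \<in> set xs \<Longrightarrow> size (e x) \<le> C ^ j - 1" for e :: "'x \<Rightarrow> tree" and xs j
  proof -
    have "size (enc_list e xs) \<le> B * Suc (C ^ j - 1)" by (rule size_enc_list_le[OF that])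
    also have "Suc (C ^ j - 1) = C ^ j" using C by simp
    also have "B * C ^ j \<le> (C - 1) * C ^ j" by (simp add: C_def)
    also have "\<dots> = C ^ Suc j - C ^ j" by (simp add: diff_mult_distrib)
    also have "\<dots> \<le> C ^ Suc j - 1" using C by (intro diff_le_mono2) simp
    finally show ?thesis .
  qed
  have V: "distinct v" "set v = cands I" if "v \<in> set (votes I)" for v
    using I that by (auto simp: instances_def is_instance_def)
  have V': "length v \<le> B" if "v \<in> set (votes I)" for v
    using V[OF that] B(2) by (metis card_lessThan distinct_card)
  have p: "preferred I \<le> B" using I B(2) by (auto simp: instances_def is_instance_def)
  have nats: "size (enc_nats xs) \<le> C ^ 2 - 1" if "length xs \<le> B" "\<And>x. x \<in> set xs \<Longrightarrow> x \<le> B" for xs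
    using list[of xs enc_nat 1] nat that by (simp add: power2_eq_square)
  have votes: "size (enc_votes (votes I)) \<le> C ^ 3 - 1"
    using list[of "votes I" enc_nats 2] B(1) V V' nats B(2)
    by (simp add: eval_nat_numeral) (metis le_trans lessThan_iff less_imp_le_nat)
  have table: "size (enc_table (cost_table I)) \<le> C ^ 4 - 1"
  proof -
    have row: "size (enc_nats (map (\<lambda>b. if a = b then 0 else swap_cost I i a b) [0..<num_cands I])) \<le> C ^ 2 - 1"
      if "i < num_votes I" "a < num_cands I" for i a
      using that B(2) cost by (intro nats) (auto simp: swaps_def)
    have matrix: "size (enc_votes (map (\<lambda>a. map (\<lambda>b. if a = b then 0 else swap_cost I i a b) [0..<num_cands I]) [0..<num_cands I])) \<le> C ^ Suc 2 - 1"
      if "i < num_votes I" for i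
      by (rule list) (use that B(2) row in auto)
    have "size (enc_table (cost_table I)) \<le> C ^ Suc (Suc 2) - 1"
      unfolding cost_table_def by (rule list) (use B(1) matrix in auto)
    then show ?thesis by (simp add: eval_nat_numeral)
  qed
  have "size (enc_pair enc_instance enc_name (I, param_n_budget I)) \<le>
      8 + 6 * (C - 1) + (C ^ 3 - 1) + (C ^ 4 - 1)"
    using nat[OF B(1)] nat[OF B(2)] nat[OF B(3)] nat[OF B(4)] nat[OF p] votes table
    by (simp add: size_enc_pair enc_instance_data enc_data_def instance_data_def param_n_budget_def)
  also have "\<dots> \<le> 8 + 6 * C + C ^ 3 + C ^ 4" by simp
  \<comment> \<open>The coefficients 8, 6, 1 and 1 add up to 16, which is at most
    \<open>C ^ 4\<close> as \<open>C\<close> is at least 2.\<close>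
  also have "\<dots> \<le> 16 * C ^ 4"
  proof -
    have "C \<le> C ^ 4" "C ^ 3 \<le> C ^ 4" "1 \<le> C ^ 4"
      using C power_increasing[of 1 4 C] power_increasing[of 3 4 C] by auto
    then show ?thesis by simp
  qed
  also have "\<dots> = 2 ^ 4 * C ^ 4" by simp
  also have "\<dots> \<le> C ^ 4 * C ^ 4" using C by (intro mult_le_mono1 power_mono) auto
  also have "\<dots> = C ^ 8" by (simp flip: power_add)
  also have "\<dots> \<le> C ^ 10" using C by (intro power_increasing) auto
  finally show ?thesis by (simp add: C_def)
qed

lemma size_kernel_le:
  assumes I: "I \<in> instances"
  shows "size (enc_pair enc_instance enc_name (kernel I, param_n_budget (kernel I))) \<le>
    (num_votes I + budget I + 2) ^ 60"
proof -
  \<comment> \<open>The summand 2 lets powers of \<open>N\<close> absorb all constants: the kernel's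
    numbers are at most \<open>N ^ 4\<close>, and then \<open>(2 * N ^ 4 + 2) ^ 10\<close> is at
    most \<open>N ^ 60\<close>.\<close>
  define N where "N = num_votes I + budget I + 2"
  have N: "2 \<le> N" by (simp add: N_def)
  have NN: "N \<le> N ^ 4" using N power_increasing[of 1 4 N] by simp
  have "num_votes (kernel I) \<le> N ^ 4 \<and> num_cands (kernel I) \<le> N ^ 4 \<and> approval (kernel I) \<le> N ^ 4 \<and>
    budget (kernel I) \<le> N ^ 4 \<and> (\<forall>i a b. (i, a, b) \<in> swaps (kernel I) \<longrightarrow> swap_cost (kernel I) i a b \<le> N ^ 4)"
    (is "?P (kernel I)")
  proof -
    have yes: "?P yes_instance"
      using N NN by (auto simp: instance_of_def trivial_yes_def swaps_def)
    have no: "?P no_instance"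
      using N NN by (auto simp: instance_of_def trivial_no_def swaps_def less_2_cases_iff)
    from I show ?thesis
    proof (cases rule: kernel_cases)
      case 4
      let ?n = "num_votes I" and ?b = "budget I"
      interpret reduction I by (rule 4(3))
      have "num_cands J \<le> (?n + 1) * (2 + 2 * ?n * ?b)" by (rule num_cands_J)
      also have "\<dots> \<le> N * N ^ 3"
      proof (rule mult_le_mono)
        have "?n * ?b \<le> (N - 2) * (N - 2)" by (rule mult_le_mono) (simp_all add: N_def)
        moreover obtain j where j: "N = j + 2" using N by (metis add.commute le_Suc_ex)
        ultimately have "2 + 2 * ?n * ?b \<le> 2 + 2 * (j * j)" by simp
        also have "\<dots> \<le> N ^ 3" by (simp add: j power3_eq_cube algebra_simps)
        finally show "2 + 2 * ?n * ?b \<le> N ^ 3" .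
      qed (simp add: N_def)
      finally have cands: "length X \<le> N ^ 4" by (simp add: eval_nat_numeral)
      moreover have "length R \<le> length X" by (simp add: X_def length_names)
      moreover have "n \<le> N" "b \<le> N" "Suc b \<le> N" by (auto simp: N_def)
      ultimately have "?P J" using NN swap_cost_J_le by (fastforce intro: order_trans)
      then show ?thesis using 4(4) by simp
    qed (use yes no in simp_all)
  qed
  then have "size (enc_pair enc_instance enc_name (kernel I, param_n_budget (kernel I))) \<le> (2 * N ^ 4 + 2) ^ 10"
    by (intro size_enc_instance_le kernel_correct(1)[OF I]) auto
  also have "\<dots> \<le> (N ^ 6) ^ 10"
  proof (rule power_mono)
    have "2 \<le> 2 * N ^ 4" using N by simp
    then have "2 * N ^ 4 + 2 \<le> (2 * 2) * N ^ 4" by simp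
    also have "\<dots> \<le> (N * N) * N ^ 4" using N by (intro mult_le_mono1 mult_le_mono)
    also have "\<dots> = N ^ 6" by (simp add: eval_nat_numeral)
    finally show "2 * N ^ 4 + 2 \<le> N ^ 6" .
  qed simp
  finally show ?thesis by (simp add: N_def flip: power_mult)
qed

lemma less_power_length_bits: "n < 2 ^ length (bits n)"
proof (induction n rule: bits.induct)
  case (1 n)
  show ?case
  proof (cases "n = 0")
    case False
    with 1 have "n div 2 < 2 ^ length (bits (n div 2))" by simp
    then show ?thesis using False by (subst bits.simps) auto
  qed simp
qed

lemma bits_power: "bits (2 ^ j) = replicate j False @ [True]"
proof (induction j)
  case 0
  then show ?case by (simp add: bits.simps[of "Suc 0"])
next
  case (Suc j)
  then show ?case by (subst bits.simps) simp
qed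

text \<open>A power of two, so that its binary encoding is easy to write down.\<close>

definition size_bound :: "nat \<Rightarrow> nat \<times> nat \<Rightarrow> nat" where
  "size_bound d z = 2 ^ (d * (length (bits (fst z)) + length (bits (snd z)) + 1))"

text \<open>With the least significant digit first, a power of two is a block of zeros followed by a
  one. The block consists of \<open>d\<close> copies of the two digit lists and one extra entry, all
  turned into zeros.\<close>

lemma ptime_size_bound: "ptime enc_name enc_nat (size_bound d)"
proof -
  have "ptime enc_name (enc_list enc_bool) (\<lambda>z. concat (map (\<lambda>_. map (\<lambda>_. False)
    (bits (fst z) @ bits (snd z) @ [False])) (replicate d ())) @ [True])"
    by (rule ptime_intros ptime_const[where eb="enc_list enc_unit"])+
  then show ?thesis
  proof (rule ptime_recode_out)
    fix z :: "nat \<times> nat"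
    have rep: "concat (map (\<lambda>_. map (\<lambda>_. False) xs) (replicate d ())) = replicate (d * length xs) False" for xs :: "bool list"
      by (induction d) (simp_all add: map_replicate_const replicate_add)
    show "enc_nat (size_bound d z) = enc_list enc_bool (concat (map (\<lambda>_. map (\<lambda>_. False)
      (bits (fst z) @ bits (snd z) @ [False])) (replicate d ())) @ [True])"
      unfolding rep by (simp add: enc_nat_bits size_bound_def bits_power)
  qed
qed

lemma size_bound_ge: "(a + b + 2) ^ d \<le> size_bound d (a, b)"
proof -
  let ?x = "length (bits a)" and ?y = "length (bits b)"
  have "a + 1 \<le> 2 ^ ?x" "b + 1 \<le> 2 ^ ?y"
    using less_power_length_bits[of a] less_power_length_bits[of b] by simp_all
  moreover have "(2::nat) ^ ?x \<le> 2 ^ (?x + ?y)" "(2::nat) ^ ?y \<le> 2 ^ (?x + ?y)" by simp_all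
  moreover have "(2::nat) ^ (?x + ?y + 1) = 2 ^ (?x + ?y) + 2 ^ (?x + ?y)" by simp
  ultimately have "a + b + 2 \<le> 2 ^ (?x + ?y + 1)" by linarith
  then have "(a + b + 2) ^ d \<le> (2 ^ (?x + ?y + 1)) ^ d" by (rule power_mono) simp
  then show ?thesis by (simp only: size_bound_def fst_conv snd_conv mult.commute[of d] power_mult)
qed

lemma ptime_computable: "ptime ea eb f \<Longrightarrow> computable ea eb f"
  unfolding ptime_def computable_def implements_def runs_def computes_in_def
  by (metis fun_upd_same)

text \<open>Functions and encodings are compared on \<open>A\<close> only, because
  \<open>instance_data_kernel\<close> is available for instances only.\<close>

lemma poly_time_on_recode:
  assumes "poly_time_on UNIV ea eb f" "\<And>x. x \<in> A \<Longrightarrow> ea' x = ea (h x)" "\<And>x. x \<in> A \<Longrightarrow> eb' (g x) = eb (f (h x))"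
  shows "poly_time_on A ea' eb' g"
  using assms unfolding poly_time_on_def by (metis UNIV_I)

theorem theorem8:
  shows "\<exists>K (c :: nat).
    kernelization instances swap_bribery param_n_budget enc_instance (enc_pair enc_nat enc_nat) K \<and>
    (\<forall>I\<in>instances. num_votes (K I) \<le> c * max 1 (num_votes I ^ 2 * budget I) \<and>
           num_cands (K I) \<le> c * max 1 (num_votes I ^ 2 * budget I ^ 2))"
proof (intro exI conjI)
  let ?enc = "\<lambda>x. enc_pair enc_instance enc_name (x, param_n_budget x)"
  have enc: "?enc x = enc_pair enc_data enc_name (instance_data x, param_n_budget x)" for x
    by (simp add: enc_pair_def enc_instance_data)
  have "poly_time_on instances ?enc ?enc kernel"
  proof (rule poly_time_on_recode[OF ptime_poly_time_on[OF ptime_kernel] enc])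
    fix I assume I: "I \<in> instances"
    show "?enc (kernel I) = enc_pair enc_data enc_name (let D = kernel_data (fst (snd (fst (instance_data I, param_n_budget I))))
        (fst (snd (snd (fst (instance_data I, param_n_budget I)))))
        (fst (snd (snd (snd (fst (instance_data I, param_n_budget I))))))
        (fst (snd (snd (snd (snd (fst (instance_data I, param_n_budget I)))))))
        (fst (snd (snd (snd (snd (snd (fst (instance_data I, param_n_budget I))))))))
      in (D, length (fst (snd D)), fst (snd (snd (snd (snd (snd D)))))))"
      unfolding enc instance_data_def[of I] fst_conv snd_conv Let_def instance_data_kernel[OF I, symmetric]
      by (simp add: instance_data_def param_n_budget_def)
  qed
  moreover have "size (?enc (kernel I)) \<le> size_bound 60 (param_n_budget I)" if "I \<in> instances" for I
    using size_kernel_le[OF that] size_bound_ge[of "num_votes I" "budget I" 60]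
    by (simp add: param_n_budget_def)
  ultimately show "kernelization instances swap_bribery param_n_budget enc_instance (enc_pair enc_nat enc_nat) kernel"
    using kernel_correct ptime_computable[OF ptime_size_bound[of 60]] by (auto simp: kernelization_def)
  show "\<forall>I\<in>instances. num_votes (kernel I) \<le> 8 * max 1 (num_votes I ^ 2 * budget I) \<and>
      num_cands (kernel I) \<le> 8 * max 1 (num_votes I ^ 2 * budget I ^ 2)"
    using kernel_bounds by blast
qed

end
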